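(* Let $\Omega\subseteq\mathbb{C}^n$ be a domain, let $\mathcal{H}\in B_1^*(\Omega)$, and let $l$ be a positive integer. For $i=1,2$ let $\Theta_i:\Omega\to\mathcal{B}(\mathbb{C}^l,\mathbb{C}^{l+1})$ with $\Theta_i\in\mathcal{M}(\mathcal{H})\otimes\mathcal{B}(\mathbb{C}^l,\mathbb{C}^{l+1})$ have a left inverse in $\mathcal{M}(\mathcal{H})\otimes\mathcal{B}(\mathbb{C}^{l+1},\mathbb{C}^l)$. Then the quotient Hilbert modules $\mathcal{H}_{\Theta_1}$ and $\mathcal{H}_{\Theta_2}$ are isomorphic if and only if $$\frac{\partial^2}{\partial w_j\,\partial\bar w_k}\log\|\Delta_{\Theta_1}(w)\|=\frac{\partial^2}{\partial w_j\,\partial\bar w_k}\log\|\Delta_{\Theta_2}(w)\|\qquad\text{for all } w\in\Omega,\ 1\le j,k\le n.$$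
   Context: A Hilbert module over $\mathbb{C}[z_1,\dots,z_n]$ is a Hilbert space $\mathcal{H}$ with commuting bounded operators $M_{z_1},\dots,M_{z_n}$ on it, acting by $p\cdot h=p(M_{z_1},\dots,M_{z_n})h$. A module map is a bounded linear map intertwining the operators $M_{z_i}$; two Hilbert modules are isomorphic if there is a unitary module map between them. A domain is a connected open set. $B_1^*(\Omega)$ is the set of Hilbert modules $\mathcal{H}$ over $\mathbb{C}[z_1,\dots,z_n]$ such that: (i) for every $w\in\Omega$ the column operator $(M_z-wI_{\mathcal{H}})^*:\mathcal{H}\to\mathcal{H}^n$, $h\mapsto (M_{z_1}-w_1I)^*h\oplus\cdots\oplus(M_{z_n}-w_nI)^*h$, has closed range; (ii) $\dim\ker(M_z-wI_{\mathcal{H}})^*=1$ for every $w\in\Omega$; (iii) the closed linear span of $\bigcup_{w\in\Omega}\ker(M_z-wI_{\mathcal{H}})^*$ is $\mathcal{H}$. Write $E^*_{\mathcal{H}}(w)=\ker(M_z-wI_{\mathcal{H}})^*$. $\mathcal{M}(\mathcal{H})$ is the multiplier algebra: functions $\varphi:\Omega\to\mathbb{C}$ for which pointwise multiplication defines a bounded operator $M_\varphi$ on $\mathcal{H}$ (elements of $\mathcal{H}$ being regarded, locally, as functions on $\Omega$ via evaluation against $E_{\mathcal{H}}^*(w)$); equivalently there is a bounded $M_\varphi$ on $\mathcal{H}$ with $M_\varphi^*k=\overline{\varphi(w)}k$ for all $w\in\Omega$, $k\in E^*_{\mathcal{H}}(w)$. An element $\Theta=[\theta_{i,j}]$ of $\mathcal{M}(\mathcal{H})\otimes\mathcal{B}(\mathbb{C}^p,\mathbb{C}^q)$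 is a $q\times p$ matrix of multipliers, and $M_\Theta:\mathcal{H}\otimes\mathbb{C}^p\to\mathcal{H}\otimes\mathbb{C}^q$ is the corresponding matrix of operators $[M_{\theta_{i,j}}]$. $\Psi$ is a left inverse of $\Theta$ if $\Psi(w)\Theta(w)=I$ for all $w\in\Omega$. For $\Theta$ as in the claim, $\mathcal{H}_\Theta=(\mathcal{H}\otimes\mathbb{C}^{l+1})/M_\Theta(\mathcal{H}\otimes\mathbb{C}^l)$ with the quotient norm and induced module action. For $\Theta=[\theta_{i,j}]:\Omega\to\mathcal{B}(\mathbb{C}^l,\mathbb{C}^{l+1})$ and $\{e_i\}_{i=1}^{l+1}$ the standard orthonormal basis of $\mathbb{C}^{l+1}$, $\Delta_\Theta(w)\in\mathbb{C}^{l+1}$ is the formal determinant $$\Delta_\Theta(w)=\det\begin{bmatrix} e_1&\theta_{1,1}(w)&\cdots&\theta_{1,l}(w)\\ \vdots&\vdots&&\vdots\\ e_{l+1}&\theta_{l+1,1}(w)&\cdots&\theta_{l+1,l}(w)\end{bmatrix},$$ which is non-zero for every $w$ when $\Theta$ has a left inverse; $\|\cdot\|$ is the Euclidean norm on $\mathbb{C}^{l+1}$. *)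

theory Defs
  imports "HOL-Analysis.Analysis" "HOL-Library.Set_Algebras"
begin

section \<open>Complex Hilbert spaces\<close>

text \<open>The real inner product of the superclass is the real part of the complex one, so norm, topology
  and completeness are those of the library.  Positive definiteness of \<open>cinner\<close> is inherited:
  \<open>cinner x x\<close> is real by conjugate symmetry and has real part \<open>inner x x\<close>.  The complex inner
  product is linear in its first argument.\<close>

class chilbert_space = real_inner + banach +
  fixes scaleC :: "complex \<Rightarrow> 'a \<Rightarrow> 'a"  (infixr \<open>*\<^sub>C\<close> 75)
    and cinner :: "'a \<Rightarrow> 'a \<Rightarrow> complex"
  assumes scaleC_add_right: "a *\<^sub>C (x + y) = a *\<^sub>C x + a *\<^sub>C y"
    and scaleC_add_left: "(a + b) *\<^sub>C x = a *\<^sub>C x + b *\<^sub>C x"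
    and scaleC_scaleC: "a *\<^sub>C b *\<^sub>C x = (a * b) *\<^sub>C x"
    and scaleC_of_real: "complex_of_real r *\<^sub>C x = r *\<^sub>R x"
    and cinner_commute: "cinner x y = cnj (cinner y x)"
    and cinner_add_left: "cinner (x + y) z = cinner x z + cinner y z"
    and cinner_scaleC_left: "cinner (a *\<^sub>C x) y = a * cinner x y"
    and inner_eq_Re_cinner: "inner x y = Re (cinner x y)"

lemma scaleC_one: "1 *\<^sub>C x = (x :: 'a::chilbert_space)"
  using scaleC_of_real[of 1 x] by simp

global_interpretation complex_vector: vector_space "scaleC :: complex \<Rightarrow> 'a \<Rightarrow> 'a::chilbert_space"
  defines cspan = complex_vector.span
    and cdim = complex_vector.dim
  by unfold_locales (simp_all add: scaleC_add_right scaleC_add_left scaleC_scaleC scaleC_one)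

text \<open>The Hilbert space tensor product of \<open>\<H>\<close> with \<open>\<complex>\<^sup>p\<close> is realised as the
  \<open>p\<close>-fold orthogonal direct sum \<open>'h ^ 'p\<close>.\<close>

instantiation vec :: (chilbert_space, finite) chilbert_space
begin

definition scaleC_vec :: "complex \<Rightarrow> 'a ^ 'b \<Rightarrow> 'a ^ 'b" where
  "scaleC_vec c x = (\<chi> i. c *\<^sub>C x $ i)"

definition cinner_vec :: "'a ^ 'b \<Rightarrow> 'a ^ 'b \<Rightarrow> complex" where
  "cinner_vec x y = (\<Sum>i\<in>UNIV. cinner (x $ i) (y $ i))"

instance
proof
  fix a b :: complex and r :: real and x y z :: "'a ^ 'b"
  show "a *\<^sub>C (x + y) = a *\<^sub>C x + a *\<^sub>C y"
    by (simp add: scaleC_vec_def vec_eq_iff scaleC_add_right)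
  show "(a + b) *\<^sub>C x = a *\<^sub>C x + b *\<^sub>C x"
    by (simp add: scaleC_vec_def vec_eq_iff scaleC_add_left)
  show "a *\<^sub>C b *\<^sub>C x = (a * b) *\<^sub>C x"
    by (simp add: scaleC_vec_def vec_eq_iff scaleC_scaleC)
  show "complex_of_real r *\<^sub>C x = r *\<^sub>R x"
    by (simp add: scaleC_vec_def vec_eq_iff scaleC_of_real)
  show "cinner x y = cnj (cinner y x)"
    unfolding cinner_vec_def cnj_sum by (rule sum.cong[OF refl]) (rule cinner_commute)
  show "cinner (x + y) z = cinner x z + cinner y z"
    by (simp add: cinner_vec_def cinner_add_left sum.distrib)
  show "cinner (a *\<^sub>C x) y = a * cinner x y"
    by (simp add: cinner_vec_def scaleC_vec_def cinner_scaleC_left sum_distrib_left)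
  show "inner x y = Re (cinner x y)"
    by (simp add: inner_vec_def cinner_vec_def inner_eq_Re_cinner)
qed

end

definition bounded_clinear :: "('a::chilbert_space \<Rightarrow> 'b::chilbert_space) \<Rightarrow> bool" where
  "bounded_clinear T \<longleftrightarrow> bounded_linear T \<and> (\<forall>c x. T (c *\<^sub>C x) = c *\<^sub>C T x)"

text \<open>For bounded complex linear \<open>T\<close> the operator chosen exists and is unique; likewise for
  \<open>mult_op\<close> below.\<close>

definition cadjoint :: "('a::chilbert_space \<Rightarrow> 'b::chilbert_space) \<Rightarrow> 'b \<Rightarrow> 'a" where
  "cadjoint T = (SOME S. \<forall>x y. cinner (T x) y = cinner x (S y))"

section \<open>Hilbert modules and the class \<open>B\<^sub>1\<^sup>*(\<Omega>)\<close>\<close>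

text \<open>The action of the polynomial ring in the variables \<open>z\<^sub>i\<close>, \<open>i :: 'n\<close>, is given by the
  commuting tuple \<open>M\<close> of multiplication operators by the coordinates.\<close>

definition hilbert_module :: "('n::finite \<Rightarrow> 'h::chilbert_space \<Rightarrow> 'h) \<Rightarrow> bool" where
  "hilbert_module M \<longleftrightarrow> (\<forall>i. bounded_clinear (M i)) \<and> (\<forall>i j. M i \<circ> M j = M j \<circ> M i)"

definition col_adjoint ::
  "('n::finite \<Rightarrow> 'h::chilbert_space \<Rightarrow> 'h) \<Rightarrow> complex ^ 'n \<Rightarrow> 'h \<Rightarrow> 'h ^ 'n" where
  "col_adjoint M w h = (\<chi> i. cadjoint (\<lambda>x. M i x - (w $ i) *\<^sub>C x) h)"

definition eigenspace_star ::
  "('n::finite \<Rightarrow> 'h::chilbert_space \<Rightarrow> 'h) \<Rightarrow> complex ^ 'n \<Rightarrow> 'h set" where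
  "eigenspace_star M w = {h. col_adjoint M w h = 0}"

definition B1_star ::
  "(complex ^ 'n::finite) set \<Rightarrow> ('n \<Rightarrow> 'h::chilbert_space \<Rightarrow> 'h) set" where
  "B1_star \<Omega> = {M. hilbert_module M
     \<and> (\<forall>w\<in>\<Omega>. closed (range (col_adjoint M w)))
     \<and> (\<forall>w\<in>\<Omega>. cdim (eigenspace_star M w) = 1)
     \<and> closure (cspan (\<Union>w\<in>\<Omega>. eigenspace_star M w)) = UNIV}"

section \<open>Multipliers\<close>

definition is_mult_op ::
  "('n::finite \<Rightarrow> 'h::chilbert_space \<Rightarrow> 'h) \<Rightarrow> (complex ^ 'n) set
   \<Rightarrow> (complex ^ 'n \<Rightarrow> complex) \<Rightarrow> ('h \<Rightarrow> 'h) \<Rightarrow> bool" where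
  "is_mult_op M \<Omega> \<phi> T \<longleftrightarrow> bounded_clinear T
     \<and> (\<forall>w\<in>\<Omega>. \<forall>k\<in>eigenspace_star M w. cadjoint T k = cnj (\<phi> w) *\<^sub>C k)"

definition multipliers ::
  "('n::finite \<Rightarrow> 'h::chilbert_space \<Rightarrow> 'h) \<Rightarrow> (complex ^ 'n) set
   \<Rightarrow> (complex ^ 'n \<Rightarrow> complex) set" where
  "multipliers M \<Omega> = {\<phi>. \<exists>T. is_mult_op M \<Omega> \<phi> T}"

definition mult_op ::
  "('n::finite \<Rightarrow> 'h::chilbert_space \<Rightarrow> 'h) \<Rightarrow> (complex ^ 'n) set
   \<Rightarrow> (complex ^ 'n \<Rightarrow> complex) \<Rightarrow> 'h \<Rightarrow> 'h" where
  "mult_op M \<Omega> \<phi> = (SOME T. is_mult_op M \<Omega> \<phi> T)"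

text \<open>A value of type \<open>complex ^ 'p ^ 'q\<close> is a matrix with rows indexed by \<open>'q\<close> and columns by
  \<open>'p\<close>, i.e. a linear map from \<open>\<complex>\<^sup>p\<close> to \<open>\<complex>\<^sup>q\<close>.\<close>

definition mult_matrices ::
  "('n::finite \<Rightarrow> 'h::chilbert_space \<Rightarrow> 'h) \<Rightarrow> (complex ^ 'n) set
   \<Rightarrow> (complex ^ 'n \<Rightarrow> complex ^ 'p::finite ^ 'q::finite) set" where
  "mult_matrices M \<Omega> = {\<Theta>. \<forall>i j. (\<lambda>w. \<Theta> w $ i $ j) \<in> multipliers M \<Omega>}"

definition mult_matrix_op ::
  "('n::finite \<Rightarrow> 'h::chilbert_space \<Rightarrow> 'h) \<Rightarrow> (complex ^ 'n) set
   \<Rightarrow> (complex ^ 'n \<Rightarrow> complex ^ 'p::finite ^ 'q::finite) \<Rightarrow> 'h ^ 'p \<Rightarrow> 'h ^ 'q" where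
  "mult_matrix_op M \<Omega> \<Theta> x =
     (\<chi> i. \<Sum>j\<in>UNIV. mult_op M \<Omega> (\<lambda>w. \<Theta> w $ i $ j) (x $ j))"

definition left_inverse_on ::
  "(complex ^ 'n) set \<Rightarrow> (complex ^ 'n \<Rightarrow> complex ^ 'q::finite ^ 'p::finite)
   \<Rightarrow> (complex ^ 'n \<Rightarrow> complex ^ 'p ^ 'q) \<Rightarrow> bool" where
  "left_inverse_on \<Omega> \<Psi> \<Theta> \<longleftrightarrow> (\<forall>w\<in>\<Omega>. \<Psi> w ** \<Theta> w = mat 1)"

section \<open>Quotient modules and isomorphism\<close>

record ('a, 'n) module_data =
  Mcarrier :: "'a set"
  Madd :: "'a \<Rightarrow> 'a \<Rightarrow> 'a"
  Mscale :: "complex \<Rightarrow> 'a \<Rightarrow> 'a"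
  Mnorm :: "'a \<Rightarrow> real"
  Mact :: "'n \<Rightarrow> 'a \<Rightarrow> 'a"

text \<open>For a subspace \<open>S\<close> the elements of the quotient are the cosets \<open>x +o S\<close>.  If \<open>T\<close> is linear
  and maps \<open>S\<close> into itself, the operator it induces sends \<open>A = x +o S\<close> to
  \<open>T ` A + S = T x +o S\<close>; adding \<open>S\<close> is needed because \<open>T ` A\<close> may be only a part of a coset.\<close>

definition induced_op :: "'a::plus set \<Rightarrow> ('a \<Rightarrow> 'a) \<Rightarrow> 'a set \<Rightarrow> 'a set" where
  "induced_op S T A = T ` A + S"

definition quotient_module ::
  "('n \<Rightarrow> 'a \<Rightarrow> 'a) \<Rightarrow> 'a::chilbert_space set \<Rightarrow> ('a set, 'n) module_data" where
  "quotient_module N S =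
    \<lparr> Mcarrier = range (\<lambda>x. x +o S),
      Madd = (\<lambda>A B. A + B),
      Mscale = (\<lambda>c. induced_op S (scaleC c)),
      Mnorm = (\<lambda>A. INF x\<in>A. norm x),
      Mact = (\<lambda>i. induced_op S (N i)) \<rparr>"

text \<open>\<open>\<H>\<^sub>\<Theta>\<close>, the quotient of the \<open>q\<close>-fold direct sum of \<open>\<H>\<close>, on which the coordinates act
  entrywise, by the range of \<open>M\<^sub>\<Theta>\<close>.\<close>

definition quotient_by ::
  "('n::finite \<Rightarrow> 'h::chilbert_space \<Rightarrow> 'h) \<Rightarrow> (complex ^ 'n) set
   \<Rightarrow> (complex ^ 'n \<Rightarrow> complex ^ 'p::finite ^ 'q::finite)
   \<Rightarrow> (('h ^ 'q) set, 'n) module_data" where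
  "quotient_by M \<Omega> \<Theta> =
     quotient_module (\<lambda>i x. \<chi> k. M i (x $ k)) (range (mult_matrix_op M \<Omega> \<Theta>))"

text \<open>Unitaries are the surjective linear isometries; by polarization these preserve the inner
  products that induce the norms.\<close>

definition unitary_module_map ::
  "('a, 'n) module_data \<Rightarrow> ('b, 'n) module_data \<Rightarrow> ('a \<Rightarrow> 'b) \<Rightarrow> bool" where
  "unitary_module_map X Y U \<longleftrightarrow>
     bij_betw U (Mcarrier X) (Mcarrier Y)
     \<and> (\<forall>x\<in>Mcarrier X. \<forall>y\<in>Mcarrier X. U (Madd X x y) = Madd Y (U x) (U y))
     \<and> (\<forall>c. \<forall>x\<in>Mcarrier X. U (Mscale X c x) = Mscale Y c (U x))
     \<and> (\<forall>x\<in>Mcarrier X. Mnorm Y (U x) = Mnorm X x)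
     \<and> (\<forall>i. \<forall>x\<in>Mcarrier X. U (Mact X i x) = Mact Y i (U x))"

definition isomorphic_modules :: "('a, 'n) module_data \<Rightarrow> ('b, 'n) module_data \<Rightarrow> bool" where
  "isomorphic_modules X Y \<longleftrightarrow> (\<exists>U. unitary_module_map X Y U)"

section \<open>The formal determinant\<close>

text \<open>With \<open>l = CARD('l)\<close>, the set of \<open>l + 1\<close> indices is \<open>'l option\<close>, \<open>None\<close> standing for the
  first and \<open>Some j\<close> for the one following \<open>j\<close>, for rows and columns alike (so no sign depends
  on an ordering of \<open>'l\<close>).  A determinant is linear in its first column, so the \<open>k\<close>-th coordinate
  of the formal determinant is obtained by replacing each \<open>e\<^sub>i\<close> in that column by its \<open>k\<close>-th
  coordinate.\<close>

definition formal_det :: "complex ^ 'l::finite ^ 'l option \<Rightarrow> complex ^ 'l option" where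
  "formal_det A = (\<chi> k. det (\<chi> i j.
     case j of None \<Rightarrow> (axis i 1 :: complex ^ 'l option) $ k | Some j' \<Rightarrow> A $ i $ j'))"

section \<open>Wirtinger derivatives\<close>

definition dir_deriv ::
  "(complex ^ 'n::finite \<Rightarrow> complex) \<Rightarrow> complex ^ 'n \<Rightarrow> complex ^ 'n \<Rightarrow> complex" where
  "dir_deriv f v w = vector_derivative (\<lambda>t::real. f (w + t *\<^sub>R v)) (at 0)"

definition d_dw ::
  "'n::finite \<Rightarrow> (complex ^ 'n \<Rightarrow> complex) \<Rightarrow> complex ^ 'n \<Rightarrow> complex" where
  "d_dw j f w = (dir_deriv f (axis j 1) w - \<i> * dir_deriv f (axis j \<i>) w) / 2"

definition d_dwbar ::
  "'n::finite \<Rightarrow> (complex ^ 'n \<Rightarrow> complex) \<Rightarrow> complex ^ 'n \<Rightarrow> complex" where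
  "d_dwbar k f w = (dir_deriv f (axis k 1) w + \<i> * dir_deriv f (axis k \<i>) w) / 2"

definition log_norm_det ::
  "(complex ^ 'n::finite \<Rightarrow> complex ^ 'l::finite ^ 'l option) \<Rightarrow> complex ^ 'n \<Rightarrow> complex" where
  "log_norm_det \<Theta> w = complex_of_real (ln (norm (formal_det (\<Theta> w))))"

end

theory Submission
  imports Defs "HOL-Complex_Analysis.Conformal_Mappings"
begin

text \<open>Write \<open>\<Delta>\<^sub>i(w)\<close> for the formal determinant of \<open>\<Theta>\<^sub>i(w)\<close>, \<open>K\<^sub>i(w,v)\<close> for the sum over \<open>m\<close> of
\<open>\<Delta>\<^sub>i(w)\<^sub>m\<close> times the conjugate of \<open>\<Delta>\<^sub>i(v)\<^sub>m\<close>, and \<open>k\<^sub>w\<close> for a generator of the line \<open>E\<^sup>*(w)\<close>.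

\<^bold>\<open>The quotients through their eigenvectors.\<close>  The range \<open>S\<^sub>i\<close> of the operator of \<open>\<Theta>\<^sub>i\<close> is closed, because
the operator of a left inverse of \<open>\<Theta>\<^sub>i\<close> inverts it on the left, so the quotient is the orthogonal complement
of \<open>S\<^sub>i\<close> with the compressed operators.  Expanding a determinant along its first column gives
\<open>\<Sum>\<^sub>m \<Delta>\<^sub>i(w)\<^sub>m x\<^sub>m = det [x | \<Theta>\<^sub>i(w)]\<close>, which vanishes exactly for \<open>x\<close> in the range of \<open>\<Theta>\<^sub>i(w)\<close>.  Hence
the joint eigenvectors of the adjoints at \<open>w\<close> in that complement are the multiples of
\<open>\<gamma>\<^sub>i(w) = k\<^sub>w \<otimes> cnj \<Delta>\<^sub>i(w)\<close>, and the \<open>\<gamma>\<^sub>i(w)\<close> with \<open>w \<in> \<Omega>\<close> span it densely; by the identity theorem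
and connectedness of \<open>\<Omega>\<close>, those with \<open>w\<close> in a small ball suffice.

\<^bold>\<open>Isomorphism and normalised kernels.\<close>  A unitary module map sends \<open>\<gamma>\<^sub>1(w)\<close> to a multiple of
\<open>\<gamma>\<^sub>2(w)\<close>.  Comparing Gram matrices near a point \<open>w\<^sub>0\<close> eliminates the unknown factor and leaves
\<open>K\<^sub>1(w,v) K\<^sub>2(w,w\<^sub>0) K\<^sub>2(w\<^sub>0,v) K\<^sub>1(w\<^sub>0,w\<^sub>0) = K\<^sub>2(w,v) K\<^sub>1(w,w\<^sub>0) K\<^sub>1(w\<^sub>0,v) K\<^sub>2(w\<^sub>0,w\<^sub>0)\<close>
for \<open>v = w\<close>.  Conversely, if this equation holds for all \<open>w\<close> and \<open>v\<close> near \<open>w\<^sub>0\<close>, then rescaled families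
\<open>\<gamma>\<^sub>1\<close> and \<open>\<gamma>\<^sub>2\<close> have equal Gram matrices, and the unitary that matches them intertwines the actions,
because the adjoints act on both families by the same scalars.

\<^bold>\<open>Normalised kernels and curvature.\<close>  On the diagonal the equation says that
\<open>log \<parallel>\<Delta>\<^sub>1\<parallel> - log \<parallel>\<Delta>\<^sub>2\<parallel>\<close> differs by a constant from the difference of the \<open>log \<bar>K\<^sub>i(\<cdot>,w\<^sub>0)\<bar>\<close>, and the
logarithm of the modulus of a holomorphic function is pluriharmonic; so the curvatures agree.  If the curvatures
agree, then \<open>log \<parallel>\<Delta>\<^sub>1\<parallel> - log \<parallel>\<Delta>\<^sub>2\<parallel>\<close> is harmonic on each complex line through \<open>w\<^sub>0\<close>, hence the real part of a
holomorphic function there.  Polarizing on the line gives the equation on the diagonal, and polarizing in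
a ball gives it for all \<open>w\<close> and \<open>v\<close>
(\<open>normalised_kernels_agree_of_curvature\<close>, \<open>curvature_eq_of_normalised_kernels\<close>).

All this rests on holomorphy: \<open>k\<^sub>w\<close> can be chosen locally to depend antiholomorphically on \<open>w\<close>
(\<open>antiholomorphic_eigenvector\<close>, the place where closed range enters), and therefore multipliers, in
particular the coordinates of \<open>\<Delta>\<^sub>i\<close>, are holomorphic.\<close>

section \<open>Complex Hilbert spaces and bounded operators\<close>

lemma cinner_scaleC_right: "cinner x (a *\<^sub>C y) = cnj a * cinner x (y::'a::chilbert_space)"
  by (metis cinner_commute cinner_scaleC_left complex_cnj_mult)

lemma cinner_add_right: "cinner x (y + z) = cinner x y + cinner x (z::'a::chilbert_space)"
  by (metis cinner_commute cinner_add_left complex_cnj_add)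

lemma cinner_self: "cinner x x = complex_of_real ((norm (x::'a::chilbert_space))\<^sup>2)"
proof (rule complex_eqI)
  have "Im (cinner x x) = Im (cnj (cinner x x))"
    using cinner_commute[of x x] by simp
  then show "Im (cinner x x) = Im (complex_of_real ((norm x)\<^sup>2))" by simp
  show "Re (cinner x x) = Re (complex_of_real ((norm x)\<^sup>2))"
    by (simp add: inner_eq_Re_cinner[symmetric] power2_norm_eq_inner)
qed

lemma norm_scaleC: "norm (a *\<^sub>C x) = cmod a * norm (x::'a::chilbert_space)"
proof -
  have "complex_of_real ((norm (a *\<^sub>C x))\<^sup>2) = complex_of_real ((cmod a * norm x)\<^sup>2)"
    unfolding cinner_self[symmetric] cinner_scaleC_left cinner_scaleC_right
    by (simp add: cinner_self power_mult_distrib complex_norm_square del: of_real_power)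
  then have "(norm (a *\<^sub>C x))\<^sup>2 = (cmod a * norm x)\<^sup>2"
    by (simp only: of_real_eq_iff)
  then show ?thesis by (simp add: power2_eq_iff_nonneg)
qed

lemma cmod_cinner_le: "cmod (cinner x y) \<le> norm x * norm (y::'a::chilbert_space)"
proof (cases "cinner x y = 0")
  case False
  define c where "c = cnj (cinner x y) / cmod (cinner x y)"
  have "cmod c = 1" using False by (simp add: c_def norm_divide)
  moreover have "cinner (c *\<^sub>C x) y = cmod (cinner x y)"
    using False complex_norm_square[of "cinner x y"]
    by (simp add: cinner_scaleC_left c_def field_simps power2_eq_square)
  then have "inner (c *\<^sub>C x) y = cmod (cinner x y)" by (simp add: inner_eq_Re_cinner)
  ultimately show ?thesis
    using norm_cauchy_schwarz[of "c *\<^sub>C x" y] by (simp add: norm_scaleC)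
qed simp

lemma scaleC_scaleR: "a *\<^sub>C (r *\<^sub>R x) = r *\<^sub>R (a *\<^sub>C (x::'a::chilbert_space))"
  unfolding scaleC_of_real[symmetric] scaleC_scaleC by (simp add: mult.commute)

interpretation scaleC: bounded_bilinear "scaleC :: complex \<Rightarrow> 'a \<Rightarrow> 'a::chilbert_space"
proof
  show "\<exists>K. \<forall>a (b::'a). norm (a *\<^sub>C b) \<le> norm a * norm b * K"
    by (rule exI[of _ 1]) (simp add: norm_scaleC)
  fix r a and b :: 'a
  show "(r *\<^sub>R a) *\<^sub>C b = r *\<^sub>R (a *\<^sub>C b)"
    unfolding scaleC_of_real[symmetric] scaleC_scaleC scaleR_conv_of_real ..
qed (simp_all add: scaleC_add_right scaleC_add_left scaleC_scaleR)

interpretation cinner: bounded_bilinear "cinner :: 'a \<Rightarrow> 'a::chilbert_space \<Rightarrow> complex"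
proof
  show "\<exists>K. \<forall>a (b::'a). norm (cinner a b) \<le> norm a * norm b * K"
    by (rule exI[of _ 1]) (simp add: cmod_cinner_le)
  fix r and a b :: 'a
  show "cinner (r *\<^sub>R a) b = r *\<^sub>R cinner a b"
    unfolding scaleC_of_real[symmetric] cinner_scaleC_left scaleR_conv_of_real ..
  show "cinner a (r *\<^sub>R b) = r *\<^sub>R cinner a b"
    unfolding scaleC_of_real[symmetric] cinner_scaleC_right scaleR_conv_of_real by simp
qed (simp_all add: cinner_add_left cinner_add_right)

lemma cinner_eq_inner: "cinner x y = Complex (inner x y) (inner x (\<i> *\<^sub>C (y::'a::chilbert_space)))"
  by (simp add: inner_eq_Re_cinner cinner_scaleC_right complex_eq_iff)

lemma scaleC_zero [simp]: "a *\<^sub>C (0::'a::chilbert_space) = 0" "0 *\<^sub>C (x::'a) = 0"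
  by (simp_all add: scaleC.zero_right scaleC.zero_left)

lemma scaleC_eq_0_iff [simp]: "a *\<^sub>C (x::'a::chilbert_space) = 0 \<longleftrightarrow> a = 0 \<or> x = 0"
  by (metis norm_eq_zero norm_scaleC mult_eq_0_iff)

lemma cinner_zero [simp]: "cinner 0 (x::'a::chilbert_space) = 0" "cinner (x::'a) 0 = 0"
  by (simp_all add: cinner.zero_left cinner.zero_right)

lemma cinner_eq_zero_iff [simp]: "cinner x x = 0 \<longleftrightarrow> x = (0::'a::chilbert_space)"
  by (simp add: cinner_self)

declare scaleC_one [simp]

lemma bounded_clinearD: "bounded_clinear T \<Longrightarrow> bounded_linear T"
  and bounded_clinear_scaleC: "bounded_clinear T \<Longrightarrow> T (c *\<^sub>C x) = c *\<^sub>C T x"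
  by (simp_all add: bounded_clinear_def)

lemma bounded_clinearI:
  assumes "\<And>x y. T (x + y) = T x + T y" "\<And>c x. T (c *\<^sub>C x) = c *\<^sub>C T x"
    and "\<And>x. norm (T x) \<le> norm x * K"
  shows "bounded_clinear (T :: 'a::chilbert_space \<Rightarrow> 'b::chilbert_space)"
  unfolding bounded_clinear_def
  by (metis assms bounded_linear_intro scaleC_of_real)

lemma bounded_clinear_compose:
  assumes "bounded_clinear S" "bounded_clinear T"
  shows "bounded_clinear (\<lambda>x. S (T x))"
  using assms bounded_linear_compose by (auto simp: bounded_clinear_def)

lemma bounded_clinear_add:
  assumes "bounded_clinear S" "bounded_clinear T"
  shows "bounded_clinear (\<lambda>x. S x + T x)"
  using assms bounded_linear_add by (auto simp: bounded_clinear_def scaleC_add_right)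

lemma bounded_clinear_const_scaleC:
  assumes "bounded_clinear T"
  shows "bounded_clinear (\<lambda>x. c *\<^sub>C T x)"
  using assms bounded_linear_compose[OF scaleC.bounded_linear_right]
  by (auto simp: bounded_clinear_def scaleC_scaleC mult.commute)

lemma bounded_clinear_ident: "bounded_clinear (\<lambda>x. x)"
  by (simp add: bounded_clinear_def bounded_linear_ident)

section \<open>Orthogonal complements and adjoints\<close>

abbreviation csubspace :: "'a::chilbert_space set \<Rightarrow> bool" where
  "csubspace \<equiv> complex_vector.subspace"

lemmas csubspace_0 = complex_vector.subspace_0
  and csubspace_add = complex_vector.subspace_add
  and csubspace_scale = complex_vector.subspace_scale
  and csubspace_diff = complex_vector.subspace_diff
  and csubspace_sum = complex_vector.subspace_sum

lemma csubspace_scaleR: "csubspace S \<Longrightarrow> x \<in> S \<Longrightarrow> r *\<^sub>R x \<in> S"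
  by (metis csubspace_scale scaleC_of_real)

lemma csubspace_imp_convex: "csubspace S \<Longrightarrow> convex S"
  unfolding convex_def by (meson csubspace_add csubspace_scaleR)

definition orthocomp :: "'a::chilbert_space set \<Rightarrow> 'a set" where
  "orthocomp S = {x. \<forall>y\<in>S. cinner x y = 0}"

lemma orthocompI: "(\<And>y. y \<in> S \<Longrightarrow> cinner x y = 0) \<Longrightarrow> x \<in> orthocomp S"
  and orthocompD: "x \<in> orthocomp S \<Longrightarrow> y \<in> S \<Longrightarrow> cinner x y = 0"
  and orthocompD': "x \<in> orthocomp S \<Longrightarrow> y \<in> S \<Longrightarrow> cinner y x = 0"
  by (auto simp: orthocomp_def) (metis cinner_commute complex_cnj_zero)

lemma csubspace_orthocomp: "csubspace (orthocomp S)"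
  unfolding complex_vector.subspace_def
  by (auto simp: orthocomp_def cinner_add_left cinner_scaleC_left)

lemma closed_orthocomp: "closed (orthocomp S)"
proof -
  have "orthocomp S = (\<Inter>y\<in>S. (\<lambda>x. cinner x y) -` {0})" by (auto simp: orthocomp_def)
  moreover have "closed ((\<lambda>x. cinner x y) -` {0})" for y :: 'a
    by (intro closed_vimage closed_singleton linear_continuous_on cinner.bounded_linear_left)
  ultimately show ?thesis by auto
qed

text \<open>The projection is the point of the subspace nearest to \<open>x\<close>.  It exists because by the parallelogram
identity every minimizing sequence is Cauchy.\<close>

lemma ex_orthogonal_projection:
  assumes S: "csubspace S" "closed S"
  shows "\<exists>p\<in>S. x - p \<in> orthocomp (S :: 'a::chilbert_space set)"
proof -
  define \<delta> where "\<delta> = (INF y\<in>S. (norm (x - y))\<^sup>2)"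
  have S0: "0 \<in> S" using S csubspace_0 by blast
  have bdd: "bdd_below ((\<lambda>y. (norm (x - y))\<^sup>2) ` S)" by (rule bdd_belowI[of _ 0]) auto
  have le: "\<delta> \<le> (norm (x - y))\<^sup>2" if "y \<in> S" for y
    unfolding \<delta>_def using bdd that by (rule cINF_lower)
  have "\<exists>y\<in>S. (norm (x - y))\<^sup>2 < \<delta> + inverse (real (Suc n))" for n
    using cINF_less_iff[OF _ bdd, of "\<delta> + inverse (real (Suc n))"] S0
    unfolding \<delta>_def by fastforce
  then obtain y where yS: "\<And>n. y n \<in> S"
    and y: "\<And>n. (norm (x - y n))\<^sup>2 < \<delta> + inverse (real (Suc n))"
    by metis
  have par: "(norm (y m - y n))\<^sup>2 \<le> 2 * inverse (real (Suc m)) + 2 * inverse (real (Suc n))" for m n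
  proof -
    define z where "z = (1/2::real) *\<^sub>R (y m + y n)"
    have "z \<in> S" unfolding z_def by (intro csubspace_scaleR S csubspace_add yS)
    have "(norm (y m - y n))\<^sup>2 = 2 * (norm (x - y m))\<^sup>2 + 2 * (norm (x - y n))\<^sup>2 - 4 * (norm (x - z))\<^sup>2"
      by (simp add: z_def power2_norm_eq_inner inner_diff inner_add inner_commute algebra_simps)
    then show ?thesis using y[of m] y[of n] le[OF \<open>z \<in> S\<close>] by linarith
  qed
  have "Cauchy y"
  proof (rule metric_CauchyI)
    fix e :: real assume "e > 0"
    then obtain N where N: "inverse (real (Suc N)) < e\<^sup>2 / 4"
      using reals_Archimedean[of "e\<^sup>2/4"] by auto
    have "dist (y m) (y n) < e" if "m \<ge> N" "n \<ge> N" for m n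
    proof -
      have "inverse (real (Suc m)) \<le> inverse (real (Suc N))" "inverse (real (Suc n)) \<le> inverse (real (Suc N))"
        using that by (auto intro!: le_imp_inverse_le)
      then have "(norm (y m - y n))\<^sup>2 < e\<^sup>2" using par[of m n] N by linarith
      then show ?thesis using \<open>e > 0\<close> by (simp add: dist_norm power_less_imp_less_base)
    qed
    then show "\<exists>M. \<forall>m\<ge>M. \<forall>n\<ge>M. dist (y m) (y n) < e" by blast
  qed
  then obtain p where p: "y \<longlonglongrightarrow> p" by (meson Cauchy_convergent convergent_def)
  have pS: "p \<in> S" using S(2) yS p closed_sequentially by blast
  have "(\<lambda>n. \<delta> + inverse (real (Suc n))) \<longlonglongrightarrow> \<delta> + 0"
    by (intro tendsto_intros LIMSEQ_inverse_real_of_nat)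
  moreover have "(\<lambda>n. (norm (x - y n))\<^sup>2) \<longlonglongrightarrow> (norm (x - p))\<^sup>2" by (intro tendsto_intros p)
  ultimately have "(norm (x - p))\<^sup>2 \<le> \<delta> + 0"
    using LIMSEQ_le y less_imp_le by meson
  then have "dist x p \<le> dist x z" if "z \<in> S" for z
    using le[OF that] by (metis add.right_neutral dist_norm norm_ge_zero order_trans power2_le_imp_le)
  then have dot: "inner (x - p) (z - p) \<le> 0" if "z \<in> S" for z
    using any_closest_point_dot[OF csubspace_imp_convex[OF S(1)] S(2) pS that] by blast
  have "inner (x - p) z = 0" if "z \<in> S" for z
    using dot[of "p + z"] dot[of "p - z"] that pS S(1)
    by (simp add: csubspace_add csubspace_diff)
  then have "cinner (x - p) z = 0" if "z \<in> S" for z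
    using that S(1) by (simp add: cinner_eq_inner csubspace_scale complex_eq_iff)
  then show ?thesis using pS by (auto simp: orthocomp_def)
qed

lemma orthocomp_Int_self: "x \<in> S \<Longrightarrow> x \<in> orthocomp S \<Longrightarrow> x = 0"
  using orthocompD by fastforce

lemma csubspace_closure:
  assumes "csubspace S" shows "csubspace (closure S)"
  unfolding complex_vector.subspace_def
proof (intro conjI ballI allI)
  show "0 \<in> closure S" using assms closure_subset csubspace_0 by blast
  fix x y :: 'a and c
  assume x: "x \<in> closure S"
  then obtain f where f: "\<And>n. f n \<in> S" "f \<longlonglongrightarrow> x" by (meson closure_sequential)
  show "c *\<^sub>C x \<in> closure S"
    unfolding closure_sequential
    by (rule exI[of _ "\<lambda>n. c *\<^sub>C f n"])
      (use f assms in \<open>auto intro: csubspace_scale scaleC.tendsto\<close>)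
  assume "y \<in> closure S"
  then obtain g where g: "\<And>n. g n \<in> S" "g \<longlonglongrightarrow> y" by (meson closure_sequential)
  show "x + y \<in> closure S"
    unfolding closure_sequential
    by (rule exI[of _ "\<lambda>n. f n + g n"])
      (use f g assms in \<open>auto intro: csubspace_add tendsto_add\<close>)
qed

lemma orthocomp_closure_cspan: "orthocomp (closure (cspan G)) = orthocomp (G :: 'a::chilbert_space set)"
proof
  show "orthocomp (closure (cspan G)) \<subseteq> orthocomp G"
  proof
    fix x assume x: "x \<in> orthocomp (closure (cspan G))"
    show "x \<in> orthocomp G"
      by (intro orthocompI orthocompD[OF x])
        (use closure_subset complex_vector.span_base in blast)
  qed
  show "orthocomp G \<subseteq> orthocomp (closure (cspan G))"
  proof
    fix x assume x: "x \<in> orthocomp G"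
    have "G \<subseteq> orthocomp {x}" using orthocompD'[OF x] by (auto simp: orthocomp_def)
    then have "closure (cspan G) \<subseteq> orthocomp {x}"
      by (intro closure_minimal complex_vector.span_minimal csubspace_orthocomp closed_orthocomp)
    then show "x \<in> orthocomp (closure (cspan G))"
      by (intro orthocompI) (meson insertI1 orthocompD' subsetD)
  qed
qed

text \<open>The form in which families of eigenvectors are shown to span: density is tested on orthogonal vectors.\<close>

lemma closure_cspan_eqI:
  assumes T: "csubspace T" "closed T" "G \<subseteq> T"
    and zero: "\<And>x. x \<in> T \<Longrightarrow> (\<And>g. g \<in> G \<Longrightarrow> cinner x g = 0) \<Longrightarrow> x = 0"
  shows "closure (cspan G) = (T :: 'a::chilbert_space set)"
proof
  show sub: "closure (cspan G) \<subseteq> T" by (intro closure_minimal complex_vector.span_minimal T)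
  show "T \<subseteq> closure (cspan G)"
  proof
    fix x assume "x \<in> T"
    obtain p where p: "p \<in> closure (cspan G)" "x - p \<in> orthocomp (closure (cspan G))"
      using ex_orthogonal_projection[OF csubspace_closure[OF complex_vector.subspace_span]] by blast
    have "x - p = 0"
      by (rule zero) (use p sub \<open>x \<in> T\<close> T in \<open>auto simp: orthocomp_closure_cspan orthocompD intro: csubspace_diff\<close>)
    then show "x \<in> closure (cspan G)" using p by simp
  qed
qed

text \<open>The representing vector spans the orthogonal complement of the kernel of \<open>f\<close>.\<close>

lemma riesz_representation:
  assumes add: "\<And>x y. f (x + y) = f x + f y" and scale: "\<And>c x. f (c *\<^sub>C x) = c * f x"
    and bdd: "\<And>x. cmod (f x) \<le> norm x * K"
  shows "\<exists>y. \<forall>x. f x = cinner x (y :: 'a::chilbert_space)"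
proof (cases "\<forall>x. f x = 0")
  case True
  then show ?thesis by (intro exI[of _ 0]) simp
next
  case False
  then obtain z where z: "f z \<noteq> 0" by blast
  have bl: "bounded_linear f"
    by (rule bounded_linear_intro[where K = K])
      (use add scale bdd in \<open>auto simp: scaleC_of_real[symmetric] scaleR_conv_of_real\<close>)
  then interpret f: bounded_linear f .
  define S where "S = f -` {0}"
  have "csubspace S" by (auto simp: S_def complex_vector.subspace_def add scale f.zero)
  moreover have "closed S" unfolding S_def
    by (intro closed_vimage closed_singleton linear_continuous_on bl)
  ultimately obtain p where p: "p \<in> S" "z - p \<in> orthocomp S"
    using ex_orthogonal_projection by blast
  define u where "u = z - p"
  have fu: "f u = f z" using p(1) by (simp add: u_def S_def f.diff)
  then have u0: "u \<noteq> 0" using z f.zero by auto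
  define y where "y = (cnj (f u) / cinner u u) *\<^sub>C u"
  have "f x = cinner x y" for x
  proof -
    have "x - (f x / f u) *\<^sub>C u \<in> S" using fu z by (simp add: S_def f.diff scale)
    then have "cinner (x - (f x / f u) *\<^sub>C u) u = 0" using p(2) orthocompD' unfolding u_def by blast
    then have "cinner x u = (f x / f u) * cinner u u" by (simp add: cinner.diff_left cinner_scaleC_left)
    moreover have "cnj (cinner u u) = cinner u u" using cinner_commute by metis
    ultimately show ?thesis using fu z u0
      by (simp add: y_def cinner_scaleC_right)
  qed
  then show ?thesis by blast
qed

text \<open>The choice in the definition of \<open>cadjoint\<close> has a witness by Riesz representation.\<close>

lemma cinner_cadjoint:
  assumes "bounded_clinear T"
  shows "cinner (T x) y = cinner x (cadjoint T y)"
proof -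
  interpret T: bounded_linear T using assms bounded_clinearD by blast
  obtain K where K: "\<And>x. norm (T x) \<le> norm x * K" using T.bounded by blast
  have "\<exists>z. \<forall>x. cinner (T x) y = cinner x z" for y
  proof (rule riesz_representation)
    show "cmod (cinner (T x) y) \<le> norm x * (K * norm y)" for x
      using cmod_cinner_le[of "T x" y] mult_right_mono[OF K, of "norm y"] by (simp add: mult.assoc order_trans)
  qed (simp_all add: T.add cinner_add_left cinner_scaleC_left bounded_clinear_scaleC[OF assms])
  then have "\<exists>S. \<forall>x y. cinner (T x) y = cinner x (S y)" by metis
  then have "\<forall>x y. cinner (T x) y = cinner x (cadjoint T y)"
    unfolding cadjoint_def by (rule someI_ex)
  then show ?thesis by blast
qed

lemma cadjoint_eqI:
  assumes "bounded_clinear T" "\<And>x. cinner (T x) y = cinner x z"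
  shows "cadjoint T y = z"
proof -
  have "cinner x (cadjoint T y - z) = 0" for x
    using cinner_cadjoint[OF assms(1), of x y] assms(2)[of x] by (simp add: cinner.diff_right)
  then have "cadjoint T y - z = 0" using cinner_eq_zero_iff by blast
  then show ?thesis by simp
qed

lemma bounded_clinear_cadjoint:
  assumes "bounded_clinear T"
  shows "bounded_clinear (cadjoint T)"
proof -
  interpret T: bounded_linear T using assms bounded_clinearD by blast
  obtain K where K0: "K \<ge> 0" and K: "\<And>x. norm (T x) \<le> norm x * K"
    using T.nonneg_bounded by blast
  show ?thesis
  proof (rule bounded_clinearI)
    show "cadjoint T (x + y) = cadjoint T x + cadjoint T y" for x y
      by (rule cadjoint_eqI[OF assms]) (simp add: cinner_add_right cinner_cadjoint[OF assms])
    show "cadjoint T (c *\<^sub>C x) = c *\<^sub>C cadjoint T x" for c x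
      by (rule cadjoint_eqI[OF assms]) (simp add: cinner_scaleC_right cinner_cadjoint[OF assms])
    show "norm (cadjoint T y) \<le> norm y * K" for y
    proof (cases "cadjoint T y = 0")
      case True
      then show ?thesis using K0 by simp
    next
      case False
      let ?z = "cadjoint T y"
      have "(norm ?z)\<^sup>2 = cmod (cinner (T ?z) y)"
        by (simp add: cinner_cadjoint[OF assms] cinner_self norm_power)
      also have "\<dots> \<le> norm (T ?z) * norm y" by (rule cmod_cinner_le)
      also have "\<dots> \<le> norm ?z * K * norm y" by (intro mult_right_mono K) simp
      finally show ?thesis using False by (simp add: power2_eq_square mult.commute mult.left_commute)
    qed
  qed
qed

section \<open>Operators with closed range\<close>

text \<open>The open mapping theorem for a map onto its closed range.  By Baire's theorem the closure of the image of
some ball contains a ball of the range, so the equation \<open>T x = y\<close> can be solved up to an error of half the size of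
\<open>y\<close> by an \<open>x\<close> of controlled norm; summing the corrections solves it exactly.\<close>

lemma closed_range_solution_bound:
  fixes T :: "'a::banach \<Rightarrow> 'b::banach"
  assumes "bounded_linear T" and cl: "closed (range T)"
  shows "\<exists>C>0. \<forall>y\<in>range T. \<exists>x. T x = y \<and> norm x \<le> C * norm y"
proof -
  interpret T: bounded_linear T by fact
  define R where "R = range T"
  define X where "X = top_of_set R"
  define F where "F n = R \<inter> closure (T ` cball 0 (real n))" for n
  have R0: "0 \<in> R" unfolding R_def by (metis T.zero rangeI)
  have Radd: "x + y \<in> R" and Rdiff: "x - y \<in> R" and Rscale: "s *\<^sub>R x \<in> R"
    if "x \<in> R" "y \<in> R" for x y s
    using that unfolding R_def by (auto simp flip: T.add T.diff T.scaleR)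
  have "completely_metrizable_space X"
    unfolding X_def R_def using cl
    by (metis completely_metrizable_space_closedin completely_metrizable_space_euclidean closed_closedin)
  moreover have "\<Union>(range F) = R"
  proof
    show "R \<subseteq> \<Union>(range F)"
    proof
      fix y assume "y \<in> R"
      then obtain x where x: "y = T x" by (auto simp: R_def)
      obtain n where "norm x \<le> real n" using real_arch_simple by blast
      then have "y \<in> T ` cball 0 (real n)" using x by auto
      then have "y \<in> F n" using \<open>y \<in> R\<close> subsetD[OF closure_subset] unfolding F_def by (intro IntI)
      then show "y \<in> \<Union>(range F)" by blast
    qed
  qed (auto simp: F_def)
  moreover have "X interior_of R = R" by (simp add: X_def interior_of_openin)
  moreover have "closedin X (F n)" for n unfolding X_def F_def by (intro closedin_closed_Int closed_closure)
  ultimately obtain n where n: "X interior_of (F n) \<noteq> {}"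
    using Baire_category_alt[of X "range F"] R0 by auto
  then obtain y0 V where V: "openin X V" "V \<subseteq> F n" "y0 \<in> V"
    unfolding interior_of_def by blast
  then obtain r where r: "r > 0" "ball y0 r \<inter> R \<subseteq> V"
    unfolding X_def openin_contains_ball by blast
  have y0: "y0 \<in> R" "y0 \<in> closure (T ` cball 0 (real n))" using V by (auto simp: F_def)
  \<comment> \<open>Scaling \<open>y\<close> to norm \<open>r / 2\<close> costs a factor \<open>2 * norm y / r\<close>, and the difference of two points
    of the ball has norm at most \<open>2 * n\<close>.\<close>
  define C where "C = 4 * real n / r"
  have C0: "C \<ge> 0" using r by (simp add: C_def)
  have approx: "\<exists>x. norm x \<le> C * norm y \<and> norm (y - T x) \<le> norm y / 2" if y: "y \<in> R" for y
  proof (cases "y = 0")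
    case True
    then show ?thesis by (intro exI[of _ 0]) (simp add: T.zero)
  next
    case False
    define s where "s = r / (2 * norm y)"
    have s0: "s > 0" using r False by (simp add: s_def)
    have "norm (s *\<^sub>R y) = r / 2" using False r by (simp add: s_def)
    then have "y0 + s *\<^sub>R y \<in> ball y0 r \<inter> R"
      using r Radd[OF y0(1) Rscale[OF y y]] by (simp add: dist_norm)
    then have "y0 + s *\<^sub>R y \<in> closure (T ` cball 0 (real n))" using r V by (auto simp: F_def)
    then obtain a where a: "norm a \<le> real n" "dist (T a) (y0 + s *\<^sub>R y) < r / 8"
      unfolding closure_approachable using r by (force dest: spec[of _ "r/8"])
    from y0(2) obtain b where b: "norm b \<le> real n" "dist (T b) y0 < r / 8"
      unfolding closure_approachable using r by (force dest: spec[of _ "r/8"])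
    define x where "x = (1 / s) *\<^sub>R (a - b)"
    have "norm (a - b) \<le> 2 * real n" using norm_triangle_ineq4[of a b] a b by linarith
    then have "norm x \<le> (1 / s) * (2 * real n)"
      using s0 by (simp add: x_def divide_right_mono)
    also have "\<dots> = C * norm y" using r False by (simp add: s_def C_def)
    finally have 1: "norm x \<le> C * norm y" .
    have "y - T x = (1 / s) *\<^sub>R ((T b - y0) - (T a - (y0 + s *\<^sub>R y)))"
      using s0 by (simp add: x_def T.scaleR T.diff algebra_simps)
    then have "norm (y - T x) = (1 / s) * norm ((T b - y0) - (T a - (y0 + s *\<^sub>R y)))"
      using s0 by simp
    also have "\<dots> \<le> (1 / s) * (r / 4)"
    proof (intro mult_left_mono)
      show "norm ((T b - y0) - (T a - (y0 + s *\<^sub>R y))) \<le> r / 4"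
        using norm_triangle_ineq4[of "T b - y0" "T a - (y0 + s *\<^sub>R y)"] a b
        unfolding dist_norm by linarith
    qed (use s0 in simp)
    also have "\<dots> = norm y / 2" using r False by (simp add: s_def)
    finally show ?thesis using 1 by blast
  qed
  then obtain g where g: "\<And>y. y \<in> R \<Longrightarrow> norm (g y) \<le> C * norm y"
    and g2: "\<And>y. y \<in> R \<Longrightarrow> norm (y - T (g y)) \<le> norm y / 2"
    by metis
  have sol: "\<exists>x. T x = y \<and> norm x \<le> (2 * C + 1) * norm y" if y: "y \<in> R" for y
  proof -
    \<comment> \<open>the error left after one approximate solution, and its iterates\<close>
    define h where "h z = z - T (g z)" for z
    define z where "z k = (h ^^ k) y" for k
    have zR: "z k \<in> R" for k
      by (induction k) (use y in \<open>auto simp: z_def h_def R_def intro!: Rdiff[unfolded R_def]\<close>)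
    have zn: "norm (z k) \<le> norm y * (1/2) ^ k" for k
    proof (induction k)
      case (Suc k)
      have "norm (z (Suc k)) \<le> norm (z k) / 2" using g2[OF zR[of k]] by (simp add: z_def h_def)
      then show ?case using Suc by simp
    qed (simp add: z_def)
    have gz: "norm (g (z k)) \<le> (C * norm y) * (1/2) ^ k" for k
      using order_trans[OF g[OF zR] mult_left_mono[OF zn C0]] by (simp add: mult.assoc)
    have geo: "summable (\<lambda>k. (C * norm y) * (1/2) ^ k)" by (intro summable_mult summable_geometric) simp
    have sg: "summable (\<lambda>k. norm (g (z k)))"
      by (rule summable_comparison_test'[OF geo, of 0]) (use gz in auto)
    define x where "x = (\<Sum>k. g (z k))"
    have part: "T (\<Sum>k<m. g (z k)) = y - z m" for m
      by (induction m) (simp_all add: T.zero T.add z_def h_def algebra_simps)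
    have "(\<lambda>m. \<Sum>k<m. g (z k)) \<longlonglongrightarrow> x"
      unfolding x_def by (rule summable_LIMSEQ[OF summable_norm_cancel[OF sg]])
    then have "(\<lambda>m. T (\<Sum>k<m. g (z k))) \<longlonglongrightarrow> T x" by (rule T.tendsto)
    moreover have "z \<longlonglongrightarrow> 0"
    proof (rule Lim_null_comparison)
      show "\<forall>\<^sub>F k in sequentially. norm (z k) \<le> norm y * (1/2) ^ k" using zn by simp
      show "(\<lambda>k. norm y * (1/2) ^ k) \<longlonglongrightarrow> 0"
        by (intro tendsto_mult_right_zero LIMSEQ_power_zero) simp
    qed
    then have "(\<lambda>m. y - z m) \<longlonglongrightarrow> y - 0" by (intro tendsto_intros)
    ultimately have "T x = y" unfolding part using LIMSEQ_unique by force
    have "norm x \<le> (\<Sum>k. norm (g (z k)))" unfolding x_def by (rule summable_norm[OF sg])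
    also have "\<dots> \<le> (\<Sum>k. (C * norm y) * (1/2) ^ k)" by (rule suminf_le[OF gz sg geo])
    also have "\<dots> = 2 * C * norm y" by (subst suminf_mult) (auto simp: suminf_geometric)
    also have "\<dots> \<le> (2 * C + 1) * norm y" by (intro mult_right_mono) auto
    finally show ?thesis using \<open>T x = y\<close> by blast
  qed
  show ?thesis
    by (rule exI[of _ "2 * C + 1"]) (use C0 sol in \<open>auto simp: R_def\<close>)
qed

section \<open>Antiholomorphic families of eigenvectors\<close>

text \<open>Derivatives of antiholomorphic maps have this shape, \<open>d j\<close> being the derivative along the conjugate of the
\<open>j\<close>-th coordinate.\<close>

definition antilin :: "('n::finite \<Rightarrow> 'a::chilbert_space) \<Rightarrow> complex ^ 'n \<Rightarrow> 'a" where
  "antilin d v = (\<Sum>j\<in>UNIV. cnj (v $ j) *\<^sub>C d j)"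

text \<open>The simple tensor of \<open>x\<close> with the conjugate of \<open>v\<close>, in the realisation of the tensor product as a direct sum.\<close>

definition tens :: "complex ^ 'n::finite \<Rightarrow> 'a::chilbert_space \<Rightarrow> 'a ^ 'n" where
  "tens v x = (\<chi> i. cnj (v $ i) *\<^sub>C x)"

lemma bounded_linear_cnj_scaleC: "bounded_linear (\<lambda>v. cnj (v $ j) *\<^sub>C x)"
  by (rule bounded_linear_compose[OF scaleC.bounded_linear_left, OF bounded_linear_compose[OF bounded_linear_cnj bounded_linear_vec_nth]])

lemma bounded_linear_antilin: "bounded_linear (antilin d)"
  unfolding antilin_def by (intro bounded_linear_sum bounded_linear_cnj_scaleC)

lemma antilin_axis: "antilin d (axis j c) = cnj c *\<^sub>C d j"
proof -
  have "antilin d (axis j c) = (\<Sum>i\<in>UNIV. if i = j then cnj c *\<^sub>C d j else 0)"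
    unfolding antilin_def by (rule sum.cong) (auto simp: axis_def)
  then show ?thesis by simp
qed

lemma tens_eq_antilin: "tens v x = antilin (\<lambda>j. axis j x) v"
proof -
  have "(\<Sum>j\<in>UNIV. (cnj (v $ j) *\<^sub>C axis j x) $ i) = (\<Sum>j\<in>UNIV. if j = i then cnj (v $ i) *\<^sub>C x else 0)" for i
    by (rule sum.cong) (auto simp: axis_def scaleC_vec_def)
  then show ?thesis by (simp add: tens_def antilin_def vec_eq_iff)
qed

lemma norm_tens: "norm (tens v x) = norm v * norm x"
  by (simp add: tens_def norm_vec_def norm_scaleC L2_set_left_distrib)

lemma bounded_clinear_antilin:
  assumes "bounded_clinear T"
  shows "T (antilin d v) = antilin (\<lambda>j. T (d j)) v"
proof -
  interpret T: bounded_linear T using assms bounded_clinearD by blast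
  show ?thesis by (simp add: antilin_def T.sum bounded_clinear_scaleC[OF assms])
qed

lemma antilin_add: "antilin (\<lambda>j. d j + d' j) v = antilin d v + antilin d' v"
  by (simp add: antilin_def scaleC_add_right sum.distrib)

text \<open>For \<open>A i = cadjoint (M i)\<close> this is the column operator whose kernel is the joint eigenspace at \<open>w\<close>.  It
depends on \<open>w\<close> only through the term \<open>cnj (w $ i)\<close>, hence antiholomorphically.\<close>

definition shifted :: "('n::finite \<Rightarrow> 'h::chilbert_space \<Rightarrow> 'h) \<Rightarrow> complex ^ 'n \<Rightarrow> 'h \<Rightarrow> 'h ^ 'n" where
  "shifted A w x = (\<chi> i. A i x - cnj (w $ i) *\<^sub>C x)"

lemma shifted_shift: "shifted A w x = shifted A w' x + tens (w' - w) x"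
  by (simp add: shifted_def tens_def vec_eq_iff scaleC.diff_left)

lemma bounded_clinear_vec:
  assumes "\<And>i. bounded_clinear (\<lambda>x. F x $ i)"
  shows "bounded_clinear (F :: 'a::chilbert_space \<Rightarrow> 'b::chilbert_space ^ 'n::finite)"
proof -
  have bl: "bounded_linear (\<lambda>x. F x $ i)" for i using assms bounded_clinearD by blast
  then have "\<exists>K. \<forall>x. norm (F x $ i) \<le> norm x * K" for i using bounded_linear.bounded by blast
  then obtain K where K: "\<And>i x. norm (F x $ i) \<le> norm x * K i" by metis
  show ?thesis
  proof (rule bounded_clinearI)
    show "F (x + y) = F x + F y" for x y
      by (simp add: vec_eq_iff linear_simps(1)[OF bl])
    show "F (c *\<^sub>C x) = c *\<^sub>C F x" for c x
      using assms by (simp add: vec_eq_iff bounded_clinear_def scaleC_vec_def)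
    show "norm (F x) \<le> norm x * (\<Sum>i\<in>UNIV. K i)" for x
    proof -
      have "norm (F x) \<le> (\<Sum>i\<in>UNIV. norm (F x $ i))" by (simp add: norm_vec_def L2_set_le_sum)
      also have "\<dots> \<le> (\<Sum>i\<in>UNIV. norm x * K i)" by (intro sum_mono K)
      finally show ?thesis by (simp add: sum_distrib_left)
    qed
  qed
qed

lemma bounded_clinear_diff:
  assumes "bounded_clinear S" "bounded_clinear T"
  shows "bounded_clinear (\<lambda>x. S x - T x)"
  using assms bounded_linear_sub by (auto simp: bounded_clinear_def scaleC.diff_right)

lemma bounded_clinear_shifted:
  assumes "\<And>i. bounded_clinear (A i)"
  shows "bounded_clinear (shifted A w)"
  by (rule bounded_clinear_vec)
    (simp add: shifted_def bounded_clinear_diff assms bounded_clinear_const_scaleC bounded_clinear_ident)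

lemma bounded_clinear_zero: "bounded_clinear (\<lambda>x. 0)"
  by (simp add: bounded_clinear_def)

lemma bounded_clinear_axis: "bounded_clinear (axis j :: 'a::chilbert_space \<Rightarrow> 'a ^ 'n::finite)"
proof (rule bounded_clinear_vec)
  fix i
  show "bounded_clinear (\<lambda>x::'a. axis j x $ i)"
    by (cases "i = j") (simp_all add: axis_def bounded_clinear_ident bounded_clinear_zero)
qed

lemma closed_image_bounded_below:
  assumes "bounded_linear T" "c > 0" "\<And>x. x \<in> X \<Longrightarrow> c * norm x \<le> norm (T x)"
    and "csubspace X" "closed (X :: 'a::chilbert_space set)"
  shows "closed (T ` X)"
proof -
  have "subspace X" unfolding subspace_def
    using assms(4) by (simp add: csubspace_0 csubspace_add csubspace_scaleR)
  then show ?thesis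
    using complete_isometric_image[of c X T] assms complete_imp_closed by (auto simp: complete_eq_closed)
qed

text \<open>Solutions \<open>a w\<close> of the equation \<open>shifted A w (a w) = b w\<close> inherit differentiability from the right-hand side when the
operators are uniformly bounded below on \<open>X\<close>.  The difference quotients of \<open>a\<close> solve equations whose right-hand sides
converge to \<open>b' j w + axis j (a w)\<close>; the image of \<open>X\<close> being closed, the limit equation has a solution \<open>a' j w\<close>, and
the lower bound turns closeness of right-hand sides into closeness of solutions.  As the derivatives solve
equations of the same kind, the lemma can be iterated.\<close>

lemma antiholomorphic_solution:
  fixes A :: "'n::finite \<Rightarrow> 'h::chilbert_space \<Rightarrow> 'h"
  assumes A: "\<And>i. bounded_clinear (A i)" and U: "open U" and c: "c > 0"
    and X: "csubspace X" "closed X"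
    and below: "\<And>w x. w \<in> U \<Longrightarrow> x \<in> X \<Longrightarrow> c * norm x \<le> norm (shifted A w x)"
    and aX: "\<And>w. w \<in> U \<Longrightarrow> a w \<in> X" and a: "\<And>w. w \<in> U \<Longrightarrow> shifted A w (a w) = b w"
    and b: "\<And>w. w \<in> U \<Longrightarrow> (b has_derivative antilin (\<lambda>j. b' j w)) (at w)"
  shows "\<exists>a'. \<forall>w\<in>U. (a has_derivative antilin (\<lambda>j. a' j w)) (at w)
    \<and> (\<forall>j. a' j w \<in> X \<and> shifted A w (a' j w) = b' j w + axis j (a w))"
proof -
  have *: "\<exists>d. (a has_derivative antilin d) (at w)
    \<and> (\<forall>j. d j \<in> X \<and> shifted A w (d j) = b' j w + axis j (a w))" if w: "w \<in> U" for w
  proof -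
    let ?T = "shifted A w" and ?b = "antilin (\<lambda>j. b' j w)"
    have Tc: "bounded_clinear ?T" by (rule bounded_clinear_shifted[OF A])
    then interpret T: bounded_linear ?T by (rule bounded_clinearD)
    have nearU: "\<forall>\<^sub>F w' in at w. w' \<in> U" using U w by (simp add: eventually_at_in_open')
    have step: "?T (a w' - a w) = b w' - b w + tens (w' - w) (a w')" if "w' \<in> U" for w'
      using shifted_shift[of A w "a w'" w'] a[OF that] a[OF w] by (simp add: T.diff)
    have bc: "(b \<longlongrightarrow> b w) (at w)" using has_derivative_continuous[OF b[OF w]] by (simp add: isContD)
    have "((\<lambda>w'. a w' - a w) \<longlongrightarrow> 0) (at w)"
    proof (rule Lim_null_comparison)
      let ?g = "\<lambda>w'. (norm (b w' - b w) + norm (w' - w) * (norm (b w') / c)) / c"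
      have "norm (a w' - a w) \<le> ?g w'" if w': "w' \<in> U" for w'
      proof -
        have "norm (a w') \<le> norm (b w') / c"
          using below[OF w' aX[OF w']] a[OF w'] c by (simp add: field_simps)
        then have "norm (w' - w) * norm (a w') \<le> norm (w' - w) * (norm (b w') / c)"
          by (rule mult_left_mono) simp
        moreover have "c * norm (a w' - a w) \<le> norm (?T (a w' - a w))"
          by (rule below[OF w csubspace_diff[OF X(1) aX[OF w'] aX[OF w]]])
        moreover have "\<dots> \<le> norm (b w' - b w) + norm (w' - w) * norm (a w')"
          unfolding step[OF w'] norm_tens[symmetric] by (rule norm_triangle_ineq)
        ultimately have "c * norm (a w' - a w) \<le> norm (b w' - b w) + norm (w' - w) * (norm (b w') / c)"
          by linarith
        then show ?thesis using c by (simp add: field_simps)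
      qed
      then show "\<forall>\<^sub>F w' in at w. norm (a w' - a w) \<le> ?g w'"
        using nearU by (auto elim: eventually_mono)
      have "(?g \<longlongrightarrow> (norm (b w - b w) + norm (w - w) * (norm (b w) / c)) / c) (at w)"
        by (intro tendsto_intros bc) (use c in auto)
      then show "(?g \<longlongrightarrow> 0) (at w)" by simp
    qed
    then have ac: "((\<lambda>w'. a w') \<longlongrightarrow> a w) (at w)" by (rule LIM_zero_cancel)
    have "\<exists>y\<in>X. ?T y = b' j w + axis j (a w)" for j
    proof -
      let ?p = "\<lambda>t::real. w + t *\<^sub>R axis j 1"
      let ?q = "\<lambda>t. (1 / t) *\<^sub>R (b (?p t) - b w)"
      have pl: "((\<lambda>t. ?p t) \<longlongrightarrow> w + 0 *\<^sub>R axis j 1) (at 0)" by (intro tendsto_intros)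
      have pne: "?p t \<noteq> w" if "t \<noteq> 0" for t using that by (simp add: axis_eq_0_iff)
      have pf: "filterlim ?p (at w) (at 0)"
        using pl pne by (auto simp: filterlim_at eventually_at_filter)
      have bd: "((\<lambda>t. b (?p t)) has_derivative (\<lambda>t. ?b (t *\<^sub>R axis j 1))) (at 0)"
        by (rule has_derivative_compose[where f = ?p and g = b, of "\<lambda>t. t *\<^sub>R axis j 1"])
          (auto intro!: derivative_eq_intros b w)
      have "?b (t *\<^sub>R axis j 1) = t *\<^sub>R b' j w" for t
        using linear_simps(5)[OF bounded_linear_antilin, of "\<lambda>j. b' j w" t "axis j 1"] by (simp add: antilin_axis)
      then have "((\<lambda>t. b (?p t)) has_vector_derivative b' j w) (at 0)"
        using bd by (simp add: has_vector_derivative_def)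
      then have q1: "((\<lambda>t. ?q t) \<longlongrightarrow> b' j w) (at 0)"
      proof -
        have "((\<lambda>t. norm (b (?p t) - b w - t *\<^sub>R b' j w) / norm t) \<longlongrightarrow> 0) (at 0)"
          using \<open>((\<lambda>t. b (?p t)) has_vector_derivative b' j w) (at 0)\<close>
          by (simp add: has_derivative_at has_vector_derivative_def)
        moreover have "\<forall>\<^sub>F t in at 0. norm (b (?p t) - b w - t *\<^sub>R b' j w) / norm t
            = norm (?q t - b' j w)"
        proof -
          have "norm (b (?p t) - b w - t *\<^sub>R b' j w) / norm t
              = norm (?q t - b' j w)" if "t \<noteq> 0" for t
          proof -
            have "?q t - b' j w = (1 / t) *\<^sub>R (b (?p t) - b w - t *\<^sub>R b' j w)"
              using that by (simp add: algebra_simps)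
            then show ?thesis by (simp add: divide_inverse mult.commute)
          qed
          then show ?thesis by (simp add: eventually_at_filter)
        qed
        ultimately have "((\<lambda>t. norm (?q t - b' j w)) \<longlongrightarrow> 0) (at 0)"
          by (rule Lim_transform_eventually)
        then show ?thesis by (rule LIM_zero_cancel[OF tendsto_norm_zero_cancel])
      qed
      have q2: "((\<lambda>t. axis j (a (?p t))) \<longlongrightarrow> axis j (a w)) (at 0)"
        using bounded_linear.tendsto[OF bounded_clinearD[OF bounded_clinear_axis] filterlim_compose[OF ac pf]] .
      have cl: "closed (?T ` X)"
        by (rule closed_image_bounded_below[OF T.bounded_linear_axioms c below[OF w] X])
      have lim: "((\<lambda>t. ?q t + axis j (a (?p t))) \<longlongrightarrow> b' j w + axis j (a w)) (at 0)"
        by (intro tendsto_add q1 q2)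
      have ev: "\<forall>\<^sub>F t in at 0. ?q t + axis j (a (?p t)) \<in> ?T ` X"
      proof -
        have *: "?q t + axis j (a (?p t)) \<in> ?T ` X" if t: "t \<noteq> 0" "?p t \<in> U" for t
        proof (rule image_eqI)
          show "(1 / t) *\<^sub>R (a (?p t) - a w) \<in> X"
            by (intro csubspace_scaleR X csubspace_diff aX w t)
          have "tens (t *\<^sub>R axis j 1) (a (?p t)) = t *\<^sub>R axis j (a (?p t))"
            using linear_simps(5)[OF bounded_linear_antilin, of "\<lambda>j. axis j (a (?p t))" t "axis j 1"]
            by (simp add: tens_eq_antilin antilin_axis)
          then show "?q t + axis j (a (?p t)) = ?T ((1 / t) *\<^sub>R (a (?p t) - a w))"
            using step[OF t(2)] t(1) by (simp add: T.scaleR scaleR_add_right)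
        qed
        have "\<forall>\<^sub>F t in at 0. t \<noteq> (0::real)" by (simp add: eventually_at_filter)
        moreover have "\<forall>\<^sub>F t in at 0. ?p t \<in> U" by (rule eventually_compose_filterlim[OF nearU pf])
        ultimately show "\<forall>\<^sub>F t in at 0. ?q t + axis j (a (?p t)) \<in> ?T ` X"
          by eventually_elim (rule *)
      qed
      have "b' j w + axis j (a w) \<in> ?T ` X"
        by (rule Lim_in_closed_set[OF cl ev at_neq_bot lim])
      then show ?thesis by (auto simp: image_iff eq_commute)
    qed
    then obtain d where d: "\<And>j. d j \<in> X" "\<And>j. ?T (d j) = b' j w + axis j (a w)" by metis
    have antX: "antilin d v \<in> X" for v
      unfolding antilin_def by (intro csubspace_sum[OF X(1)] csubspace_scale[OF X(1)] d)
    have rem: "?T (a w' - a w - antilin d (w' - w)) =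
        (b w' - b w - ?b (w' - w)) + tens (w' - w) (a w' - a w)" if w': "w' \<in> U" for w'
    proof -
      have "?T (antilin d (w' - w)) = ?b (w' - w) + tens (w' - w) (a w)"
        unfolding bounded_clinear_antilin[OF Tc] d(2) antilin_add tens_eq_antilin ..
      moreover have "tens (w' - w) (a w' - a w) = tens (w' - w) (a w') - tens (w' - w) (a w)"
        by (simp add: tens_def vec_eq_iff scaleC.diff_right)
      ultimately show ?thesis using step[OF w'] by (simp add: T.diff)
    qed
    have "(a has_derivative antilin d) (at w)"
      unfolding has_derivative_iff_norm
    proof (rule conjI[OF bounded_linear_antilin Lim_null_comparison])
      let ?r = "\<lambda>w'. norm (a w' - a w - antilin d (w' - w))"
      let ?\<rho> = "\<lambda>w'. norm (b w' - b w - ?b (w' - w)) / norm (w' - w)"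
      let ?g = "\<lambda>w'. (?\<rho> w' + norm (a w' - a w)) / c"
      have "norm (?r w' / norm (w' - w)) \<le> ?g w'"
        if w': "w' \<in> U" "w' \<noteq> w" for w'
      proof -
        have "c * ?r w' \<le> norm (?T (a w' - a w - antilin d (w' - w)))"
          by (intro below w csubspace_diff X aX w' antX)
        also have "\<dots> \<le> norm (b w' - b w - ?b (w' - w)) + norm (w' - w) * norm (a w' - a w)"
          unfolding rem[OF w'(1)] norm_tens[symmetric] by (rule norm_triangle_ineq)
        finally show ?thesis using c w'(2) by (simp add: field_simps)
      qed
      moreover have "\<forall>\<^sub>F w' in at w. w' \<noteq> w" by (simp add: eventually_at_filter)
      ultimately show "\<forall>\<^sub>F w' in at w. norm (?r w' / norm (w' - w)) \<le> ?g w'"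
        using nearU by (auto elim: eventually_elim2)
      have \<rho>0: "(?\<rho> \<longlongrightarrow> 0) (at w)" using b[OF w] by (simp add: has_derivative_iff_norm)
      have a0: "((\<lambda>w'. norm (a w' - a w)) \<longlongrightarrow> 0) (at w)"
        using ac by (simp add: LIM_zero tendsto_norm_zero)
      have "(?g \<longlongrightarrow> (0 + 0) / c) (at w)"
        by (rule tendsto_divide[OF tendsto_add[OF \<rho>0 a0] tendsto_const]) (use c in simp)
      then show "(?g \<longlongrightarrow> 0) (at w)" by simp
    qed
    then show ?thesis using d by blast
  qed
  have "\<forall>w\<in>U. \<exists>d. (a has_derivative antilin d) (at w)
    \<and> (\<forall>j. d j \<in> X \<and> shifted A w (d j) = b' j w + axis j (a w))"
    using * by (rule ballI)
  from bchoice[OF this] obtain D where "\<forall>w\<in>U. (a has_derivative antilin (D w)) (at w)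
    \<and> (\<forall>j. D w j \<in> X \<and> shifted A w (D w j) = b' j w + axis j (a w))" ..
  then show ?thesis by (intro exI[of _ "\<lambda>j w. D w j"])
qed

lemma mem_eigenspace_star:
  assumes "hilbert_module M"
  shows "h \<in> eigenspace_star M w \<longleftrightarrow> (\<forall>i. cadjoint (M i) h = cnj (w $ i) *\<^sub>C h)"
    and "col_adjoint M w h = shifted (\<lambda>i. cadjoint (M i)) w h"
proof -
  have M: "bounded_clinear (M i)" for i using assms by (simp add: hilbert_module_def)
  have adj: "cadjoint (\<lambda>x. M i x - (w $ i) *\<^sub>C x) h = cadjoint (M i) h - cnj (w $ i) *\<^sub>C h" for i h
    by (rule cadjoint_eqI)
      (auto intro!: bounded_clinear_diff M bounded_clinear_const_scaleC bounded_clinear_ident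
        simp: cinner.diff_left cinner.diff_right cinner_cadjoint[OF M] cinner_scaleC_left cinner_scaleC_right)
  show "col_adjoint M w h = shifted (\<lambda>i. cadjoint (M i)) w h"
    by (simp add: col_adjoint_def shifted_def adj)
  show "h \<in> eigenspace_star M w \<longleftrightarrow> (\<forall>i. cadjoint (M i) h = cnj (w $ i) *\<^sub>C h)"
    by (simp add: eigenspace_star_def col_adjoint_def adj vec_eq_iff)
qed

lemma eigenspace_star_line:
  assumes M: "M \<in> B1_star \<Omega>" and w: "w \<in> \<Omega>"
  shows "\<exists>f. f \<noteq> 0 \<and> eigenspace_star M w = {c *\<^sub>C f |c. True}"
proof -
  let ?E = "eigenspace_star M w"
  have hm: "hilbert_module M" and dim: "cdim ?E = 1" using M w by (auto simp: B1_star_def)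
  have A: "bounded_clinear (cadjoint (M i))" for i
    using hm bounded_clinear_cadjoint by (auto simp: hilbert_module_def)
  have add: "cadjoint (M i) (x + y) = cadjoint (M i) x + cadjoint (M i) y" for i x y
    using A bounded_clinearD linear_simps(1) by blast
  have zero: "cadjoint (M i) 0 = 0" for i
    using A bounded_clinearD linear_simps(3) by blast
  have sub: "csubspace ?E"
    unfolding complex_vector.subspace_def
    by (auto simp: mem_eigenspace_star[OF hm] add zero bounded_clinear_scaleC[OF A] scaleC_add_right
        scaleC_scaleC mult.commute)
  obtain B where B: "B \<subseteq> ?E" "complex_vector.independent B" "?E \<subseteq> cspan B" "card B = cdim ?E"
    using complex_vector.basis_exists by blast
  then obtain f where f: "B = {f}" using dim by (metis card_1_singletonE)
  have "?E = cspan B" using B sub complex_vector.span_minimal by blast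
  moreover have "f \<noteq> 0" using B(2) f complex_vector.dependent_zero by blast
  ultimately show ?thesis unfolding f complex_vector.span_singleton by auto
qed

lemma generator_mem: "E = {c *\<^sub>C f |c. True} \<Longrightarrow> f \<in> (E :: 'a::chilbert_space set)"
  by (metis (mono_tags, lifting) mem_Collect_eq scaleC_one)

text \<open>Near \<open>w0\<close> the eigenvector is normalised by \<open>k w = e + a w\<close> with \<open>e\<close> a unit eigenvector at \<open>w0\<close> and \<open>a w\<close>
orthogonal to \<open>e\<close>.  Closed range at \<open>w0\<close> bounds the column operator below on the complement of \<open>e\<close>, a bound
that persists nearby, and the eigenvalue equation for \<open>k w\<close> becomes \<open>shifted A w (a w) = tens (w - w0) e\<close>, to which
\<open>antiholomorphic_solution\<close> applies twice.  Two derivatives are what the curvature needs.\<close>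

lemma antiholomorphic_eigenvector:
  fixes M :: "'n::finite \<Rightarrow> 'h::chilbert_space \<Rightarrow> 'h"
  assumes \<Omega>: "open \<Omega>" and M: "M \<in> B1_star \<Omega>" and w0: "w0 \<in> \<Omega>"
  obtains r k k1 k2 where "r > 0" "ball w0 r \<subseteq> \<Omega>"
    "\<And>w. w \<in> ball w0 r \<Longrightarrow> eigenspace_star M w = {c *\<^sub>C k w |c. True}"
    "\<And>w. w \<in> ball w0 r \<Longrightarrow> cinner (k w) (k w0) = 1"
    "\<And>w. w \<in> ball w0 r \<Longrightarrow> (k has_derivative antilin (\<lambda>j. k1 j w)) (at w)"
    "\<And>w j. w \<in> ball w0 r \<Longrightarrow> (k1 j has_derivative antilin (\<lambda>i. k2 i j w)) (at w)"
proof -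
  have hm: "hilbert_module M" using M by (auto simp: B1_star_def)
  define A where "A i = cadjoint (M i)" for i
  have A: "bounded_clinear (A i)" for i
    using hm bounded_clinear_cadjoint by (auto simp: hilbert_module_def A_def)
  have Tc: "bounded_clinear (shifted A w)" for w by (rule bounded_clinear_shifted[OF A])
  note Tlin = linear_simps[OF bounded_clinearD[OF Tc]]
  have colT: "col_adjoint M w = shifted A w" for w
    by (rule ext) (simp add: mem_eigenspace_star(2)[OF hm] A_def[abs_def])
  have E: "f \<in> eigenspace_star M w \<longleftrightarrow> shifted A w f = 0" for w f
    by (simp add: eigenspace_star_def colT)
  obtain f0 where f0: "f0 \<noteq> 0" "eigenspace_star M w0 = {c *\<^sub>C f0 |c. True}"
    using eigenspace_star_line[OF M w0] by blast
  define e where "e = complex_of_real (1 / norm f0) *\<^sub>C f0"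
  have e1: "cinner e e = 1"
    using f0(1) by (simp add: e_def cinner_self norm_scaleC norm_divide)
  have e0: "e \<noteq> 0" using e1 by auto
  have f0e: "c *\<^sub>C f0 = (c * norm f0) *\<^sub>C e" for c
    using f0(1) by (simp add: e_def scaleC_scaleC)
  have Te: "shifted A w0 e = 0" unfolding E[symmetric] f0(2) e_def by blast
  define X where "X = orthocomp {e}"
  have X: "csubspace X" "closed X" unfolding X_def by (rule csubspace_orthocomp, rule closed_orthocomp)
  have Xiff: "x \<in> X \<longleftrightarrow> cinner x e = 0" for x by (simp add: X_def orthocomp_def)
  have "closed (range (shifted A w0))" using M w0 colT by (auto simp: B1_star_def)
  then obtain C where C: "C > 0"
    "\<And>y. y \<in> range (shifted A w0) \<Longrightarrow> \<exists>x. shifted A w0 x = y \<and> norm x \<le> C * norm y"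
    using closed_range_solution_bound[OF bounded_clinearD[OF Tc]] by meson
  have below0: "norm x \<le> C * norm (shifted A w0 x)" if x: "x \<in> X" for x
  proof -
    obtain x' where x': "shifted A w0 x' = shifted A w0 x" "norm x' \<le> C * norm (shifted A w0 x)"
      using C(2) by blast
    then have "shifted A w0 (x' - x) = 0" by (simp add: Tlin)
    then have "x' - x \<in> eigenspace_star M w0" unfolding E .
    then obtain c' where "x' - x = c' *\<^sub>C f0" unfolding f0(2) by blast
    then obtain c where c: "x' - x = c *\<^sub>C e" using f0e by auto
    have "cinner x (x' - x) = 0"
      using x cinner_commute[of x e] by (simp add: c cinner_scaleC_right Xiff)
    then have "cinner x x = cinner x x'" by (simp add: cinner.diff_right)
    then have "(norm x)\<^sup>2 = cmod (cinner x x')" by (metis cinner_self norm_of_real abs_of_nonneg zero_le_power2)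
    also have "\<dots> \<le> norm x * norm x'" by (rule cmod_cinner_le)
    finally have "norm x \<le> norm x'" by (cases "norm x = 0") (auto simp: power2_eq_square)
    then show ?thesis using x'(2) by linarith
  qed
  \<comment> \<open>Half of the lower bound at \<open>w0\<close> survives on the ball of this radius.\<close>
  define c where "c = 1 / (2 * C)"
  have c: "c > 0" using C by (simp add: c_def)
  obtain r1 where r1: "r1 > 0" "ball w0 r1 \<subseteq> \<Omega>" using \<Omega> w0 open_contains_ball by blast
  define r where "r = min r1 c"
  have r: "r > 0" "ball w0 r \<subseteq> \<Omega>" using r1 c by (auto simp: r_def)
  have below: "c * norm x \<le> norm (shifted A w x)" if w: "w \<in> ball w0 r" and x: "x \<in> X" for w x
  proof -
    have "norm (w0 - w) \<le> c" using w by (simp add: r_def dist_norm)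
    then have "norm (w0 - w) * norm x \<le> c * norm x" by (rule mult_right_mono) simp
    moreover have "norm (shifted A w0 x) \<le> norm (shifted A w x) + norm (w0 - w) * norm x"
    proof -
      have "shifted A w0 x = shifted A w x + tens (w - w0) x" by (rule shifted_shift)
      then show ?thesis
        using norm_triangle_ineq[of "shifted A w x" "tens (w - w0) x"] by (simp add: norm_tens norm_minus_commute)
    qed
    moreover have "2 * c * norm x \<le> norm (shifted A w0 x)"
      using below0[OF x] C(1) by (simp add: c_def field_simps)
    ultimately show ?thesis by linarith
  qed
  have "\<exists>k. eigenspace_star M w = {c *\<^sub>C k |c. True} \<and> cinner k e = 1" if w: "w \<in> ball w0 r" for w
  proof -
    obtain f where f: "f \<noteq> 0" "eigenspace_star M w = {c *\<^sub>C f |c. True}"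
      using eigenspace_star_line[OF M] w r(2) by blast
    have "f \<in> eigenspace_star M w" by (rule generator_mem[OF f(2)])
    then have Tf: "shifted A w f = 0" by (simp add: E)
    have ne: "cinner f e \<noteq> 0"
    proof
      assume "cinner f e = 0"
      then have "f \<in> X" by (simp add: Xiff)
      then have "c * norm f \<le> 0" using below[OF w] Tf by force
      then show False using c f(1) by (simp add: mult_le_0_iff)
    qed
    define k where "k = (1 / cinner f e) *\<^sub>C f"
    have "cinner k e = 1" using ne by (simp add: k_def cinner_scaleC_left)
    moreover have fk: "c *\<^sub>C f = (c * cinner f e) *\<^sub>C k" for c
      using ne by (simp add: k_def scaleC_scaleC)
    have kf: "c *\<^sub>C k = (c / cinner f e) *\<^sub>C f" for c
      by (simp add: k_def scaleC_scaleC)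
    have "{c *\<^sub>C f |c. True} = {c *\<^sub>C k |c. True}" using fk kf by fast
    ultimately show ?thesis using f(2) by blast
  qed
  then obtain k where kE: "\<And>w. w \<in> ball w0 r \<Longrightarrow> eigenspace_star M w = {c *\<^sub>C k w |c. True}"
    and ke: "\<And>w. w \<in> ball w0 r \<Longrightarrow> cinner (k w) e = 1" by metis
  define a where "a w = k w - e" for w
  have aX: "a w \<in> X" if "w \<in> ball w0 r" for w
    using ke[OF that] e1 by (simp add: Xiff a_def cinner.diff_left)
  have Ta: "shifted A w (a w) = tens (w - w0) e" if w: "w \<in> ball w0 r" for w
  proof -
    have "k w \<in> eigenspace_star M w" by (rule generator_mem[OF kE[OF w]])
    moreover have "shifted A w e = tens (w0 - w) e" using shifted_shift[of A w e w0] Te by simp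
    ultimately show ?thesis by (simp add: E a_def Tlin) (simp add: tens_def vec_eq_iff scaleC.diff_left)
  qed
  have b1: "((\<lambda>w. tens (w - w0) e) has_derivative antilin (\<lambda>j. axis j e)) (at w)" for w
    unfolding tens_eq_antilin
    by (rule bounded_linear.has_derivative[OF bounded_linear_antilin, where g = "\<lambda>w. w - w0" and g' = "\<lambda>v. v", simplified])
      (auto intro!: derivative_eq_intros)
  obtain a1 where a1: "\<And>w. w \<in> ball w0 r \<Longrightarrow> (a has_derivative antilin (\<lambda>j. a1 j w)) (at w)"
      "\<And>j w. w \<in> ball w0 r \<Longrightarrow> a1 j w \<in> X"
      "\<And>j w. w \<in> ball w0 r \<Longrightarrow> shifted A w (a1 j w) = axis j e + axis j (a w)"
    using antiholomorphic_solution[OF A open_ball c X below aX Ta b1] by metis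
  have b2: "((\<lambda>w. axis j e + axis j (a w)) has_derivative antilin (\<lambda>i. axis j (a1 i w))) (at w)"
    if w: "w \<in> ball w0 r" for j :: 'n and w
  proof -
    have "((\<lambda>w. axis j e + axis j (a w)) has_derivative (\<lambda>v. 0 + axis j (antilin (\<lambda>i. a1 i w) v))) (at w)"
      by (intro has_derivative_add has_derivative_const
          bounded_linear.has_derivative[OF bounded_clinearD[OF bounded_clinear_axis]] a1 w)
    then show ?thesis by (simp add: bounded_clinear_antilin[OF bounded_clinear_axis])
  qed
  have "\<exists>a2. \<forall>w\<in>ball w0 r. (a1 j has_derivative antilin (\<lambda>i. a2 i w)) (at w)" for j
    using antiholomorphic_solution[OF A open_ball c X below a1(2) a1(3) b2] by metis
  then obtain a2 where a2: "\<And>j w. w \<in> ball w0 r \<Longrightarrow> (a1 j has_derivative antilin (\<lambda>i. a2 j i w)) (at w)"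
    by metis
  have k1: "(k has_derivative antilin (\<lambda>j. a1 j w)) (at w)" if "w \<in> ball w0 r" for w
  proof -
    have "((\<lambda>w. a w + e) has_derivative (\<lambda>v. antilin (\<lambda>j. a1 j w) v + 0)) (at w)"
      by (intro has_derivative_add has_derivative_const a1 that)
    then show ?thesis by (simp add: a_def)
  qed
  have "k w0 = e"
  proof -
    have w0b: "w0 \<in> ball w0 r" using r by simp
    have "e \<in> eigenspace_star M w0" by (simp add: E Te)
    then obtain c where "e = c *\<^sub>C k w0" using kE[OF w0b] by auto
    then show ?thesis using e1 ke[OF w0b] by (metis cinner_scaleC_left mult.right_neutral scaleC_one)
  qed
  with ke have kk: "cinner (k w) (k w0) = 1" if "w \<in> ball w0 r" for w using that by simp
  show ?thesis by (rule that[of r k a1 "\<lambda>i j w. a2 j i w", OF r kE kk k1 a2])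
qed

section \<open>The algebra of multipliers\<close>

text \<open>Free of adjoints: multiplication operators act on the evaluations \<open>cinner x k\<close> by multiplication.\<close>

lemma is_mult_op_iff:
  "is_mult_op M \<Omega> \<phi> T \<longleftrightarrow> bounded_clinear T
    \<and> (\<forall>w\<in>\<Omega>. \<forall>k\<in>eigenspace_star M w. \<forall>x. cinner (T x) k = \<phi> w * cinner x k)"
proof (cases "bounded_clinear T")
  case True
  have "cadjoint T k = cnj c *\<^sub>C k \<longleftrightarrow> (\<forall>x. cinner (T x) k = c * cinner x k)" for k c
    by (metis cadjoint_eqI[OF True] cinner_cadjoint[OF True] cinner_scaleC_right complex_cnj_cnj)
  then show ?thesis by (simp add: is_mult_op_def)
qed (simp add: is_mult_op_def)

lemma eigenvectors_total:
  assumes "M \<in> B1_star \<Omega>" "\<And>w k. w \<in> \<Omega> \<Longrightarrow> k \<in> eigenspace_star M w \<Longrightarrow> cinner x k = 0"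
  shows "x = 0"
proof -
  let ?G = "\<Union>w\<in>\<Omega>. eigenspace_star M w"
  have "x \<in> orthocomp (closure (cspan ?G))"
    unfolding orthocomp_closure_cspan using assms(2) by (auto intro: orthocompI)
  moreover have "closure (cspan ?G) = UNIV" using assms(1) by (simp add: B1_star_def)
  ultimately show ?thesis using orthocompD[of x UNIV x] by simp
qed

lemma
  assumes "\<phi> \<in> multipliers M \<Omega>"
  shows bounded_clinear_mult_op: "bounded_clinear (mult_op M \<Omega> \<phi>)"
    and cinner_mult_op: "w \<in> \<Omega> \<Longrightarrow> k \<in> eigenspace_star M w \<Longrightarrow> cinner (mult_op M \<Omega> \<phi> x) k = \<phi> w * cinner x k"
proof -
  have "is_mult_op M \<Omega> \<phi> (mult_op M \<Omega> \<phi>)"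
    using assms someI_ex[of "is_mult_op M \<Omega> \<phi>"] by (simp add: multipliers_def mult_op_def)
  then show "bounded_clinear (mult_op M \<Omega> \<phi>)"
    and "w \<in> \<Omega> \<Longrightarrow> k \<in> eigenspace_star M w \<Longrightarrow> cinner (mult_op M \<Omega> \<phi> x) k = \<phi> w * cinner x k"
    by (auto simp: is_mult_op_iff)
qed

lemma multipliersI:
  assumes "bounded_clinear T"
    "\<And>w k x. w \<in> \<Omega> \<Longrightarrow> k \<in> eigenspace_star M w \<Longrightarrow> cinner (T x) k = \<phi> w * cinner x k"
  shows "\<phi> \<in> multipliers M \<Omega>"
  using assms by (auto simp: multipliers_def is_mult_op_iff)

lemma multipliers_const: "(\<lambda>w. c) \<in> multipliers M \<Omega>"
  by (rule multipliersI[OF bounded_clinear_const_scaleC[OF bounded_clinear_ident]])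
    (rule cinner_scaleC_left)

lemma multipliers_add:
  assumes "\<phi> \<in> multipliers M \<Omega>" "\<psi> \<in> multipliers M \<Omega>"
  shows "(\<lambda>w. \<phi> w + \<psi> w) \<in> multipliers M \<Omega>"
  by (rule multipliersI[OF bounded_clinear_add[OF bounded_clinear_mult_op[OF assms(1)] bounded_clinear_mult_op[OF assms(2)]]])
    (simp add: cinner_add_left cinner_mult_op[OF assms(1)] cinner_mult_op[OF assms(2)] distrib_right)

lemma multipliers_mult:
  assumes "\<phi> \<in> multipliers M \<Omega>" "\<psi> \<in> multipliers M \<Omega>"
  shows "(\<lambda>w. \<phi> w * \<psi> w) \<in> multipliers M \<Omega>"
  by (rule multipliersI[OF bounded_clinear_compose[OF bounded_clinear_mult_op[OF assms(1)] bounded_clinear_mult_op[OF assms(2)]]])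
    (simp add: cinner_mult_op[OF assms(1)] cinner_mult_op[OF assms(2)] mult.assoc)

lemma multipliers_sum:
  assumes "\<And>i. i \<in> I \<Longrightarrow> \<phi> i \<in> multipliers M \<Omega>"
  shows "(\<lambda>w. \<Sum>i\<in>I. \<phi> i w) \<in> multipliers M \<Omega>"
  using assms
  by (induction I rule: infinite_finite_induct) (simp_all add: multipliers_const multipliers_add)

lemma multipliers_prod:
  assumes "\<And>i. i \<in> I \<Longrightarrow> \<phi> i \<in> multipliers M \<Omega>"
  shows "(\<lambda>w. \<Prod>i\<in>I. \<phi> i w) \<in> multipliers M \<Omega>"
  using assms
  by (induction I rule: infinite_finite_induct) (simp_all add: multipliers_const multipliers_mult)

text \<open>Multipliers form an algebra, and determinants are polynomials in the entries.\<close>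

lemma multipliers_formal_det:
  assumes "\<Theta> \<in> mult_matrices M \<Omega>"
  shows "(\<lambda>w. formal_det (\<Theta> w) $ k) \<in> multipliers M \<Omega>"
proof -
  have "(\<lambda>w. case j of None \<Rightarrow> (axis i 1 :: complex ^ 'b option) $ k | Some j' \<Rightarrow> \<Theta> w $ i $ j') \<in> multipliers M \<Omega>"
    for i and j :: "'b option"
    using assms by (cases j) (auto simp: multipliers_const mult_matrices_def)
  then show ?thesis
    unfolding formal_det_def det_def vec_lambda_beta
    by (intro multipliers_sum multipliers_mult multipliers_prod multipliers_const)
qed

section \<open>Matrices of multipliers\<close>

text \<open>The value at \<open>w\<close> of an element of the direct sum, evaluated against \<open>k \<in> eigenspace_star M w\<close>.\<close>

definition pairing :: "'h::chilbert_space \<Rightarrow> 'h ^ 'q::finite \<Rightarrow> complex ^ 'q" where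
  "pairing k x = (\<chi> j. cinner (x $ j) k)"

lemma pairing_total:
  assumes "M \<in> B1_star \<Omega>"
    "\<And>w k. w \<in> \<Omega> \<Longrightarrow> k \<in> eigenspace_star M w \<Longrightarrow> pairing k x = pairing k y"
  shows "x = y"
proof -
  have "x $ j - y $ j = 0" for j
    using assms(2) by (intro eigenvectors_total[OF assms(1)]) (auto simp: pairing_def vec_eq_iff cinner.diff_left)
  then show ?thesis by (simp add: vec_eq_iff)
qed

lemma bounded_clinear_vec_nth: "bounded_clinear (\<lambda>x :: 'a::chilbert_space ^ 'n::finite. x $ i)"
  by (simp add: bounded_clinear_def bounded_linear_vec_nth scaleC_vec_def)

lemma bounded_clinear_sum:
  assumes "\<And>i. i \<in> I \<Longrightarrow> bounded_clinear (T i)"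
  shows "bounded_clinear (\<lambda>x. \<Sum>i\<in>I. T i x)"
  using assms
  by (induction I rule: infinite_finite_induct) (simp_all add: bounded_clinear_zero bounded_clinear_add)

lemma bounded_clinear_mult_matrix_op:
  assumes "\<Theta> \<in> mult_matrices M \<Omega>"
  shows "bounded_clinear (mult_matrix_op M \<Omega> \<Theta>)"
proof (rule bounded_clinear_vec)
  fix i
  have "bounded_clinear (mult_op M \<Omega> (\<lambda>w. \<Theta> w $ i $ j))" for j
    using assms by (intro bounded_clinear_mult_op) (simp add: mult_matrices_def)
  from bounded_clinear_compose[OF this bounded_clinear_vec_nth]
  show "bounded_clinear (\<lambda>x. mult_matrix_op M \<Omega> \<Theta> x $ i)"
    by (auto simp: mult_matrix_op_def intro!: bounded_clinear_sum)
qed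

lemma pairing_mult_matrix_op:
  assumes "\<Theta> \<in> mult_matrices M \<Omega>" "w \<in> \<Omega>" "k \<in> eigenspace_star M w"
  shows "pairing k (mult_matrix_op M \<Omega> \<Theta> x) = \<Theta> w *v pairing k x"
proof -
  have "(\<lambda>w. \<Theta> w $ i $ j) \<in> multipliers M \<Omega>" for i j using assms(1) by (simp add: mult_matrices_def)
  from cinner_mult_op[OF this assms(2,3)] show ?thesis
    by (simp add: pairing_def mult_matrix_op_def vec_eq_iff matrix_vector_mult_def cinner.sum_left)
qed

lemma mult_matrix_op_left_inverse:
  assumes "M \<in> B1_star \<Omega>" "\<Theta> \<in> mult_matrices M \<Omega>" "\<Psi> \<in> mult_matrices M \<Omega>" "left_inverse_on \<Omega> \<Psi> \<Theta>"
  shows "mult_matrix_op M \<Omega> \<Psi> (mult_matrix_op M \<Omega> \<Theta> x) = x"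
  by (rule pairing_total[OF assms(1)])
    (use assms in \<open>simp add: pairing_mult_matrix_op matrix_vector_mul_assoc left_inverse_on_def\<close>)

text \<open>With a left inverse the range is the set of fixed points of a continuous map.\<close>

lemma range_mult_matrix_op:
  assumes "M \<in> B1_star \<Omega>" "\<Theta> \<in> mult_matrices M \<Omega>" "\<Psi> \<in> mult_matrices M \<Omega>" "left_inverse_on \<Omega> \<Psi> \<Theta>"
  shows "csubspace (range (mult_matrix_op M \<Omega> \<Theta>))" and "closed (range (mult_matrix_op M \<Omega> \<Theta>))"
proof -
  let ?T = "mult_matrix_op M \<Omega> \<Theta>" and ?R = "mult_matrix_op M \<Omega> \<Psi>"
  note T = bounded_clinear_mult_matrix_op[OF assms(2)] and R = bounded_clinear_mult_matrix_op[OF assms(3)]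
  note Tlin = linear_simps[OF bounded_clinearD[OF T]]
  show "csubspace (range ?T)"
    unfolding complex_vector.subspace_def
    by (auto simp flip: Tlin bounded_clinear_scaleC[OF T])
  have "range ?T = {x. ?T (?R x) = x}"
    using mult_matrix_op_left_inverse[OF assms] by (auto, metis rangeI)
  moreover have "continuous_on UNIV (\<lambda>x. ?T (?R x))"
    by (intro linear_continuous_on bounded_clinearD bounded_clinear_compose[OF T R])
  then have "closed {x. ?T (?R x) = x}" by (intro closed_Collect_eq continuous_on_id)
  ultimately show "closed (range ?T)" by simp
qed

text \<open>The action of the coordinates on the direct sum.\<close>

definition entrywise :: "('n \<Rightarrow> 'h \<Rightarrow> 'h) \<Rightarrow> 'n \<Rightarrow> 'h ^ 'q \<Rightarrow> 'h ^ 'q" where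
  "entrywise M i x = (\<chi> k. M i (x $ k))"

lemma cinner_coordinate_op:
  assumes "hilbert_module M" "k \<in> eigenspace_star M w"
  shows "cinner (M i x) k = w $ i * cinner x k"
proof -
  have "bounded_clinear (M i)" using assms(1) by (simp add: hilbert_module_def)
  then show ?thesis
    using assms by (simp add: cinner_cadjoint mem_eigenspace_star(1) cinner_scaleC_right)
qed

lemma pairing_entrywise:
  assumes "hilbert_module M" "k \<in> eigenspace_star M w"
  shows "pairing k (entrywise M i x) = w $ i *s pairing k x"
  by (simp add: pairing_def entrywise_def vec_eq_iff cinner_coordinate_op[OF assms])

lemma bounded_clinear_entrywise:
  assumes "hilbert_module M"
  shows "bounded_clinear (entrywise M i)"
proof (rule bounded_clinear_vec)
  fix k
  have "bounded_clinear (M i)" using assms by (simp add: hilbert_module_def)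
  from bounded_clinear_compose[OF this bounded_clinear_vec_nth]
  show "bounded_clinear (\<lambda>x. entrywise M i x $ k)" by (simp add: entrywise_def)
qed

lemma entrywise_mult_matrix_op:
  assumes "M \<in> B1_star \<Omega>" "\<Theta> \<in> mult_matrices M \<Omega>"
  shows "entrywise M i (mult_matrix_op M \<Omega> \<Theta> x) = mult_matrix_op M \<Omega> \<Theta> (entrywise M i x)"
  by (rule pairing_total[OF assms(1)])
    (use assms in \<open>simp add: pairing_mult_matrix_op pairing_entrywise B1_star_def vector_scalar_commute\<close>)

section \<open>The formal determinant\<close>

text \<open>Expansion along the first column: the determinant is linear in it.\<close>

lemma sum_formal_det:
  "(\<Sum>k\<in>UNIV. formal_det A $ k * x $ k) = det (\<chi> i j. case j of None \<Rightarrow> x $ i | Some j' \<Rightarrow> A $ i $ j')"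
proof -
  define c where "c j = (\<chi> i. case j of None \<Rightarrow> 0 | Some j' \<Rightarrow> A $ i $ j')" for j
  have d: "det (\<chi> i j. case j of None \<Rightarrow> y $ i | Some j' \<Rightarrow> A $ i $ j') = det (\<chi> j. if j = None then y else c j)"
    for y :: "complex ^ 'a option"
  proof -
    have "transpose (\<chi> i j. case j of None \<Rightarrow> y $ i | Some j' \<Rightarrow> A $ i $ j') = (\<chi> j. if j = None then y else c j)"
      by (auto simp: transpose_def vec_eq_iff c_def split: option.splits)
    then show ?thesis
      using det_transpose[of "\<chi> i j. case j of None \<Rightarrow> y $ i | Some j' \<Rightarrow> A $ i $ j'"] by argo
  qed
  have "det (\<chi> j. if j = None then x else c j) = det (\<chi> j. if j = None then (\<Sum>k\<in>UNIV. x $ k *s axis k 1) else c j)"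
    unfolding basis_expansion ..
  also have "\<dots> = (\<Sum>k\<in>UNIV. det (\<chi> j. if j = None then x $ k *s axis k 1 else c j))"
    by (rule det_linear_row_sum) simp
  also have "\<dots> = (\<Sum>k\<in>UNIV. x $ k * det (\<chi> j. if j = None then axis k 1 else c j))"
    by (simp only: det_row_mul)
  also have "\<dots> = (\<Sum>k\<in>UNIV. formal_det A $ k * x $ k)"
  proof (rule sum.cong[OF refl])
    fix k
    have "formal_det A $ k = det (\<chi> i j. case j of None \<Rightarrow> (axis k 1 :: complex ^ 'a option) $ i | Some j' \<Rightarrow> A $ i $ j')"
      unfolding formal_det_def vec_lambda_beta by (rule arg_cong[where f = det]) (auto simp: vec_eq_iff axis_def split: option.splits)
    then show "x $ k * det (\<chi> j. if j = None then axis k 1 else c j) = formal_det A $ k * x $ k"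
      unfolding d by simp
  qed
  finally show ?thesis unfolding d ..
qed

lemma det_eq_0_iff_kernel: "det (A :: complex ^ 'n ^ 'n) = 0 \<longleftrightarrow> (\<exists>x. x \<noteq> 0 \<and> A *v x = 0)"
  using invertible_det_nz[of A] matrix_left_invertible_ker[of A] matrix_left_right_inverse[where 'a = complex and 'n = 'n]
  unfolding invertible_def by metis

text \<open>The columns of \<open>A\<close> being independent, \<open>det [x | A]\<close> vanishes exactly when \<open>x\<close> depends on them; in that case
\<open>\<Psi> *v x\<close> is its coordinate vector.\<close>

lemma sum_formal_det_eq_0_iff:
  assumes "\<Psi> ** A = mat 1"
  shows "(\<Sum>k\<in>UNIV. formal_det A $ k * x $ k) = 0 \<longleftrightarrow> A *v (\<Psi> *v x) = x"
proof -
  define B where "B = (\<chi> i j. case j of None \<Rightarrow> x $ i | Some j' \<Rightarrow> A $ i $ j')"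
  have Bv: "B *v v = v $ None *s x + A *v (\<chi> j. v $ Some j)" for v
    by (simp add: vec_eq_iff matrix_vector_mult_def B_def UNIV_option_conv sum.reindex mult.commute)
  have inj: "\<Psi> *v (A *v y) = y" for y using assms by (simp add: matrix_vector_mul_assoc)
  have "(\<exists>v. v \<noteq> 0 \<and> B *v v = 0) \<longleftrightarrow> A *v (\<Psi> *v x) = x"
  proof
    assume "\<exists>v. v \<noteq> 0 \<and> B *v v = 0"
    then obtain v where v: "v \<noteq> 0" "v $ None *s x + A *v (\<chi> j. v $ Some j) = 0" using Bv by metis
    have n: "v $ None \<noteq> 0"
    proof
      assume n: "v $ None = 0"
      then have "A *v (\<chi> j. v $ Some j) = 0" using v by simp
      then have "(\<chi> j. v $ Some j) = 0" using inj by (metis matrix_vector_mult_0_right)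
      then have "v = 0" using n by (simp add: vec_eq_iff) (metis option.exhaust)
      then show False using v by simp
    qed
    define y where "y = (\<chi> j. - (v $ Some j / v $ None))"
    have "x = A *v y"
    proof -
      have "x $ i = (A *v y) $ i" for i
      proof -
        have "v $ None * x $ i + (\<Sum>j\<in>UNIV. A $ i $ j * v $ Some j) = 0"
          using v(2) by (simp add: vec_eq_iff matrix_vector_mult_def)
        then have "x $ i = - (\<Sum>j\<in>UNIV. A $ i $ j * v $ Some j) / v $ None"
          using n by (simp add: field_simps eq_neg_iff_add_eq_0)
        also have "\<dots> = (A *v y) $ i"
          by (simp add: matrix_vector_mult_def y_def sum_negf sum_divide_distrib)
        finally show ?thesis .
      qed
      then show ?thesis by (simp add: vec_eq_iff)
    qed
    then show "A *v (\<Psi> *v x) = x" by (simp add: inj)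
  next
    assume x: "A *v (\<Psi> *v x) = x"
    define v where "v = (\<chi> j. case j of None \<Rightarrow> - 1 | Some j' \<Rightarrow> (\<Psi> *v x) $ j')"
    have "v $ None = - 1" "(\<chi> j. v $ Some j) = \<Psi> *v x" by (simp_all add: v_def vec_eq_iff)
    then have "B *v v = 0" and "v \<noteq> 0" using x by (auto simp: Bv)
    then show "\<exists>v. v \<noteq> 0 \<and> B *v v = 0" by blast
  qed
  then show ?thesis unfolding sum_formal_det B_def[symmetric] det_eq_0_iff_kernel .
qed

text \<open>Otherwise \<open>A\<close> would be onto, and the two products of \<open>A\<close> with its inverse would have equal traces
\<open>l + 1\<close> and \<open>l\<close>.\<close>

lemma formal_det_nonzero:
  fixes A :: "complex ^ 'l::finite ^ 'l option"
  assumes "\<Psi> ** A = mat 1"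
  shows "formal_det A \<noteq> 0"
proof
  assume "formal_det A = 0"
  then have "A *v (\<Psi> *v x) = x" for x using sum_formal_det_eq_0_iff[OF assms, of x] by simp
  then have "A ** \<Psi> = mat 1" by (simp add: matrix_eq matrix_vector_mul_assoc)
  then have "(\<Sum>i\<in>UNIV. (A ** \<Psi>) $ i $ i) = of_nat (CARD('l option))" by (simp add: mat_def)
  moreover have "(\<Sum>i\<in>UNIV. (A ** \<Psi>) $ i $ i) = (\<Sum>j\<in>UNIV. (\<Psi> ** A) $ j $ j)"
    unfolding matrix_matrix_mult_def vec_lambda_beta by (subst sum.swap) (simp add: mult.commute)
  moreover have "\<dots> = of_nat (CARD('l))" by (simp add: assms mat_def)
  ultimately have "(of_nat (CARD('l option)) :: complex) = of_nat (CARD('l))" by simp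
  then show False unfolding of_nat_eq_iff by simp
qed

text \<open>The range of \<open>A\<close> is a hyperplane with equation \<open>formal_det A\<close>, and a hyperplane determines its equation up to a
factor.\<close>

lemma annihilator_multiple_of_formal_det:
  fixes A :: "complex ^ 'l::finite ^ 'l option"
  assumes inv: "\<Psi> ** A = mat 1" and ann: "\<And>y. (\<Sum>k\<in>UNIV. a $ k * (A *v y) $ k) = 0"
  shows "\<exists>c. a = c *s formal_det A"
proof -
  let ?d = "formal_det A"
  obtain m where m: "?d $ m \<noteq> 0" using formal_det_nonzero[OF inv] by (auto simp: vec_eq_iff)
  have "a $ k * ?d $ m = a $ m * ?d $ k" for k
  proof -
    \<comment> \<open>a vector annihilated by \<open>?d\<close>, hence in the range of \<open>A\<close>\<close>
    define x where "x = ?d $ m *s axis k 1 - ?d $ k *s axis m 1"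
    have s: "(\<Sum>i\<in>UNIV. b $ i * x $ i) = ?d $ m * b $ k - ?d $ k * b $ m" for b :: "complex ^ 'l option"
    proof -
      have "(\<Sum>i\<in>UNIV. b $ i * x $ i) = (\<Sum>i\<in>UNIV. (if i = k then ?d $ m * b $ k else 0) - (if i = m then ?d $ k * b $ m else 0))"
        by (rule sum.cong) (auto simp: x_def axis_def algebra_simps)
      then show ?thesis by (simp add: sum_subtractf)
    qed
    have "A *v (\<Psi> *v x) = x" using sum_formal_det_eq_0_iff[OF inv, of x] s[of ?d] by simp
    then have "(\<Sum>i\<in>UNIV. a $ i * x $ i) = 0" using ann[of "\<Psi> *v x"] by simp
    then show ?thesis using s[of a] by (simp add: mult.commute)
  qed
  then have "a = (a $ m / ?d $ m) *s ?d" using m by (simp add: vec_eq_iff field_simps)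
  then show ?thesis by blast
qed

section \<open>Quotient modules\<close>

lemma scaleC_minus_one: "(- 1) *\<^sub>C x = - (x :: 'a::chilbert_space)"
  using scaleC_of_real[of "-1" x] by simp

lemma mem_coset_iff: "y \<in> x +o S \<longleftrightarrow> y - x \<in> (S :: 'a::ab_group_add set)"
  unfolding elt_set_plus_def by (auto intro: bexI[of _ "y - x"])

lemma coset_eq_iff:
  assumes "csubspace S"
  shows "x +o S = y +o S \<longleftrightarrow> x - y \<in> S"
proof
  assume "x +o S = y +o S"
  moreover have "x \<in> x +o S" using assms by (simp add: mem_coset_iff csubspace_0)
  ultimately show "x - y \<in> S" by (simp add: mem_coset_iff)
next
  assume d: "x - y \<in> S"
  show "x +o S = y +o S"
  proof (rule set_eqI)
    fix z
    have "z - y = (z - x) + (x - y)" "z - x = (z - y) - (x - y)" by simp_all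
    then show "z \<in> x +o S \<longleftrightarrow> z \<in> y +o S"
      unfolding mem_coset_iff using d assms
      by (metis csubspace_add csubspace_diff)
  qed
qed

lemma subspace_plus_self: "csubspace S \<Longrightarrow> S + S = S"
proof
  assume S: "csubspace S"
  show "S + S \<subseteq> S" using S by (auto simp: set_plus_def csubspace_add)
  show "S \<subseteq> S + S"
  proof
    fix x assume "x \<in> S"
    then have "0 + x \<in> S + S" by (rule set_plus_intro[OF csubspace_0[OF S]])
    then show "x \<in> S + S" by simp
  qed
qed

lemma coset_add:
  assumes "csubspace S"
  shows "(x +o S) + (y +o S) = (x + y) +o S"
  by (simp add: set_plus_rearrange subspace_plus_self[OF assms])

lemma induced_op_coset:
  assumes S: "csubspace S" and add: "\<And>x y. T (x + y) = T x + T y" and inv: "\<And>x. x \<in> S \<Longrightarrow> T x \<in> S"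
  shows "induced_op S T (x +o S) = T x +o S"
proof
  show "induced_op S T (x +o S) \<subseteq> T x +o S"
  proof
    fix z assume "z \<in> induced_op S T (x +o S)"
    then obtain s t where "s \<in> S" "t \<in> S" "z = T (x + s) + t"
      unfolding induced_op_def elt_set_plus_def set_plus_def by auto
    then show "z \<in> T x +o S" using S inv by (simp add: mem_coset_iff add csubspace_add)
  qed
  show "T x +o S \<subseteq> induced_op S T (x +o S)"
  proof
    fix z assume z: "z \<in> T x +o S"
    have "x \<in> x +o S" using S by (simp add: mem_coset_iff csubspace_0)
    then have "T x + (z - T x) \<in> T ` (x +o S) + S"
      using z by (intro set_plus_intro imageI) (simp_all add: mem_coset_iff)
    then show "z \<in> induced_op S T (x +o S)" by (simp add: induced_op_def)
  qed
qed

text \<open>The representative of least norm of the coset of \<open>x\<close>.\<close>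

definition perp_part :: "'a::chilbert_space set \<Rightarrow> 'a \<Rightarrow> 'a" where
  "perp_part S x = (SOME p. p \<in> orthocomp S \<and> x - p \<in> S)"

lemma
  assumes "csubspace S" "closed S"
  shows perp_part_orthocomp: "perp_part S x \<in> orthocomp S"
    and diff_perp_part: "x - perp_part S x \<in> S"
proof -
  obtain p where "p \<in> S" "x - p \<in> orthocomp S" using ex_orthogonal_projection[OF assms] by blast
  then have "x - p \<in> orthocomp S \<and> x - (x - p) \<in> S" by simp
  then have "perp_part S x \<in> orthocomp S \<and> x - perp_part S x \<in> S"
    unfolding perp_part_def by (rule someI)
  then show "perp_part S x \<in> orthocomp S" "x - perp_part S x \<in> S" by simp_all
qed

lemma orthocomp_eqI:
  assumes "csubspace S" "p \<in> orthocomp S" "q \<in> orthocomp S" "p - q \<in> S"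
  shows "p = q"
proof -
  have "p - q \<in> orthocomp S" using assms csubspace_orthocomp csubspace_diff by blast
  then show ?thesis using assms(4) orthocomp_Int_self by fastforce
qed

lemma perp_part_eqI:
  assumes "csubspace S" "closed S" "p \<in> orthocomp S" "x - p \<in> S"
  shows "perp_part S x = p"
proof (rule orthocomp_eqI[OF assms(1) perp_part_orthocomp[OF assms(1,2)] assms(3)])
  have "perp_part S x - p = (x - p) - (x - perp_part S x)" by simp
  then show "perp_part S x - p \<in> S"
    using assms diff_perp_part csubspace_diff by metis
qed

lemma perp_part_id:
  assumes "csubspace S" "closed S" "p \<in> orthocomp S"
  shows "perp_part S p = p"
  by (rule perp_part_eqI[OF assms]) (simp add: csubspace_0[OF assms(1)])

lemma perp_part_add:
  assumes S: "csubspace S" "closed S"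
  shows "perp_part S (x + y) = perp_part S x + perp_part S y"
proof (rule perp_part_eqI[OF S])
  show "perp_part S x + perp_part S y \<in> orthocomp S"
    by (intro csubspace_add csubspace_orthocomp perp_part_orthocomp S)
  have "x + y - (perp_part S x + perp_part S y) = (x - perp_part S x) + (y - perp_part S y)" by simp
  then show "x + y - (perp_part S x + perp_part S y) \<in> S"
    using S diff_perp_part csubspace_add by metis
qed

lemma perp_part_scaleC:
  assumes S: "csubspace S" "closed S"
  shows "perp_part S (c *\<^sub>C x) = c *\<^sub>C perp_part S x"
proof (rule perp_part_eqI[OF S])
  show "c *\<^sub>C perp_part S x \<in> orthocomp S"
    by (intro csubspace_scale csubspace_orthocomp perp_part_orthocomp S)
  show "c *\<^sub>C x - c *\<^sub>C perp_part S x \<in> S"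
    unfolding scaleC.diff_right[symmetric] by (intro csubspace_scale S diff_perp_part)
qed

lemma coset_perp_part:
  assumes "csubspace S" "closed S"
  shows "perp_part S x +o S = x +o S"
proof -
  have "x - perp_part S x \<in> S" by (rule diff_perp_part[OF assms])
  then show ?thesis using coset_eq_iff[OF assms(1)] by metis
qed

lemma cinner_perp_part:
  assumes "csubspace S" "closed S" "y \<in> orthocomp S"
  shows "cinner (perp_part S x) y = cinner x y"
  using orthocompD'[OF assms(3) diff_perp_part[OF assms(1,2)], of x] by (simp add: cinner.diff_left)

lemma norm_coset:
  assumes S: "csubspace S" and x: "x \<in> orthocomp S"
  shows "(INF a\<in>x +o S. norm a) = norm x"
proof (rule antisym)
  have x0: "x \<in> x +o S" using S by (simp add: mem_coset_iff csubspace_0)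
  show "(INF a\<in>x +o S. norm a) \<le> norm x"
    by (rule cINF_lower[OF bdd_belowI[of _ 0] x0]) auto
  show "norm x \<le> (INF a\<in>x +o S. norm a)"
  proof (rule cINF_greatest)
    fix a assume "a \<in> x +o S"
    then have "cinner x (a - x) = 0" using x by (auto simp: mem_coset_iff orthocompD)
    then have "cinner x x = cinner x a" by (simp add: cinner.diff_right)
    then have "(norm x)\<^sup>2 = cmod (cinner x a)" by (metis cinner_self norm_of_real abs_of_nonneg zero_le_power2)
    also have "\<dots> \<le> norm x * norm a" by (rule cmod_cinner_le)
    finally show "norm x \<le> norm a" by (cases "norm x = 0") (auto simp: power2_eq_square)
  qed (use x0 in auto)
qed

text \<open>Orthogonal complements, with the compressions of the \<open>N i\<close>, are models of the quotients.\<close>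

definition intertwining_unitary ::
  "('n \<Rightarrow> 'a::chilbert_space \<Rightarrow> 'a) \<Rightarrow> 'a set \<Rightarrow> 'a set \<Rightarrow> ('a \<Rightarrow> 'a) \<Rightarrow> bool" where
  "intertwining_unitary N S1 S2 V \<longleftrightarrow>
     V ` orthocomp S1 = orthocomp S2
     \<and> (\<forall>x\<in>orthocomp S1. \<forall>y\<in>orthocomp S1. V (x + y) = V x + V y)
     \<and> (\<forall>c. \<forall>x\<in>orthocomp S1. V (c *\<^sub>C x) = c *\<^sub>C V x)
     \<and> (\<forall>x\<in>orthocomp S1. norm (V x) = norm x)
     \<and> (\<forall>i. \<forall>x\<in>orthocomp S1. V (perp_part S1 (N i x)) = perp_part S2 (N i (V x)))"

text \<open>A coset contains exactly one vector orthogonal to the subspace, and the norm of the coset is the norm of that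
vector.\<close>

lemma isomorphic_quotients_iff:
  assumes S1: "csubspace S1" "closed S1" and S2: "csubspace S2" "closed S2"
    and N: "\<And>i. bounded_clinear (N i)"
    and inv1: "\<And>i x. x \<in> S1 \<Longrightarrow> N i x \<in> S1" and inv2: "\<And>i x. x \<in> S2 \<Longrightarrow> N i x \<in> S2"
  shows "isomorphic_modules (quotient_module N S1) (quotient_module N S2)
    \<longleftrightarrow> (\<exists>V. intertwining_unitary N S1 S2 V)"
proof -
  let ?Q1 = "quotient_module N S1" and ?Q2 = "quotient_module N S2"
  have Nadd: "N i (x + y) = N i x + N i y" for i x y
    using linear_simps(1)[OF bounded_clinearD[OF N]] .
  have act: "induced_op S1 (N i) (x +o S1) = N i x +o S1" "induced_op S2 (N i) (x +o S2) = N i x +o S2" for i x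
    by (rule induced_op_coset[OF S1(1) Nadd inv1], assumption, rule induced_op_coset[OF S2(1) Nadd inv2], assumption)
  have scale: "induced_op S1 (scaleC c) (x +o S1) = (c *\<^sub>C x) +o S1" "induced_op S2 (scaleC c) (x +o S2) = (c *\<^sub>C x) +o S2" for c x
    by (rule induced_op_coset; use S1 S2 in \<open>simp add: scaleC_add_right csubspace_scale\<close>)+
  note add1 = coset_add[OF S1(1)] and add2 = coset_add[OF S2(1)]
  note perp1 = perp_part_orthocomp[OF S1] and perp2 = perp_part_orthocomp[OF S2]
  have unique2: "p = q" if "p +o S2 = q +o S2" "p \<in> orthocomp S2" "q \<in> orthocomp S2" for p q
    using that orthocomp_eqI[OF S2(1)] coset_eq_iff[OF S2(1)] by blast
  show ?thesis
  proof
    assume "isomorphic_modules ?Q1 ?Q2"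
    then obtain U where U: "unitary_module_map ?Q1 ?Q2 U" unfolding isomorphic_modules_def by blast
    have bij: "bij_betw U (range (\<lambda>x. x +o S1)) (range (\<lambda>x. x +o S2))"
      using U by (simp add: unitary_module_map_def quotient_module_def)
    have Uadd: "U ((x + y) +o S1) = U (x +o S1) + U (y +o S1)" for x y
      using U by (simp add: unitary_module_map_def quotient_module_def add1)
    have Uscale: "U ((c *\<^sub>C x) +o S1) = induced_op S2 (scaleC c) (U (x +o S1))" for c x
      using U by (simp add: unitary_module_map_def quotient_module_def scale(1))
    have Unorm: "(INF a\<in>U (x +o S1). norm a) = (INF a\<in>x +o S1. norm a)" for x
      using U by (simp add: unitary_module_map_def quotient_module_def)
    have Uact: "U (N i x +o S1) = induced_op S2 (N i) (U (x +o S1))" for i x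
      using U by (simp add: unitary_module_map_def quotient_module_def act(1))
    have "\<exists>p. p \<in> orthocomp S2 \<and> U (x +o S1) = p +o S2" for x
    proof -
      have "U (x +o S1) \<in> range (\<lambda>x. x +o S2)" using bij bij_betwE by blast
      then obtain y where "U (x +o S1) = y +o S2" by blast
      then show ?thesis using perp2[of y] coset_perp_part[OF S2, of y] by metis
    qed
    then obtain V where V: "\<And>x. V x \<in> orthocomp S2" "\<And>x. U (x +o S1) = V x +o S2" by metis
    have Vcong: "V x = V y" if "x +o S1 = y +o S1" for x y
      using V that unique2 by metis
    have "intertwining_unitary N S1 S2 V"
      unfolding intertwining_unitary_def
    proof (intro conjI ballI allI)
      fix x y c i
      show "V (x + y) = V x + V y"
        using Uadd[of x y] unfolding V(2) add2
        by (rule unique2) (intro V csubspace_add[OF csubspace_orthocomp])+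
      show "V (c *\<^sub>C x) = c *\<^sub>C V x"
        using Uscale[of c x] unfolding V(2) scale(2)
        by (rule unique2) (intro V csubspace_scale[OF csubspace_orthocomp])+
      have "N i (V x) +o S2 = perp_part S2 (N i (V x)) +o S2" by (simp add: coset_perp_part[OF S2])
      then have "V (N i x) +o S2 = perp_part S2 (N i (V x)) +o S2"
        using Uact[of i x] unfolding V(2) act(2) by simp
      then have "V (N i x) = perp_part S2 (N i (V x))" by (rule unique2) (intro V perp2)+
      then show "V (perp_part S1 (N i x)) = perp_part S2 (N i (V x))"
        using Vcong[OF coset_perp_part[OF S1]] by simp
      show "norm (V x) = norm x" if "x \<in> orthocomp S1"
        using Unorm[of x] unfolding V(2) norm_coset[OF S2(1) V(1)] norm_coset[OF S1(1) that] .
      show "V ` orthocomp S1 = orthocomp S2"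
      proof
        show "V ` orthocomp S1 \<subseteq> orthocomp S2" using V by blast
        show "orthocomp S2 \<subseteq> V ` orthocomp S1"
        proof
          fix y assume y: "y \<in> orthocomp S2"
          have "y +o S2 \<in> U ` range (\<lambda>x. x +o S1)" using bij unfolding bij_betw_def by blast
          then obtain x where x: "U (x +o S1) = y +o S2" by auto
          have "V (perp_part S1 x) = V x" by (rule Vcong[OF coset_perp_part[OF S1]])
          also have "\<dots> = y" by (rule unique2[OF _ V(1) y]) (use x V(2) in metis)
          finally show "y \<in> V ` orthocomp S1" using perp1 by blast
        qed
      qed
    qed
    then show "\<exists>V. intertwining_unitary N S1 S2 V" by blast
  next
    assume "\<exists>V. intertwining_unitary N S1 S2 V"
    then obtain V where "intertwining_unitary N S1 S2 V" by blast
    then have im: "V ` orthocomp S1 = orthocomp S2"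
      and Vadd: "\<And>x y. x \<in> orthocomp S1 \<Longrightarrow> y \<in> orthocomp S1 \<Longrightarrow> V (x + y) = V x + V y"
      and Vscale: "\<And>c x. x \<in> orthocomp S1 \<Longrightarrow> V (c *\<^sub>C x) = c *\<^sub>C V x"
      and Vnorm: "\<And>x. x \<in> orthocomp S1 \<Longrightarrow> norm (V x) = norm x"
      and Vact: "\<And>i x. x \<in> orthocomp S1 \<Longrightarrow> V (perp_part S1 (N i x)) = perp_part S2 (N i (V x))"
      unfolding intertwining_unitary_def by blast+
    have VK: "V x \<in> orthocomp S2" if "x \<in> orthocomp S1" for x using im that by blast
    define P where "P = perp_part S1"
    have PK: "P x \<in> orthocomp S1" for x unfolding P_def by (rule perp1)
    define U where "U A = V (P (SOME a. a \<in> A)) +o S2" for A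
    have U: "U (x +o S1) = V (P x) +o S2" for x
    proof -
      have "x \<in> x +o S1" using S1 by (simp add: mem_coset_iff csubspace_0)
      then have "(SOME a. a \<in> x +o S1) \<in> x +o S1" by (rule someI)
      then have "(SOME a. a \<in> x +o S1) - P x \<in> S1"
        using diff_perp_part[OF S1, of x] csubspace_add[OF S1(1)]
        by (fastforce simp: mem_coset_iff P_def)
      then have "P (SOME a. a \<in> x +o S1) = P x"
        unfolding P_def by (rule perp_part_eqI[OF S1 perp1])
      then show ?thesis by (simp add: U_def)
    qed
    have "unitary_module_map ?Q1 ?Q2 U"
      unfolding unitary_module_map_def
    proof (intro conjI ballI allI)
      show "bij_betw U (Mcarrier ?Q1) (Mcarrier ?Q2)"
        unfolding bij_betw_def
      proof
        show "inj_on U (Mcarrier ?Q1)"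
        proof (rule inj_onI)
          fix A B assume "A \<in> Mcarrier ?Q1" "B \<in> Mcarrier ?Q1" and eq: "U A = U B"
          then obtain x y where AB: "A = x +o S1" "B = y +o S1" by (auto simp: quotient_module_def)
          then have "V (P x) = V (P y)" using eq unique2 VK PK by (simp add: U)
          moreover have "V (P x + (- 1) *\<^sub>C P y) = V (P x) + (- 1) *\<^sub>C V (P y)"
            by (simp only: Vadd Vscale PK csubspace_scale[OF csubspace_orthocomp])
          ultimately have "V (P x - P y) = 0" by (simp add: scaleC_minus_one)
          then have "P x - P y = 0"
            using Vnorm[OF csubspace_diff[OF csubspace_orthocomp PK PK], of x y] by simp
          then have "x +o S1 = y +o S1"
            using coset_perp_part[OF S1, of x] coset_perp_part[OF S1, of y] by (simp add: P_def)
          then show "A = B" using AB by simp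
        qed
        show "U ` Mcarrier ?Q1 = Mcarrier ?Q2"
        proof
          show "U ` Mcarrier ?Q1 \<subseteq> Mcarrier ?Q2" by (auto simp: quotient_module_def U)
          show "Mcarrier ?Q2 \<subseteq> U ` Mcarrier ?Q1"
          proof
            fix B assume "B \<in> Mcarrier ?Q2"
            then obtain y where "B = y +o S2" by (auto simp: quotient_module_def)
            then have B: "B = perp_part S2 y +o S2" by (simp add: coset_perp_part[OF S2])
            have "perp_part S2 y \<in> V ` orthocomp S1" unfolding im by (rule perp2)
            then obtain x where "x \<in> orthocomp S1" "perp_part S2 y = V x" by (rule imageE)
            with B have "U (x +o S1) = B" by (simp add: U P_def perp_part_id[OF S1])
            then show "B \<in> U ` Mcarrier ?Q1" by (auto simp: quotient_module_def)
          qed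
        qed
      qed
      fix A assume "A \<in> Mcarrier ?Q1"
      then obtain x where A: "A = x +o S1" by (auto simp: quotient_module_def)
      show "U (Mscale ?Q1 c A) = Mscale ?Q2 c (U A)" for c
        by (simp add: A quotient_module_def scale U P_def perp_part_scaleC[OF S1] Vscale perp1)
      show "Mnorm ?Q2 (U A) = Mnorm ?Q1 A"
      proof -
        have "Mnorm ?Q2 (U A) = norm (P x)"
          by (simp add: A quotient_module_def U norm_coset[OF S2(1)] VK PK Vnorm)
        also have "\<dots> = (INF a\<in>P x +o S1. norm a)" by (rule norm_coset[OF S1(1) PK, symmetric])
        finally show ?thesis by (simp add: A quotient_module_def P_def coset_perp_part[OF S1])
      qed
      show "U (Mact ?Q1 i A) = Mact ?Q2 i (U A)" for i
      proof -
        have "P (N i x) = P (N i (P x))"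
          unfolding P_def
        proof (rule perp_part_eqI[OF S1 perp1])
          have "N i x - perp_part S1 (N i (perp_part S1 x))
              = N i (x - perp_part S1 x) + (N i (perp_part S1 x) - perp_part S1 (N i (perp_part S1 x)))"
            using Nadd[of i "x - perp_part S1 x" "perp_part S1 x"] by simp
          then show "N i x - perp_part S1 (N i (perp_part S1 x)) \<in> S1"
            using inv1[OF diff_perp_part[OF S1]] diff_perp_part[OF S1] csubspace_add[OF S1(1)] by metis
        qed
        then have "V (P (N i x)) = perp_part S2 (N i (V (P x)))" using Vact[OF PK] by (simp add: P_def)
        then show ?thesis by (simp add: A quotient_module_def act U coset_perp_part[OF S2])
      qed
      fix B assume "B \<in> Mcarrier ?Q1"
      then obtain y where B: "B = y +o S1" by (auto simp: quotient_module_def)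
      show "U (Madd ?Q1 A B) = Madd ?Q2 (U A) (U B)"
        by (simp add: A B quotient_module_def add1 add2 U P_def perp_part_add[OF S1] Vadd perp1)
    qed
    then show "isomorphic_modules ?Q1 ?Q2" unfolding isomorphic_modules_def by blast
  qed
qed

section \<open>Unitaries from equal Gram matrices\<close>

text \<open>The inner product is determined by the norm.\<close>

lemma isometry_preserves_cinner:
  assumes K: "csubspace K"
    and add: "\<And>x y. x \<in> K \<Longrightarrow> y \<in> K \<Longrightarrow> V (x + y) = V x + V y"
    and scale: "\<And>c x. x \<in> K \<Longrightarrow> V (c *\<^sub>C x) = c *\<^sub>C V x"
    and norm: "\<And>x. x \<in> K \<Longrightarrow> norm (V x) = norm x"
    and xy: "x \<in> K" "y \<in> K"
  shows "cinner (V x) (V y) = cinner x y"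
proof -
  have inner: "inner (V x) (V y) = inner x y" if "x \<in> K" "y \<in> K" for x y
  proof -
    have "(norm (V x + V y))\<^sup>2 = (norm (x + y))\<^sup>2"
      using norm[OF csubspace_add[OF K that]] add[OF that] by simp
    then show ?thesis using norm[OF that(1)] norm[OF that(2)]
      by (simp add: power2_norm_eq_inner[symmetric] dot_norm)
  qed
  show ?thesis
    using inner[OF xy] inner[OF xy(1) csubspace_scale[OF K xy(2)]]
    by (simp add: cinner_eq_inner scale[OF xy(2)])
qed

text \<open>The closed linear span of the pairs \<open>(g i, h i)\<close>.  When the Gram matrices agree, it is the graph of an isometry,
and this makes an extension argument for densely defined maps superfluous.\<close>

inductive gram_graph ::
  "'i set \<Rightarrow> ('i \<Rightarrow> 'a::chilbert_space) \<Rightarrow> ('i \<Rightarrow> 'b::chilbert_space) \<Rightarrow> 'a \<Rightarrow> 'b \<Rightarrow> bool"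
  for I g h where
  base: "i \<in> I \<Longrightarrow> gram_graph I g h (g i) (h i)"
| zero: "gram_graph I g h 0 0"
| add: "gram_graph I g h x y \<Longrightarrow> gram_graph I g h x' y' \<Longrightarrow> gram_graph I g h (x + x') (y + y')"
| scale: "gram_graph I g h x y \<Longrightarrow> gram_graph I g h (c *\<^sub>C x) (c *\<^sub>C y)"
| lim: "(\<And>n. gram_graph I g h (f n) (f' n)) \<Longrightarrow> f \<longlonglongrightarrow> x \<Longrightarrow> f' \<longlonglongrightarrow> y \<Longrightarrow> gram_graph I g h x y"

lemma gram_graph_swap: "gram_graph I g h x y \<Longrightarrow> gram_graph I h g y x"
  by (induction rule: gram_graph.induct) (auto intro: gram_graph.intros)

lemma gram_graph_mem: "gram_graph I g h x y \<Longrightarrow> x \<in> closure (cspan (g ` I))"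
proof (induction rule: gram_graph.induct)
  case (base i)
  then show ?case by (intro subsetD[OF closure_subset] complex_vector.span_base imageI)
next
  case (lim f f' x y)
  show ?case by (rule closed_sequentially[OF closed_closure lim.IH lim.hyps(2)])
qed (simp_all add: csubspace_0 csubspace_add csubspace_scale
    csubspace_closure)

lemma gram_graph_cinner:
  assumes gram: "\<And>i j. i \<in> I \<Longrightarrow> j \<in> I \<Longrightarrow> cinner (g i) (g j) = cinner (h i) (h j)"
    and xy: "gram_graph I g h x y" and xy': "gram_graph I g h x' y'"
  shows "cinner x x' = cinner y y'"
proof -
  have "\<forall>j\<in>I. cinner x (g j) = cinner y (h j)" using xy
  proof (induction rule: gram_graph.induct)
    case (lim f f' x y)
    show ?case
    proof
      fix j assume j: "j \<in> I"
      have "(\<lambda>n. cinner (f n) (g j)) \<longlonglongrightarrow> cinner x (g j)" "(\<lambda>n. cinner (f' n) (h j)) \<longlonglongrightarrow> cinner y (h j)"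
        by (intro cinner.tendsto tendsto_const lim.hyps)+
      moreover have "(\<lambda>n. cinner (f n) (g j)) = (\<lambda>n. cinner (f' n) (h j))" using lim.IH j by auto
      ultimately show "cinner x (g j) = cinner y (h j)" using LIMSEQ_unique by metis
    qed
  qed (simp_all add: gram cinner_add_left cinner_scaleC_left)
  with xy' show ?thesis
  proof (induction rule: gram_graph.induct)
    case (lim f f' x' y')
    have "(\<lambda>n. cinner x (f n)) \<longlonglongrightarrow> cinner x x'" "(\<lambda>n. cinner y (f' n)) \<longlonglongrightarrow> cinner y y'"
      by (intro cinner.tendsto tendsto_const lim.hyps)+
    moreover have "(\<lambda>n. cinner x (f n)) = (\<lambda>n. cinner y (f' n))" using lim.IH lim.prems by auto
    ultimately show "cinner x x' = cinner y y'" using LIMSEQ_unique by metis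
  qed (simp_all add: cinner_add_right cinner_scaleC_right)
qed

text \<open>The domain of the graph is a subspace.  It is closed because, along a convergent sequence of first components, the second
components form a Cauchy sequence as well.\<close>

lemma gram_graph_total:
  assumes gram: "\<And>i j. i \<in> I \<Longrightarrow> j \<in> I \<Longrightarrow> cinner (g i) (g j) = cinner (h i) (h j)"
    and x: "x \<in> closure (cspan (g ` I))"
  shows "\<exists>y. gram_graph I g h x y"
proof -
  define D where "D = {x. \<exists>y. gram_graph I g h x y}"
  have "csubspace D" unfolding D_def complex_vector.subspace_def
    by (blast intro: gram_graph.zero gram_graph.add gram_graph.scale)
  moreover have "g ` I \<subseteq> D" unfolding D_def by (blast intro: gram_graph.base)
  moreover have "closed D" unfolding closed_sequential_limits
  proof (intro allI impI, elim conjE)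
    fix f l assume "\<forall>n. f n \<in> D" and f: "f \<longlonglongrightarrow> l"
    then have "\<forall>n. \<exists>y. gram_graph I g h (f n) y" unfolding D_def by simp
    from choice[OF this] obtain f' where f': "\<And>n. gram_graph I g h (f n) (f' n)" by blast
    have "norm (f' m - f' n) = norm (f m - f n)" for m n
    proof -
      have G: "gram_graph I g h (f m + (- 1) *\<^sub>C f n) (f' m + (- 1) *\<^sub>C f' n)"
        by (intro gram_graph.add gram_graph.scale f')
      have "cinner (f m + (- 1) *\<^sub>C f n) (f m + (- 1) *\<^sub>C f n) = cinner (f' m + (- 1) *\<^sub>C f' n) (f' m + (- 1) *\<^sub>C f' n)"
        by (rule gram_graph_cinner[OF gram G G])
      then have "(norm (f m - f n))\<^sup>2 = (norm (f' m - f' n))\<^sup>2"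
        by (simp add: cinner_self scaleC_minus_one flip: of_real_power)
      then show ?thesis by (simp add: power2_eq_iff_nonneg)
    qed
    moreover have "Cauchy f" using f by (rule LIMSEQ_imp_Cauchy)
    ultimately have "Cauchy f'" unfolding Cauchy_def dist_norm by simp
    then obtain l' where "f' \<longlonglongrightarrow> l'" by (meson Cauchy_convergent convergent_def)
    then show "l \<in> D" unfolding D_def using gram_graph.lim[OF f' f] by blast
  qed
  ultimately have "closure (cspan (g ` I)) \<subseteq> D"
    by (intro closure_minimal complex_vector.span_minimal)
  then show ?thesis using x by (auto simp: D_def)
qed

lemma unitary_of_equal_gram:
  fixes g :: "'i \<Rightarrow> 'a::chilbert_space" and h :: "'i \<Rightarrow> 'b::chilbert_space"
  assumes gram: "\<And>i j. i \<in> I \<Longrightarrow> j \<in> I \<Longrightarrow> cinner (g i) (g j) = cinner (h i) (h j)"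
  defines "K \<equiv> closure (cspan (g ` I))" and "L \<equiv> closure (cspan (h ` I))"
  obtains V where "V ` K = L" "\<And>x y. x \<in> K \<Longrightarrow> y \<in> K \<Longrightarrow> V (x + y) = V x + V y"
    "\<And>c x. x \<in> K \<Longrightarrow> V (c *\<^sub>C x) = c *\<^sub>C V x" "\<And>x. x \<in> K \<Longrightarrow> norm (V x) = norm x"
    "\<And>i. i \<in> I \<Longrightarrow> V (g i) = h i"
proof -
  let ?G = "gram_graph I g h"
  have nrm: "norm x = norm y" if "?G x y" for x y
  proof -
    have "cinner x x = cinner y y" by (rule gram_graph_cinner[OF gram that that])
    then have "(norm x)\<^sup>2 = (norm y)\<^sup>2" by (simp add: cinner_self flip: of_real_power)
    then show ?thesis by (simp add: power2_eq_iff_nonneg)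
  qed
  have uniq: "y = y'" if "?G x y" "?G x y'" for x y y'
  proof -
    have "?G (x + (- 1) *\<^sub>C x) (y + (- 1) *\<^sub>C y')" by (intro gram_graph.add gram_graph.scale that)
    then have "norm (x + (- 1) *\<^sub>C x) = norm (y + (- 1) *\<^sub>C y')" by (rule nrm)
    then have "norm (y - y') = 0" by (simp add: scaleC_minus_one)
    then show ?thesis by simp
  qed
  have "\<forall>x\<in>K. \<exists>y. ?G x y" unfolding K_def by (rule ballI) (rule gram_graph_total[OF gram])
  from bchoice[OF this] obtain V where V: "\<And>x. x \<in> K \<Longrightarrow> ?G x (V x)" by blast
  have Veq: "V x = y" if "?G x y" for x y
    using uniq[OF V that] gram_graph_mem[OF that] by (simp add: K_def)
  show ?thesis
  proof
    show "V ` K = L"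
    proof
      show "V ` K \<subseteq> L" using V gram_graph_mem[OF gram_graph_swap] unfolding L_def by blast
      show "L \<subseteq> V ` K"
      proof
        fix y assume "y \<in> L"
        then obtain x where "gram_graph I h g y x" using gram_graph_total[of I h g y] gram unfolding L_def by auto
        then have "?G x y" by (rule gram_graph_swap)
        then show "y \<in> V ` K" using Veq gram_graph_mem unfolding K_def by blast
      qed
    qed
    show "V (x + y) = V x + V y" if "x \<in> K" "y \<in> K" for x y
      by (rule Veq[OF gram_graph.add[OF V[OF that(1)] V[OF that(2)]]])
    show "V (c *\<^sub>C x) = c *\<^sub>C V x" if "x \<in> K" for c x
      by (rule Veq[OF gram_graph.scale[OF V[OF that]]])
    show "norm (V x) = norm x" if "x \<in> K" for x using nrm[OF V[OF that]] by simp
    show "V (g i) = h i" if "i \<in> I" for i by (rule Veq[OF gram_graph.base[OF that]])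
  qed
qed

section \<open>Holomorphic functions of several variables\<close>

text \<open>The complex linear form with coefficients \<open>d\<close>, and below the partial derivatives that make up such a form.\<close>

definition clin :: "('n::finite \<Rightarrow> complex) \<Rightarrow> complex ^ 'n \<Rightarrow> complex" where
  "clin d v = (\<Sum>j\<in>UNIV. v $ j * d j)"

definition pd :: "'n::finite \<Rightarrow> (complex ^ 'n \<Rightarrow> complex) \<Rightarrow> complex ^ 'n \<Rightarrow> complex" where
  "pd j f w = frechet_derivative f (at w) (axis j 1)"

abbreviation cderiv :: "(complex ^ 'n::finite \<Rightarrow> complex) \<Rightarrow> complex ^ 'n \<Rightarrow> complex ^ 'n \<Rightarrow> complex" where
  "cderiv f w \<equiv> clin (\<lambda>j. pd j f w)"

text \<open>Complex differentiability together with that of the first partial derivatives.  Asking for both avoids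
Cauchy's formula in several variables.\<close>

definition holo2_on :: "(complex ^ 'n::finite) set \<Rightarrow> (complex ^ 'n \<Rightarrow> complex) \<Rightarrow> bool" where
  "holo2_on \<Omega> f \<longleftrightarrow> (\<forall>w\<in>\<Omega>. (f has_derivative cderiv f w) (at w)
    \<and> (\<forall>j. \<exists>e. (pd j f has_derivative clin e) (at w)))"

lemma clin_axis: "clin d (axis j c) = c * d j"
proof -
  have "clin d (axis j c) = (\<Sum>i\<in>UNIV. if i = j then c * d j else 0)"
    unfolding clin_def by (rule sum.cong) (auto simp: axis_def)
  then show ?thesis by simp
qed

lemma clin_scale: "clin d (c *s v) = c * clin d v"
  by (simp add: clin_def sum_distrib_left mult.assoc)

lemma holo2_onI:
  assumes "open \<Omega>" "\<And>w. w \<in> \<Omega> \<Longrightarrow> (f has_derivative clin (\<lambda>j. d j w)) (at w)"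
    "\<And>w j. w \<in> \<Omega> \<Longrightarrow> (d j has_derivative clin (e j w)) (at w)"
  shows "holo2_on \<Omega> f"
proof -
  have pd: "pd j f w = d j w" if "w \<in> \<Omega>" for w j
    unfolding pd_def frechet_derivative_at[OF assms(2)[OF that], symmetric] by (simp add: clin_axis)
  have "(pd j f has_derivative clin (e j w)) (at w)" if w: "w \<in> \<Omega>" for w j
    by (rule has_derivative_transform_within_open[OF assms(3)[OF w] assms(1) w]) (simp add: pd)
  then show ?thesis unfolding holo2_on_def using assms(2) pd by fastforce
qed

lemma holo2_on_subset: "holo2_on \<Omega> f \<Longrightarrow> D \<subseteq> \<Omega> \<Longrightarrow> holo2_on D f"
  unfolding holo2_on_def by blast

lemma holo2_on_locally:
  assumes "\<And>w. w \<in> \<Omega> \<Longrightarrow> \<exists>D. w \<in> D \<and> holo2_on D f"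
  shows "holo2_on \<Omega> f"
  using assms unfolding holo2_on_def by blast

lemma holo2_cinner_antiholomorphic:
  assumes U: "open U" and k1: "\<And>w. w \<in> U \<Longrightarrow> (k has_derivative antilin (\<lambda>j. k1 j w)) (at w)"
    and k2: "\<And>w j. w \<in> U \<Longrightarrow> (k1 j has_derivative antilin (\<lambda>i. k2 i j w)) (at w)"
  shows "holo2_on U (\<lambda>w. cinner x (k w))"
proof (rule holo2_onI[OF U])
  have lin: "cinner x (antilin d v) = clin (\<lambda>j. cinner x (d j)) v" for d v
    by (simp add: antilin_def clin_def cinner.sum_right cinner_scaleC_right)
  fix w assume w: "w \<in> U"
  show "((\<lambda>w. cinner x (k w)) has_derivative clin (\<lambda>j. cinner x (k1 j w))) (at w)"
    unfolding lin[symmetric] by (rule bounded_linear.has_derivative[OF cinner.bounded_linear_right k1[OF w]])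
  show "((\<lambda>w. cinner x (k1 j w)) has_derivative clin (\<lambda>i. cinner x (k2 i j w))) (at w)" for j
    unfolding lin[symmetric] by (rule bounded_linear.has_derivative[OF cinner.bounded_linear_right k2[OF w]])
qed

lemma holo2_on_cong:
  assumes f: "holo2_on U f" and U: "open U" and eq: "\<And>w. w \<in> U \<Longrightarrow> f w = g w"
  shows "holo2_on U g"
proof -
  have "\<forall>w\<in>U. \<forall>j. \<exists>e. (pd j f has_derivative clin e) (at w)" using f by (simp add: holo2_on_def)
  then obtain e where e: "\<And>w j. w \<in> U \<Longrightarrow> (pd j f has_derivative clin (e w j)) (at w)" by metis
  show ?thesis
  proof (rule holo2_onI[OF U])
    fix w assume w: "w \<in> U"
    have "(f has_derivative cderiv f w) (at w)" using f w by (simp add: holo2_on_def)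
    then show "(g has_derivative cderiv f w) (at w)"
      by (rule has_derivative_transform_within_open[OF _ U w]) (rule eq)
    show "(pd j f has_derivative clin (e w j)) (at w)" for j by (rule e[OF w])
  qed
qed

text \<open>Near \<open>w0\<close> the multiplier is the function \<open>\<lambda>w. cinner x (k w)\<close>, where \<open>k\<close> is the antiholomorphic eigenvector with
\<open>cinner (k w) (k w0) = 1\<close> and \<open>x\<close> the image of \<open>k w0\<close>.\<close>

lemma multiplier_holo2:
  assumes \<Omega>: "open \<Omega>" and M: "M \<in> B1_star \<Omega>" and \<phi>: "\<phi> \<in> multipliers M \<Omega>"
  shows "holo2_on \<Omega> \<phi>"
proof (rule holo2_on_locally)
  fix w0 assume w0: "w0 \<in> \<Omega>"
  obtain r k k1 k2 where r: "r > 0" "ball w0 r \<subseteq> \<Omega>"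
    and k: "\<And>w. w \<in> ball w0 r \<Longrightarrow> eigenspace_star M w = {c *\<^sub>C k w |c. True}"
    and kk: "\<And>w. w \<in> ball w0 r \<Longrightarrow> cinner (k w) (k w0) = 1"
    and k1: "\<And>w. w \<in> ball w0 r \<Longrightarrow> (k has_derivative antilin (\<lambda>j. k1 j w)) (at w)"
    and k2: "\<And>w j. w \<in> ball w0 r \<Longrightarrow> (k1 j has_derivative antilin (\<lambda>i. k2 i j w)) (at w)"
    by (rule antiholomorphic_eigenvector[OF \<Omega> M w0], rule that)
  define x where "x = mult_op M \<Omega> \<phi> (k w0)"
  have eq: "cinner x (k w) = \<phi> w" if w: "w \<in> ball w0 r" for w
  proof -
    have "k w \<in> eigenspace_star M w" by (rule generator_mem[OF k[OF w]])
    moreover have "cinner (k w0) (k w) = 1" using kk[OF w] cinner_commute by (metis complex_cnj_one)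
    ultimately show ?thesis using cinner_mult_op[OF \<phi>, of w "k w"] w r(2) unfolding x_def by auto
  qed
  have "holo2_on (ball w0 r) \<phi>"
    by (rule holo2_on_cong[OF holo2_cinner_antiholomorphic[OF open_ball k1 k2] open_ball eq])
  then show "\<exists>D. w0 \<in> D \<and> holo2_on D \<phi>" using r(1) by (intro exI[of _ "ball w0 r"]) simp
qed

section \<open>Complex lines and polarization\<close>

text \<open>Holomorphy along complex lines is all that the identity theorem and polarization need.\<close>

definition line_holo :: "(complex ^ 'n::finite) set \<Rightarrow> (complex ^ 'n \<Rightarrow> complex) \<Rightarrow> bool" where
  "line_holo D f \<longleftrightarrow> (\<forall>p q. (\<lambda>t. f (p + t *s q)) holomorphic_on {t. p + t *s q \<in> D})"

lemma scalar_mult_vector_conv: "(t::complex) *s q = Re t *\<^sub>R q + Im t *\<^sub>R (\<i> *s q)"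
proof -
  have "t * z = Re t *\<^sub>R z + Im t *\<^sub>R (\<i> * z)" for z
    by (simp add: complex_eq_iff)
  then show ?thesis by (simp add: vec_eq_iff)
qed

lemma line_has_derivative: "((\<lambda>t. p + t *s q) has_derivative (\<lambda>h. h *s (q :: complex ^ 'n::finite))) (at t)"
proof -
  have "((\<lambda>t. p + (Re t *\<^sub>R q + Im t *\<^sub>R (\<i> *s q))) has_derivative
      (\<lambda>h. Re h *\<^sub>R q + Im h *\<^sub>R (\<i> *s q))) (at t)"
    by (auto intro!: derivative_eq_intros)
  then show ?thesis by (simp only: scalar_mult_vector_conv[symmetric])
qed

lemma open_line: "open D \<Longrightarrow> open {t. p + t *s (q :: complex ^ 'n::finite) \<in> D}"
proof -
  assume "open D"
  have "continuous_on UNIV (\<lambda>t. p + t *s q)"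
    by (intro continuous_at_imp_continuous_on ballI has_derivative_continuous[OF line_has_derivative])
  then show ?thesis using open_vimage[OF \<open>open D\<close>] by (simp add: vimage_def)
qed

lemma convex_line:
  assumes "convex D"
  shows "convex {t. p + t *s (q :: complex ^ 'n::finite) \<in> D}"
proof (rule convexI)
  fix x y :: complex and u v :: real
  assume "x \<in> {t. p + t *s q \<in> D}" "y \<in> {t. p + t *s q \<in> D}" "0 \<le> u" "0 \<le> v" and uv: "u + v = 1"
  then have "u *\<^sub>R (p + x *s q) + v *\<^sub>R (p + y *s q) \<in> D" using assms by (auto intro: convexD)
  moreover have "u *\<^sub>R (p + x *s q) + v *\<^sub>R (p + y *s q) = (u + v) *\<^sub>R p + (u *\<^sub>R x + v *\<^sub>R y) *s q"
    by (simp add: vec_eq_iff algebra_simps)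
  ultimately show "u *\<^sub>R x + v *\<^sub>R y \<in> {t. p + t *s q \<in> D}" by (simp add: uv)
qed

lemma holo2_imp_line_holo:
  assumes "holo2_on \<Omega> f" "D \<subseteq> \<Omega>" "open D"
  shows "line_holo D f"
  unfolding line_holo_def
proof (intro allI)
  fix p q
  let ?T = "{t. p + t *s q \<in> D}"
  have "\<exists>d. ((\<lambda>t. f (p + t *s q)) has_field_derivative d) (at t)" if "t \<in> ?T" for t
  proof -
    let ?d = "\<lambda>j. pd j f (p + t *s q)"
    have "(f has_derivative clin ?d) (at (p + t *s q))"
      using assms that by (auto simp: holo2_on_def)
    from has_derivative_compose[OF line_has_derivative this]
    have "((\<lambda>t. f (p + t *s q)) has_derivative (\<lambda>h. clin ?d q * h)) (at t)"
      by (simp add: clin_scale mult.commute)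
    then show ?thesis unfolding has_field_derivative_def by blast
  qed
  then show "(\<lambda>t. f (p + t *s q)) holomorphic_on ?T"
    using holomorphic_on_open[OF open_line[OF assms(3)]] by blast
qed

lemma line_holo_mult: "line_holo D f \<Longrightarrow> line_holo D g \<Longrightarrow> line_holo D (\<lambda>w. f w * g w)"
  unfolding line_holo_def by (auto intro: holomorphic_intros)

lemma line_holo_const: "line_holo D (\<lambda>w. c)"
  unfolding line_holo_def by (auto intro: holomorphic_intros)

lemma line_holo_sum: "(\<And>m. m \<in> I \<Longrightarrow> line_holo D (f m)) \<Longrightarrow> line_holo D (\<lambda>w. \<Sum>m\<in>I. f m w)"
  unfolding line_holo_def by (auto intro: holomorphic_intros)

lemma line_holo_identity:
  assumes f: "line_holo D f" and D: "open D" "convex D" and W: "open W" "W \<noteq> {}" "W \<subseteq> D"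
    and zero: "\<And>w. w \<in> W \<Longrightarrow> f w = 0" and w: "w \<in> D"
  shows "f w = 0"
proof -
  obtain p where p: "p \<in> W" using W by blast
  let ?T = "\<lambda>D. {t. p + t *s (w - p) \<in> D}"
  have "f (p + 1 *s (w - p)) = 0"
  proof (rule analytic_continuation_open[of "?T W" "?T D" "\<lambda>t. f (p + t *s (w - p))" "\<lambda>t. 0"])
    have "0 \<in> ?T W" using p by simp
    then show "?T W \<noteq> {}" by blast
    show "connected (?T D)" by (rule convex_connected[OF convex_line[OF D(2)]])
    have "(\<lambda>t. f (p + t *s (w - p))) holomorphic_on ?T D" using f unfolding line_holo_def by blast
    then show "(\<lambda>t. f (p + t *s (w - p))) holomorphic_on ?T D" .
    show "open (?T W)" "open (?T D)" by (rule open_line[OF W(1)], rule open_line[OF D(1)])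
    show "1 \<in> ?T D" using w by simp
  qed (use W(3) zero in auto)
  then show ?thesis by simp
qed

text \<open>A function holomorphic in \<open>w\<close> and antiholomorphic in \<open>v\<close> is determined by its values for \<open>v = w\<close>.  The points \<open>w\<close> and
\<open>v\<close> are joined by the curve \<open>t \<mapsto> (p + t q, p + cnj t q)\<close>, on which such a function depends holomorphically on \<open>t\<close>.  Real
\<open>t\<close> give points of the diagonal, and \<open>t = \<i>\<close> gives \<open>(w, v)\<close>.\<close>

lemma polarization:
  fixes D :: "(complex ^ 'n::finite) set"
  assumes D: "open D" "convex D"
    and hol: "\<And>m. m \<in> I \<Longrightarrow> line_holo D (f m)" "\<And>m. m \<in> I \<Longrightarrow> line_holo D (g m)"
      "\<And>m. m \<in> I \<Longrightarrow> line_holo D (f' m)" "\<And>m. m \<in> I \<Longrightarrow> line_holo D (g' m)"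
    and diag: "\<And>w. w \<in> D \<Longrightarrow> (\<Sum>m\<in>I. f m w * cnj (g m w)) = (\<Sum>m\<in>I. f' m w * cnj (g' m w))"
    and w: "w \<in> D" and v: "v \<in> D"
  shows "(\<Sum>m\<in>I. f m w * cnj (g m v)) = (\<Sum>m\<in>I. f' m w * cnj (g' m v))"
proof -
  define p where "p = (1/2) *s (w + v)"
  define q where "q = (- \<i> / 2) *s (w - v)"
  define L where "L = {t. p + t *s q \<in> D}"
  define T where "T = L \<inter> cnj ` L"
  have cL: "t \<in> cnj ` L \<longleftrightarrow> cnj t \<in> L" for t by (metis complex_cnj_cnj image_iff)
  have L: "open L" "convex L" unfolding L_def by (rule open_line[OF D(1)], rule convex_line[OF D(2)])
  have "cnj ` L = cnj -` L" using cL by auto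
  then have ocL: "open (cnj ` L)" using open_vimage[OF L(1), of cnj] by (simp add: continuous_on_cnj)
  have ccL: "convex (cnj ` L)" by (intro convex_linear_image L bounded_linear.linear bounded_linear_cnj)
  have T: "open T" "convex T" using L ocL ccL by (auto simp: T_def convex_Int)
  have pq: "p + \<i> *s q = w" "p + (- \<i>) *s q = v"
    by (simp_all add: p_def q_def vec_eq_iff field_simps)
  have "\<i> \<in> L" "- \<i> \<in> L" unfolding L_def mem_Collect_eq pq by (rule w, rule v)
  then have i: "\<i> \<in> T" "- \<i> \<in> T" by (simp_all add: T_def cL)
  have "(1/2::real) *\<^sub>R \<i> + (1/2::real) *\<^sub>R (- \<i>) \<in> T" by (rule convexD[OF T(2) i]) auto
  then have T0: "0 \<in> T" by simp
  have holL: "(\<lambda>t. f (p + t *s q)) holomorphic_on L" if "line_holo D f" for f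
    using that by (simp add: line_holo_def L_def)
  have hol1: "(\<lambda>t. f (p + t *s q)) holomorphic_on T" if "line_holo D f" for f
    using holL[OF that] by (rule holomorphic_on_subset) (simp add: T_def)
  have hol2: "(\<lambda>t. cnj (f (p + cnj t *s q))) holomorphic_on T" if "line_holo D f" for f
  proof -
    have "cnj \<circ> (\<lambda>t. f (p + t *s q)) \<circ> cnj holomorphic_on (cnj ` L)"
      by (rule holomorphic_on_compose_cnj_cnj) (use holL[OF that] ocL in \<open>simp_all add: image_image\<close>)
    then have "(\<lambda>t. cnj (f (p + cnj t *s q))) holomorphic_on (cnj ` L)" by (simp add: o_def)
    then show ?thesis by (rule holomorphic_on_subset) (simp add: T_def)
  qed
  define h where "h t = (\<Sum>m\<in>I. f m (p + t *s q) * cnj (g m (p + cnj t *s q)))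
    - (\<Sum>m\<in>I. f' m (p + t *s q) * cnj (g' m (p + cnj t *s q)))" for t
  have "h holomorphic_on T" unfolding h_def by (intro holomorphic_intros hol1 hol2 hol)
  moreover have "0 islimpt (T \<inter> \<real>)"
    unfolding islimpt_approachable
  proof (intro allI impI)
    fix e :: real assume e: "e > 0"
    obtain r where r: "r > 0" "ball 0 r \<subseteq> T" using T(1) T0 open_contains_ball by blast
    define x where "x = complex_of_real (min r e / 2)"
    have "norm x = min r e / 2" using r e by (simp add: x_def)
    then have "x \<in> ball 0 r" "x \<noteq> 0" "dist x 0 < e" using r e by (auto simp: dist_norm)
    moreover have "x \<in> \<real>" by (simp add: x_def)
    ultimately show "\<exists>x'\<in>T \<inter> \<real>. x' \<noteq> 0 \<and> dist x' 0 < e" using r(2) by blast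
  qed
  moreover have "h t = 0" if "t \<in> T \<inter> \<real>" for t
  proof -
    have "cnj t = t" using that by (simp add: Reals_cnj_iff)
    then show ?thesis using diag[of "p + t *s q"] that by (simp add: h_def T_def L_def)
  qed
  ultimately have "h \<i> = 0"
    using analytic_continuation[OF _ T(1) convex_connected[OF T(2)], of h "T \<inter> \<real>" 0 \<i>] T0 i by blast
  then show ?thesis using pq by (simp add: h_def)
qed

section \<open>Wirtinger derivatives\<close>

text \<open>The function \<open>q k\<close> is the derivative of the real function \<open>u\<close> along the conjugate of the \<open>k\<close>-th coordinate.\<close>

definition wirtinger_smooth ::
  "(complex ^ 'n::finite) set \<Rightarrow> (complex ^ 'n \<Rightarrow> real) \<Rightarrow> ('n \<Rightarrow> complex ^ 'n \<Rightarrow> complex) \<Rightarrow> bool" where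
  "wirtinger_smooth \<Omega> u q \<longleftrightarrow> (\<forall>w\<in>\<Omega>.
     (u has_derivative (\<lambda>v. 2 * Re (\<Sum>k\<in>UNIV. cnj (v $ k) * q k w))) (at w)
     \<and> (\<forall>k. q k differentiable (at w)))"

abbreviation mixed_deriv :: "'n::finite \<Rightarrow> 'n \<Rightarrow> (complex ^ 'n \<Rightarrow> real) \<Rightarrow> complex ^ 'n \<Rightarrow> complex" where
  "mixed_deriv j k u w \<equiv> d_dw j (d_dwbar k (\<lambda>w. complex_of_real (u w))) w"

text \<open>The holomorphic Wirtinger derivative read off from a real derivative \<open>D\<close>.\<close>

definition dz :: "'n::finite \<Rightarrow> (complex ^ 'n \<Rightarrow> complex) \<Rightarrow> complex" where
  "dz j D = (D (axis j 1) - \<i> * D (axis j \<i>)) / 2"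

lemma dz_eq_0I: "D (axis j \<i>) = - \<i> * D (axis j 1) \<Longrightarrow> dz j D = 0"
  by (simp add: dz_def)

lemma dir_deriv_eq:
  assumes "(f has_derivative D) (at w)"
  shows "dir_deriv f v w = D v"
proof -
  have l: "((\<lambda>t::real. w + t *\<^sub>R v) has_derivative (\<lambda>t. t *\<^sub>R v)) (at 0)"
    by (auto intro!: derivative_eq_intros)
  have "(f has_derivative D) (at (w + 0 *\<^sub>R v))" using assms by simp
  from has_derivative_compose[OF l this]
  have "((\<lambda>t. f (w + t *\<^sub>R v)) has_derivative (\<lambda>t. D (t *\<^sub>R v))) (at 0)" .
  moreover have "D (t *\<^sub>R v) = t *\<^sub>R D v" for t
    using linear_simps(5)[OF has_derivative_bounded_linear[OF assms]] .
  ultimately have "((\<lambda>t. f (w + t *\<^sub>R v)) has_vector_derivative D v) (at 0)"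
    by (simp add: has_vector_derivative_def)
  then show ?thesis unfolding dir_deriv_def by (rule vector_derivative_at)
qed

lemma sum_cnj_axis: "(\<Sum>k\<in>UNIV. cnj (axis j c $ k) * q k) = cnj c * q j"
proof -
  have "(\<Sum>k\<in>UNIV. cnj (axis j c $ k) * q k) = (\<Sum>k\<in>UNIV. if k = j then cnj c * q j else 0)"
    by (rule sum.cong) (auto simp: axis_def)
  then show ?thesis by simp
qed

lemma d_dwbar_wirtinger:
  assumes "wirtinger_smooth \<Omega> u q" "w \<in> \<Omega>"
  shows "d_dwbar k (\<lambda>w. complex_of_real (u w)) w = q k w"
proof -
  let ?D = "\<lambda>v. complex_of_real (2 * Re (\<Sum>k\<in>UNIV. cnj (v $ k) * q k w))"
  have "((\<lambda>w. complex_of_real (u w)) has_derivative ?D) (at w)"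
    by (rule bounded_linear.has_derivative[OF bounded_linear_of_real])
      (use assms in \<open>simp add: wirtinger_smooth_def\<close>)
  then have dd: "dir_deriv (\<lambda>w. complex_of_real (u w)) v w = ?D v" for v by (rule dir_deriv_eq)
  show ?thesis unfolding d_dwbar_def dd sum_cnj_axis by (simp add: complex_eq_iff)
qed

lemma d_dw_d_dwbar_wirtinger:
  assumes "open \<Omega>" "wirtinger_smooth \<Omega> u q" "w \<in> \<Omega>" "(q k has_derivative D) (at w)"
  shows "mixed_deriv j k u w = dz j D"
proof -
  have "(d_dwbar k (\<lambda>w. complex_of_real (u w)) has_derivative D) (at w)"
    by (rule has_derivative_transform_within_open[OF assms(4,1,3)]) (simp add: d_dwbar_wirtinger[OF assms(2)])
  then have "dir_deriv (d_dwbar k (\<lambda>w. complex_of_real (u w))) v w = D v" for v by (rule dir_deriv_eq)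
  then show ?thesis by (simp add: d_dw_def dz_def)
qed

lemma wirtinger_smooth_diff:
  assumes "wirtinger_smooth \<Omega> u q" "wirtinger_smooth \<Omega> u' q'"
  shows "wirtinger_smooth \<Omega> (\<lambda>w. u w - u' w) (\<lambda>k w. q k w - q' k w)"
  unfolding wirtinger_smooth_def
proof (intro ballI conjI allI)
  fix w k assume w: "w \<in> \<Omega>"
  have "((\<lambda>w. u w - u' w) has_derivative (\<lambda>v. 2 * Re (\<Sum>k\<in>UNIV. cnj (v $ k) * q k w) - 2 * Re (\<Sum>k\<in>UNIV. cnj (v $ k) * q' k w))) (at w)"
    by (rule has_derivative_diff) (use assms w in \<open>auto simp: wirtinger_smooth_def\<close>)
  then show "((\<lambda>w. u w - u' w) has_derivative (\<lambda>v. 2 * Re (\<Sum>k\<in>UNIV. cnj (v $ k) * (q k w - q' k w)))) (at w)"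
    by (simp add: right_diff_distrib sum_subtractf)
  show "(\<lambda>w. q k w - q' k w) differentiable (at w)"
    using assms w by (auto simp: wirtinger_smooth_def)
qed

lemma wirtinger_smooth_cong_const:
  assumes "wirtinger_smooth \<Omega> u q" "open \<Omega>" "\<And>w. w \<in> \<Omega> \<Longrightarrow> u' w = u w + c"
  shows "wirtinger_smooth \<Omega> u' q"
  unfolding wirtinger_smooth_def
proof (intro ballI conjI)
  fix w assume w: "w \<in> \<Omega>"
  let ?D = "\<lambda>v. 2 * Re (\<Sum>k\<in>UNIV. cnj (v $ k) * q k w)"
  have "((\<lambda>w. u w + c) has_derivative (\<lambda>v. ?D v + 0)) (at w)"
    by (intro has_derivative_add has_derivative_const) (use assms w in \<open>simp add: wirtinger_smooth_def\<close>)
  then have "((\<lambda>w. u w + c) has_derivative ?D) (at w)" by simp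
  then show "(u' has_derivative ?D) (at w)"
    by (rule has_derivative_transform_within_open[OF _ assms(2) w]) (simp add: assms(3))
qed (use assms in \<open>simp add: wirtinger_smooth_def\<close>)

definition log_norm_fam :: "'m set \<Rightarrow> ('m \<Rightarrow> complex ^ 'n \<Rightarrow> complex) \<Rightarrow> complex ^ 'n \<Rightarrow> real" where
  "log_norm_fam I F w = ln (\<Sum>m\<in>I. (cmod (F m w))\<^sup>2) / 2"

lemma wirtinger_smooth_log_norm_fam:
  assumes F: "\<And>m. m \<in> I \<Longrightarrow> holo2_on \<Omega> (F m)" and pos: "\<And>w. w \<in> \<Omega> \<Longrightarrow> (\<Sum>m\<in>I. (cmod (F m w))\<^sup>2) > 0"
  shows "wirtinger_smooth \<Omega> (log_norm_fam I F)
    (\<lambda>k w. (\<Sum>m\<in>I. F m w * cnj (pd k (F m) w)) / (2 * (\<Sum>m\<in>I. F m w * cnj (F m w))))"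
  unfolding wirtinger_smooth_def
proof (intro ballI conjI allI)
  fix w assume w: "w \<in> \<Omega>"
  define K where "K w = (\<Sum>m\<in>I. inner (F m w) (F m w))" for w
  have K: "K w = (\<Sum>m\<in>I. (cmod (F m w))\<^sup>2)" for w by (simp only: K_def power2_norm_eq_inner)
  have KC: "(\<Sum>m\<in>I. F m w * cnj (F m w)) = complex_of_real (K w)" for w
    by (simp only: K of_real_sum complex_norm_square)
  have K0: "K w > 0" using pos[OF w] by (simp add: K)
  have Fd: "(F m has_derivative cderiv (F m) w) (at w)" if "m \<in> I" for m
    using F[OF that] w by (simp add: holo2_on_def)
  have pdd: "pd j (F m) differentiable (at w)" if "m \<in> I" for m j
    using F[OF that] w unfolding holo2_on_def differentiable_def by blast
  have Fdiff: "F m differentiable (at w)" if "m \<in> I" for m using Fd[OF that] by (rule differentiableI)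
  let ?q = "\<lambda>k w. (\<Sum>m\<in>I. F m w * cnj (pd k (F m) w)) / (2 * (\<Sum>m\<in>I. F m w * cnj (F m w)))"
  let ?S = "\<lambda>v. \<Sum>m\<in>I. inner (F m w) (cderiv (F m) w v) + inner (cderiv (F m) w v) (F m w)"
  have Kd: "(K has_derivative ?S) (at w)"
    unfolding K_def by (intro has_derivative_sum has_derivative_inner Fd)
  have "(\<lambda>w. ln (K w) / 2) = log_norm_fam I F" by (simp add: fun_eq_iff log_norm_fam_def K)
  moreover have "((\<lambda>w. ln (K w) / 2) has_derivative (\<lambda>v. ?S v / K w / 2)) (at w)"
  proof -
    have "((\<lambda>w. ln (K w) * (1/2)) has_derivative (\<lambda>v. ?S v * inverse (K w) * (1/2))) (at w)"
      by (rule has_derivative_mult_left[OF DERIV_compose_FDERIV[OF DERIV_ln[OF K0] Kd]])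
    then show ?thesis by (simp only: divide_inverse mult_1_left)
  qed
  moreover have "?S v / K w / 2
      = 2 * Re (\<Sum>k\<in>UNIV. cnj (v $ k) * ?q k w)" for v
  proof -
    let ?P = "\<Sum>m\<in>I. inner (F m w) (cderiv (F m) w v)" and ?Q = "\<Sum>k\<in>UNIV. cnj (v $ k) * ?q k w"
    have "(\<Sum>k\<in>UNIV. cnj (v $ k) * (\<Sum>m\<in>I. F m w * cnj (pd k (F m) w))) = (\<Sum>m\<in>I. F m w * cnj (cderiv (F m) w v))"
      unfolding clin_def sum_distrib_left cnj_sum by (subst sum.swap) (simp add: mult_ac)
    then have "?Q = (\<Sum>m\<in>I. F m w * cnj (cderiv (F m) w v)) / complex_of_real (2 * K w)"
      by (simp add: KC sum_divide_distrib[symmetric])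
    then have "Re ?Q = (\<Sum>m\<in>I. Re (F m w * cnj (cderiv (F m) w v))) / (2 * K w)"
      by (simp only: Re_divide_of_real Re_sum)
    also have "(\<Sum>m\<in>I. Re (F m w * cnj (cderiv (F m) w v))) = ?P"
      by (simp add: inner_complex_def)
    finally have B: "Re ?Q = ?P / (2 * K w)" .
    have A: "?S v
        = 2 * ?P"
      by (simp add: inner_commute sum_distrib_left)
    show ?thesis unfolding A B by simp
  qed
  ultimately show "(log_norm_fam I F has_derivative (\<lambda>v. 2 * Re (\<Sum>k\<in>UNIV. cnj (v $ k) * ?q k w))) (at w)"
    by simp
  have cnjd: "(\<lambda>w. cnj (f w)) differentiable (at w)" if "f differentiable (at w)" for f :: "complex ^ 'b \<Rightarrow> complex"
    using that bounded_linear.has_derivative[OF bounded_linear_cnj] unfolding differentiable_def by blast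
  have "(\<Sum>m\<in>I. F m w * cnj (F m w)) \<noteq> 0" using K0 by (simp add: KC)
  moreover have sumd: "(\<lambda>w. \<Sum>m\<in>I. F m w * cnj (G m w)) differentiable (at w)"
    if "\<And>m. m \<in> I \<Longrightarrow> G m differentiable (at w)" for G
  proof (cases "finite I")
    case True
    then show ?thesis by (intro differentiable_sum ballI differentiable_mult cnjd that Fdiff)
  qed simp
  ultimately show "?q k differentiable (at w)" for k
    by (intro differentiable_divide differentiable_mult differentiable_const sumd pdd Fdiff) auto
qed

text \<open>The derivative along the conjugate coordinates is the conjugate of half the logarithmic derivative of \<open>f\<close>, hence
antiholomorphic.\<close>

lemma wirtinger_log_abs_pluriharmonic:
  assumes f: "holo2_on \<Omega> f" and \<Omega>: "open \<Omega>" and nz: "\<And>w. w \<in> \<Omega> \<Longrightarrow> f w \<noteq> 0"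
  obtains q where "wirtinger_smooth \<Omega> (\<lambda>w. ln (cmod (f w))) q"
    "\<And>k w j. w \<in> \<Omega> \<Longrightarrow> \<exists>D. (q k has_derivative D) (at w) \<and> dz j D = 0"
proof
  let ?q0 = "\<lambda>k w. (\<Sum>m\<in>{()}. f w * cnj (pd k f w)) / (2 * (\<Sum>m\<in>{()}. f w * cnj (f w)))"
  have ln: "ln (cmod (f w)) = log_norm_fam {()} (\<lambda>_. f) w" if "w \<in> \<Omega>" for w
    using nz[OF that] by (simp add: log_norm_fam_def ln_realpow)
  have "wirtinger_smooth \<Omega> (log_norm_fam {()} (\<lambda>_. f)) ?q0"
    by (rule wirtinger_smooth_log_norm_fam) (use f nz in auto)
  from wirtinger_smooth_cong_const[OF this \<Omega>, of "\<lambda>w. ln (cmod (f w))" 0]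
  show "wirtinger_smooth \<Omega> (\<lambda>w. ln (cmod (f w))) ?q0" using ln by simp
  fix k w j assume w: "w \<in> \<Omega>"
  let ?g = "\<lambda>w. pd k f w / (2 * f w)"
  have eq: "?q0 k w = cnj (?g w)" if "w \<in> \<Omega>" for w using nz[OF that] by simp
  obtain e where e: "(pd k f has_derivative clin e) (at w)" using f w by (auto simp: holo2_on_def)
  have fd: "(f has_derivative cderiv f w) (at w)" using f w by (simp add: holo2_on_def)
  let ?D = "\<lambda>v. - pd k f w * (inverse (2 * f w) * (2 * cderiv f w v) * inverse (2 * f w)) + clin e v / (2 * f w)"
  have "(?g has_derivative ?D) (at w)"
    by (rule has_derivative_divide[OF e has_derivative_mult_right[OF fd]]) (use nz[OF w] in simp)
  then have "((\<lambda>w. cnj (?g w)) has_derivative (\<lambda>v. cnj (?D v))) (at w)"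
    by (rule bounded_linear.has_derivative[OF bounded_linear_cnj])
  then have "(?q0 k has_derivative (\<lambda>v. cnj (?D v))) (at w)"
    by (rule has_derivative_transform_within_open[OF _ \<Omega> w]) (simp only: eq)
  moreover have Di: "?D (axis j \<i>) = \<i> * ?D (axis j 1)"
    by (simp add: clin_axis algebra_simps)
  have "cnj (?D (axis j \<i>)) = - \<i> * cnj (?D (axis j 1))"
    unfolding Di by (simp only: complex_cnj_mult complex_cnj_i)
  then have "dz j (\<lambda>v. cnj (?D v)) = 0" by (rule dz_eq_0I)
  ultimately show "\<exists>D. (?q0 k has_derivative D) (at w) \<and> dz j D = 0" by blast
qed

lemma real_linear_expansion:
  assumes "bounded_linear (D :: complex ^ 'n::finite \<Rightarrow> complex)"
  shows "D v = (\<Sum>j\<in>UNIV. Re (v $ j) *\<^sub>R D (axis j 1) + Im (v $ j) *\<^sub>R D (axis j \<i>))"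
proof -
  interpret D: bounded_linear D by fact
  have "v = (\<Sum>j\<in>UNIV. Re (v $ j) *\<^sub>R axis j 1 + Im (v $ j) *\<^sub>R axis j \<i>)"
  proof -
    have "(\<Sum>j\<in>UNIV. (Re (v $ j) *\<^sub>R axis j 1 + Im (v $ j) *\<^sub>R axis j \<i>) $ i) = v $ i" for i
    proof -
      have "(\<Sum>j\<in>UNIV. (Re (v $ j) *\<^sub>R axis j 1 + Im (v $ j) *\<^sub>R axis j \<i>) $ i)
          = (\<Sum>j\<in>UNIV. if j = i then Re (v $ i) *\<^sub>R 1 + Im (v $ i) *\<^sub>R \<i> else 0)"
        by (rule sum.cong) (auto simp: axis_def)
      then show ?thesis by (simp add: complex_eq_iff)
    qed
    then show ?thesis by (simp add: vec_eq_iff)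
  qed
  then have "D v = D (\<Sum>j\<in>UNIV. Re (v $ j) *\<^sub>R axis j 1 + Im (v $ j) *\<^sub>R axis j \<i>)" by simp
  then show ?thesis by (simp add: D.sum D.add D.scaleR)
qed

text \<open>On the line, \<open>G\<close> is the derivative of \<open>u\<close> along the conjugate variable.  Vanishing of the mixed derivatives makes its conjugate
holomorphic, and \<open>u\<close> is up to a constant the real part of a primitive of \<open>2 * cnj G\<close>.\<close>

lemma pluriharmonic_on_line:
  fixes a w0 :: "complex ^ 'n::finite"
  assumes B: "open B" "convex B" and u: "wirtinger_smooth B u q"
    and harm: "\<And>w j k. w \<in> B \<Longrightarrow> mixed_deriv j k u w = 0"
  defines "Z \<equiv> {\<zeta>. w0 + \<zeta> *s a \<in> B}"
  obtains E where "E holomorphic_on Z" "\<And>\<zeta>. \<zeta> \<in> Z \<Longrightarrow> exp (u (w0 + \<zeta> *s a)) = cmod (E \<zeta>)"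
proof -
  have Z: "open Z" "convex Z" unfolding Z_def by (rule open_line[OF B(1)], rule convex_line[OF B(2)])
  define G where "G \<zeta> = (\<Sum>k\<in>UNIV. cnj (a $ k) * q k (w0 + \<zeta> *s a))" for \<zeta>
  have qd: "\<exists>D. (q k has_derivative D) (at w) \<and> (\<forall>v. D v = (\<Sum>j\<in>UNIV. cnj (v $ j) * D (axis j 1)))"
    if w: "w \<in> B" for w k
  proof -
    obtain D where D: "(q k has_derivative D) (at w)"
      using u w unfolding wirtinger_smooth_def differentiable_def by blast
    have "dz j D = 0" for j using d_dw_d_dwbar_wirtinger[OF B(1) u w D] harm[OF w] by metis
    then have Di: "D (axis j \<i>) = - \<i> * D (axis j 1)" for j
    proof -
      have "\<i> * D (axis j \<i>) = D (axis j 1)" using \<open>\<And>j. dz j D = 0\<close>[of j] by (simp add: dz_def)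
      then have "- D (axis j \<i>) = \<i> * D (axis j 1)" by (metis complex_i_mult_minus)
      then have "- (- D (axis j \<i>)) = - (\<i> * D (axis j 1))" by (rule arg_cong)
      then show ?thesis by simp
    qed
    have "D v = (\<Sum>j\<in>UNIV. cnj (v $ j) * D (axis j 1))" for v
      unfolding real_linear_expansion[OF has_derivative_bounded_linear[OF D], of v]
    proof (rule sum.cong[OF refl])
      fix j
      show "Re (v $ j) *\<^sub>R D (axis j 1) + Im (v $ j) *\<^sub>R D (axis j \<i>) = cnj (v $ j) * D (axis j 1)"
        unfolding Di by (simp add: complex_eq_iff)
    qed
    then show ?thesis using D by blast
  qed
  have "\<exists>c. ((\<lambda>\<zeta>. cnj (G \<zeta>)) has_field_derivative c) (at \<zeta>)" if \<zeta>: "\<zeta> \<in> Z" for \<zeta>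
  proof -
    have "w0 + \<zeta> *s a \<in> B" using \<zeta> by (simp add: Z_def)
    then have "\<forall>k. \<exists>D. (q k has_derivative D) (at (w0 + \<zeta> *s a)) \<and> (\<forall>v. D v = (\<Sum>j\<in>UNIV. cnj (v $ j) * D (axis j 1)))"
      using qd by blast
    from choice[OF this] obtain D where D: "\<And>k. (q k has_derivative D k) (at (w0 + \<zeta> *s a))"
      and De: "\<And>k v. D k v = (\<Sum>j\<in>UNIV. cnj (v $ j) * D k (axis j 1))" by blast
    have "(G has_derivative (\<lambda>h. \<Sum>k\<in>UNIV. cnj (a $ k) * D k (h *s a))) (at \<zeta>)"
      unfolding G_def
      by (intro has_derivative_sum has_derivative_mult_right has_derivative_compose[OF line_has_derivative D])
    then have "((\<lambda>\<zeta>. cnj (G \<zeta>)) has_derivative (\<lambda>h. cnj (\<Sum>k\<in>UNIV. cnj (a $ k) * D k (h *s a)))) (at \<zeta>)"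
      by (rule bounded_linear.has_derivative[OF bounded_linear_cnj])
    moreover have "D k (h *s a) = cnj h * D k a" for k h
      unfolding De[of k "h *s a"] De[of k a] by (simp add: sum_distrib_left mult.assoc)
    then have "(\<lambda>h. cnj (\<Sum>k\<in>UNIV. cnj (a $ k) * D k (h *s a))) = (\<lambda>h. (\<Sum>k\<in>UNIV. a $ k * cnj (D k a)) * h)"
      by (simp add: fun_eq_iff sum_distrib_left sum_distrib_right mult_ac)
    ultimately show ?thesis unfolding has_field_derivative_def by (intro exI) simp
  qed
  then have "(\<lambda>\<zeta>. 2 * cnj (G \<zeta>)) holomorphic_on Z"
    using holomorphic_on_open[OF Z(1)] by (intro holomorphic_intros) blast
  then obtain f where f: "\<And>\<zeta>. \<zeta> \<in> Z \<Longrightarrow> (f has_field_derivative 2 * cnj (G \<zeta>)) (at \<zeta> within Z)"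
    using holomorphic_convex_primitive'[OF Z(2,1)] by blast
  have "\<exists>c. \<forall>\<zeta>\<in>Z. u (w0 + \<zeta> *s a) - Re (f \<zeta>) = c"
  proof (rule has_derivative_zero_constant[OF Z(2)])
    fix \<zeta> assume \<zeta>: "\<zeta> \<in> Z"
    then have wB: "w0 + \<zeta> *s a \<in> B" by (simp add: Z_def)
    have ud: "(u has_derivative (\<lambda>v. 2 * Re (\<Sum>k\<in>UNIV. cnj (v $ k) * q k (w0 + \<zeta> *s a)))) (at (w0 + \<zeta> *s a))"
      using u wB by (simp add: wirtinger_smooth_def)
    have "((\<lambda>\<zeta>. u (w0 + \<zeta> *s a)) has_derivative (\<lambda>h. 2 * Re (cnj h * G \<zeta>))) (at \<zeta>)"
      using has_derivative_compose[OF line_has_derivative ud]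
      by (simp add: G_def sum_distrib_left mult.assoc)
    then have "((\<lambda>\<zeta>. u (w0 + \<zeta> *s a)) has_derivative (\<lambda>h. 2 * Re (cnj h * G \<zeta>))) (at \<zeta> within Z)"
      by (rule has_derivative_at_withinI)
    moreover have "((\<lambda>\<zeta>. Re (f \<zeta>)) has_derivative (\<lambda>h. Re (2 * cnj (G \<zeta>) * h))) (at \<zeta> within Z)"
      by (rule bounded_linear.has_derivative[OF bounded_linear_Re])
        (use f[OF \<zeta>] in \<open>simp add: has_field_derivative_def\<close>)
    ultimately have "((\<lambda>\<zeta>. u (w0 + \<zeta> *s a) - Re (f \<zeta>)) has_derivative (\<lambda>h. 2 * Re (cnj h * G \<zeta>) - Re (2 * cnj (G \<zeta>) * h))) (at \<zeta> within Z)"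
      by (rule has_derivative_diff)
    moreover have "(\<lambda>h. 2 * Re (cnj h * G \<zeta>) - Re (2 * cnj (G \<zeta>) * h)) = (\<lambda>h. 0)"
      by (simp add: fun_eq_iff algebra_simps)
    ultimately show "((\<lambda>\<zeta>. u (w0 + \<zeta> *s a) - Re (f \<zeta>)) has_derivative (\<lambda>h. 0)) (at \<zeta> within Z)" by simp
  qed
  then obtain c where c: "\<And>\<zeta>. \<zeta> \<in> Z \<Longrightarrow> u (w0 + \<zeta> *s a) = Re (f \<zeta>) + c" by (metis diff_eq_eq add.commute)
  show thesis
  proof
    have "f holomorphic_on Z" unfolding holomorphic_on_def field_differentiable_def using f by blast
    then show "(\<lambda>\<zeta>. exp (f \<zeta> + complex_of_real c)) holomorphic_on Z" by (intro holomorphic_intros)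
    show "exp (u (w0 + \<zeta> *s a)) = cmod (exp (f \<zeta> + complex_of_real c))" if "\<zeta> \<in> Z" for \<zeta>
      by (simp add: c[OF that])
  qed
qed

section \<open>Normalised kernels and curvature\<close>

text \<open>For \<open>F\<close> the coordinates of the formal determinant, this is up to conjugation the Gram matrix of the
eigenvectors of the quotient module, divided by that of the eigenvectors of the module itself.\<close>

definition kern :: "('m::finite \<Rightarrow> complex ^ 'n \<Rightarrow> complex) \<Rightarrow> complex ^ 'n \<Rightarrow> complex ^ 'n \<Rightarrow> complex" where
  "kern F w v = (\<Sum>m\<in>UNIV. F m w * cnj (F m v))"

lemma cnj_kern: "cnj (kern F w v) = kern F v w"
  by (simp add: kern_def mult.commute)

lemma kern_diag: "kern F w w = complex_of_real (\<Sum>m\<in>UNIV. (cmod (F m w))\<^sup>2)"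
  by (simp only: kern_def of_real_sum complex_norm_square)

lemma sum_cmod_pos: "F m w \<noteq> 0 \<Longrightarrow> (\<Sum>m\<in>(UNIV :: 'm::finite set). (cmod (F m w))\<^sup>2) > 0"
  by (rule sum_pos2[of _ m]) auto

text \<open>Equality of the quotients \<open>K(w,v) K(w0,w0) / (K(w,w0) K(w0,v))\<close> for the two kernels, without denominators.
Replacing \<open>F1\<close> by a multiple \<open>\<lambda>m w. f w * F1 m w\<close> does not affect it when \<open>f\<close> has no zeros.\<close>

definition kernels_agree ::
  "('m::finite \<Rightarrow> complex ^ 'n \<Rightarrow> complex) \<Rightarrow> ('m \<Rightarrow> complex ^ 'n \<Rightarrow> complex)
   \<Rightarrow> complex ^ 'n \<Rightarrow> complex ^ 'n \<Rightarrow> complex ^ 'n \<Rightarrow> bool" where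
  "kernels_agree F1 F2 w0 w v \<longleftrightarrow>
     kern F1 w v * kern F2 w w0 * kern F2 w0 v * kern F1 w0 w0
     = kern F2 w v * kern F1 w w0 * kern F1 w0 v * kern F2 w0 w0"

lemma line_holo_coordinate:
  assumes "h holomorphic_on Z"
  shows "line_holo {x :: complex ^ 1. x $ 1 \<in> Z} (\<lambda>x. h (x $ 1))"
  unfolding line_holo_def
proof (intro allI)
  fix p q :: "complex ^ 1"
  have "(h \<circ> (\<lambda>t. p $ 1 + t * q $ 1)) holomorphic_on {t. p $ 1 + t * q $ 1 \<in> Z}"
    by (rule holomorphic_on_compose_gen[OF _ assms]) (auto intro!: holomorphic_intros)
  then show "(\<lambda>t. h ((p + t *s q) $ 1)) holomorphic_on {t. p + t *s q \<in> {x. x $ 1 \<in> Z}}"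
    by (simp add: o_def)
qed

text \<open>This is \<open>polarization\<close> in the space \<open>complex ^ 1\<close>.\<close>

lemma polarization_one_variable:
  fixes f g :: "'m::finite \<Rightarrow> complex \<Rightarrow> complex"
  assumes Z: "open Z" "convex Z"
    and f: "\<And>m. f m holomorphic_on Z" and g: "\<And>m. g m holomorphic_on Z"
    and diag: "\<And>z. z \<in> Z \<Longrightarrow> (\<Sum>m\<in>UNIV. f m z * cnj (f m z)) = (\<Sum>m\<in>UNIV. g m z * cnj (g m z))"
    and s: "s \<in> Z" and t: "t \<in> Z"
  shows "(\<Sum>m\<in>UNIV. f m s * cnj (f m t)) = (\<Sum>m\<in>UNIV. g m s * cnj (g m t))"
proof -
  let ?D = "{x :: complex ^ 1. x $ 1 \<in> Z}"
  have D: "open ?D" using open_vimage[OF Z(1), of "\<lambda>x :: complex ^ 1. x $ 1"]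
    by (simp add: vimage_def continuous_on_component)
  have "?D = (\<lambda>x. x $ 1) -` Z" by auto
  moreover have "linear (\<lambda>x :: complex ^ 1. x $ 1)" using bounded_linear_vec_nth bounded_linear.linear by blast
  ultimately have c: "convex ?D" using convex_linear_vimage[of "\<lambda>x :: complex ^ 1. x $ 1" Z] Z(2) by simp
  have "(\<Sum>m\<in>UNIV. f m ((vec s :: complex ^ 1) $ 1) * cnj (f m ((vec t :: complex ^ 1) $ 1)))
    = (\<Sum>m\<in>UNIV. g m ((vec s :: complex ^ 1) $ 1) * cnj (g m ((vec t :: complex ^ 1) $ 1)))"
    by (rule polarization[OF D c, where f = "\<lambda>m x. f m (x $ 1)" and g = "\<lambda>m x. f m (x $ 1)"
          and f' = "\<lambda>m x. g m (x $ 1)" and g' = "\<lambda>m x. g m (x $ 1)" and w = "vec s" and v = "vec t"])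
      (auto intro!: line_holo_coordinate f g diag simp: s t)
  then show ?thesis by simp
qed

text \<open>On a complex line through \<open>w0\<close> the hypothesis yields \<open>K1(\<zeta>,\<zeta>) = \<bar>E(\<zeta>)\<bar>\<^sup>2 K2(\<zeta>,\<zeta>)\<close> with \<open>E\<close> holomorphic, and
polarization on the line gives \<open>K1(s,t) = E(s) cnj (E(t)) K2(s,t)\<close>.  Normalisation at \<open>w0\<close> cancels \<open>E\<close>, which gives
the assertion for \<open>v = w\<close>, independently of lines; polarization in \<open>B\<close> gives it for all \<open>v\<close>.\<close>

lemma normalised_kernels_agree_of_curvature:
  fixes F1 F2 :: "'m::finite \<Rightarrow> complex ^ 'n::finite \<Rightarrow> complex"
  assumes B: "open B" "convex B" and w0: "w0 \<in> B"
    and F: "\<And>m. holo2_on B (F1 m)" "\<And>m. holo2_on B (F2 m)"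
    and nz: "\<And>w. w \<in> B \<Longrightarrow> \<exists>m. F1 m w \<noteq> 0" "\<And>w. w \<in> B \<Longrightarrow> \<exists>m. F2 m w \<noteq> 0"
    and curv: "\<And>w j k. w \<in> B \<Longrightarrow>
      mixed_deriv j k (log_norm_fam UNIV F1) w
      = mixed_deriv j k (log_norm_fam UNIV F2) w"
    and w: "w \<in> B" and v: "v \<in> B"
  shows "kernels_agree F1 F2 w0 w v"
proof -
  define L1 where "L1 = log_norm_fam UNIV F1"
  define L2 where "L2 = log_norm_fam UNIV F2"
  have pos: "(\<Sum>m\<in>UNIV. (cmod (F1 m w))\<^sup>2) > 0" "(\<Sum>m\<in>UNIV. (cmod (F2 m w))\<^sup>2) > 0" if "w \<in> B" for w
    using nz(1)[OF that] nz(2)[OF that] sum_cmod_pos[of F1 _ w] sum_cmod_pos[of F2 _ w] by auto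
  obtain q1 where q1: "wirtinger_smooth B L1 q1"
    using wirtinger_smooth_log_norm_fam[of UNIV B F1] F(1) pos(1) unfolding L1_def by blast
  obtain q2 where q2: "wirtinger_smooth B L2 q2"
    using wirtinger_smooth_log_norm_fam[of UNIV B F2] F(2) pos(2) unfolding L2_def by blast
  note u = wirtinger_smooth_diff[OF q1 q2]
  have harm: "mixed_deriv j k (\<lambda>w. L1 w - L2 w) w = 0" if w: "w \<in> B" for w j k
  proof -
    obtain D1 where D1: "(q1 k has_derivative D1) (at w)"
      using q1 w unfolding wirtinger_smooth_def differentiable_def by blast
    obtain D2 where D2: "(q2 k has_derivative D2) (at w)"
      using q2 w unfolding wirtinger_smooth_def differentiable_def by blast
    have "dz j D1 = dz j D2"
      using curv[OF w, of j k] unfolding L1_def[symmetric] L2_def[symmetric]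
        d_dw_d_dwbar_wirtinger[OF B(1) q1 w D1] d_dw_d_dwbar_wirtinger[OF B(1) q2 w D2] .
    moreover have "mixed_deriv j k (\<lambda>w. L1 w - L2 w) w = dz j (\<lambda>v. D1 v - D2 v)"
      by (rule d_dw_d_dwbar_wirtinger[OF B(1) u w]) (rule has_derivative_diff[OF D1 D2])
    moreover have "dz j (\<lambda>v. D1 v - D2 v) = dz j D1 - dz j D2"
      by (simp add: dz_def field_simps)
    ultimately show ?thesis by simp
  qed
  have diag: "kernels_agree F1 F2 w0 w w" if w: "w \<in> B" for w
  proof -
    define a where "a = w - w0"
    define Z where "Z = {\<zeta>. w0 + \<zeta> *s a \<in> B}"
    have Z: "open Z" "convex Z" unfolding Z_def by (rule open_line[OF B(1)], rule convex_line[OF B(2)])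
    have Z01: "0 \<in> Z" "1 \<in> Z" using w w0 by (simp_all add: Z_def a_def)
    obtain E where E: "E holomorphic_on Z" "\<And>\<zeta>. \<zeta> \<in> Z \<Longrightarrow> exp (L1 (w0 + \<zeta> *s a) - L2 (w0 + \<zeta> *s a)) = cmod (E \<zeta>)"
      using pluriharmonic_on_line[OF B u harm, of w0 a] unfolding Z_def by blast
    have hol: "(\<lambda>\<zeta>. F1 m (w0 + \<zeta> *s a)) holomorphic_on Z" "(\<lambda>\<zeta>. F2 m (w0 + \<zeta> *s a)) holomorphic_on Z" for m
      using holo2_imp_line_holo[OF F(1) order_refl B(1), of m] holo2_imp_line_holo[OF F(2) order_refl B(1), of m]
      unfolding line_holo_def Z_def by blast+
    have dg: "kern F1 (w0 + \<zeta> *s a) (w0 + \<zeta> *s a) = E \<zeta> * cnj (E \<zeta>) * kern F2 (w0 + \<zeta> *s a) (w0 + \<zeta> *s a)"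
      if \<zeta>: "\<zeta> \<in> Z" for \<zeta>
    proof -
      let ?z = "w0 + \<zeta> *s a"
      have zB: "?z \<in> B" using \<zeta> by (simp add: Z_def)
      let ?K1 = "\<Sum>m\<in>UNIV. (cmod (F1 m ?z))\<^sup>2" and ?K2 = "\<Sum>m\<in>UNIV. (cmod (F2 m ?z))\<^sup>2"
      have "(cmod (E \<zeta>))\<^sup>2 = exp (2 * (L1 ?z - L2 ?z))"
        unfolding E(2)[OF \<zeta>, symmetric] by (simp only: exp_double)
      also have "2 * (L1 ?z - L2 ?z) = ln ?K1 - ln ?K2" by (simp add: L1_def L2_def log_norm_fam_def)
      also have "exp \<dots> = ?K1 / ?K2" using pos[OF zB] by (simp add: exp_diff)
      finally have "?K1 = (cmod (E \<zeta>))\<^sup>2 * ?K2" using pos(2)[OF zB] by (simp add: field_simps)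
      then show ?thesis unfolding kern_diag complex_norm_square[symmetric] by (simp only: of_real_mult)
    qed
    have fac: "(\<Sum>m\<in>UNIV. (c * F2 m x) * cnj (d * F2 m y)) = c * cnj d * kern F2 x y" for c d x y
      by (simp add: kern_def sum_distrib_left mult_ac)
    have pol: "kern F1 (w0 + s *s a) (w0 + t *s a) = E s * cnj (E t) * kern F2 (w0 + s *s a) (w0 + t *s a)"
      if "s \<in> Z" "t \<in> Z" for s t
      unfolding kern_def[of F1] fac[symmetric]
    proof (rule polarization_one_variable[OF Z, where f = "\<lambda>m \<zeta>. F1 m (w0 + \<zeta> *s a)"
          and g = "\<lambda>m \<zeta>. E \<zeta> * F2 m (w0 + \<zeta> *s a)"])
      show "(\<lambda>\<zeta>. E \<zeta> * F2 m (w0 + \<zeta> *s a)) holomorphic_on Z" for m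
        by (intro holomorphic_on_mult hol E)
      show "(\<Sum>m\<in>UNIV. F1 m (w0 + \<zeta> *s a) * cnj (F1 m (w0 + \<zeta> *s a)))
        = (\<Sum>m\<in>UNIV. (E \<zeta> * F2 m (w0 + \<zeta> *s a)) * cnj (E \<zeta> * F2 m (w0 + \<zeta> *s a)))" if "\<zeta> \<in> Z" for \<zeta>
        unfolding fac kern_def[of F1, symmetric] by (rule dg[OF that])
    qed (use that hol in auto)
    have w1: "w0 + 1 *s a = w" "w0 + 0 *s a = w0" by (simp_all add: a_def)
    show ?thesis
      using pol[OF Z01(2) Z01(2)] pol[OF Z01(2) Z01(1)] pol[OF Z01(1) Z01(2)] pol[OF Z01(1) Z01(1)]
      unfolding w1 kernels_agree_def by (simp only: mult_ac)
  qed
  have lh: "line_holo B (F1 m)" "line_holo B (F2 m)" for m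
    by (rule holo2_imp_line_holo[OF F(1) order_refl B(1)], rule holo2_imp_line_holo[OF F(2) order_refl B(1)])
  have lk: "line_holo B (\<lambda>w. kern F1 w w0)" "line_holo B (\<lambda>w. kern F2 w w0)"
    unfolding kern_def by (intro line_holo_sum line_holo_mult line_holo_const lh)+
  have fac: "(\<Sum>m\<in>UNIV. (c * (F m w * g)) * cnj (F m v * h)) = kern F w v * g * cnj h * c"
    for c g h w v and F :: "'m \<Rightarrow> complex ^ 'n \<Rightarrow> complex"
    by (simp add: kern_def sum_distrib_left sum_distrib_right mult_ac)
  have "(\<Sum>m\<in>UNIV. (kern F1 w0 w0 * (F1 m w * kern F2 w w0)) * cnj (F1 m v * kern F2 v w0))
    = (\<Sum>m\<in>UNIV. (kern F2 w0 w0 * (F2 m w * kern F1 w w0)) * cnj (F2 m v * kern F1 v w0))"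
  proof (rule polarization[OF B, where f = "\<lambda>m w. kern F1 w0 w0 * (F1 m w * kern F2 w w0)"
        and g = "\<lambda>m v. F1 m v * kern F2 v w0" and f' = "\<lambda>m w. kern F2 w0 w0 * (F2 m w * kern F1 w w0)"
        and g' = "\<lambda>m v. F2 m v * kern F1 v w0", OF _ _ _ _ _ w v])
    show "(\<Sum>m\<in>UNIV. (kern F1 w0 w0 * (F1 m w * kern F2 w w0)) * cnj (F1 m w * kern F2 w w0))
      = (\<Sum>m\<in>UNIV. (kern F2 w0 w0 * (F2 m w * kern F1 w w0)) * cnj (F2 m w * kern F1 w w0))" if "w \<in> B" for w
      unfolding fac cnj_kern by (rule diag[OF that, unfolded kernels_agree_def])
  qed (intro line_holo_mult line_holo_const lh lk)+
  then show ?thesis unfolding fac cnj_kern kernels_agree_def .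
qed

text \<open>The logarithms of the moduli of \<open>\<kappa>1\<close> and \<open>\<kappa>2\<close> are pluriharmonic and do not affect the mixed derivatives.\<close>

lemma curvature_eq_of_log_abs:
  assumes B: "open B" and u: "wirtinger_smooth B u1 q1" "wirtinger_smooth B u2 q2"
    and \<kappa>: "holo2_on B \<kappa>1" "holo2_on B \<kappa>2" "\<And>w. w \<in> B \<Longrightarrow> \<kappa>1 w \<noteq> 0" "\<And>w. w \<in> B \<Longrightarrow> \<kappa>2 w \<noteq> 0"
    and eq: "\<And>w. w \<in> B \<Longrightarrow> u1 w - ln (cmod (\<kappa>1 w)) = u2 w - ln (cmod (\<kappa>2 w)) + c"
    and w: "w \<in> B"
  shows "mixed_deriv j k u1 w = mixed_deriv j k u2 w"
proof -
  obtain p1 where p1: "wirtinger_smooth B (\<lambda>w. ln (cmod (\<kappa>1 w))) p1"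
    "\<And>k w j. w \<in> B \<Longrightarrow> \<exists>D. (p1 k has_derivative D) (at w) \<and> dz j D = 0"
    using wirtinger_log_abs_pluriharmonic[OF \<kappa>(1) B \<kappa>(3)] by blast
  obtain p2 where p2: "wirtinger_smooth B (\<lambda>w. ln (cmod (\<kappa>2 w))) p2"
    "\<And>k w j. w \<in> B \<Longrightarrow> \<exists>D. (p2 k has_derivative D) (at w) \<and> dz j D = 0"
    using wirtinger_log_abs_pluriharmonic[OF \<kappa>(2) B \<kappa>(4)] by blast
  note s1 = wirtinger_smooth_diff[OF u(1) p1(1)] and s2 = wirtinger_smooth_diff[OF u(2) p2(1)]
  have s1': "wirtinger_smooth B (\<lambda>w. u1 w - ln (cmod (\<kappa>1 w))) (\<lambda>k w. q2 k w - p2 k w)"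
    by (rule wirtinger_smooth_cong_const[OF s2 B]) (rule eq)
  have q: "q2 k z - p2 k z + p1 k z = q1 k z" if "z \<in> B" for z
  proof -
    have "q1 k z - p1 k z = q2 k z - p2 k z"
      using d_dwbar_wirtinger[OF s1 that, of k] d_dwbar_wirtinger[OF s1' that, of k] by simp
    then show ?thesis by (simp add: algebra_simps)
  qed
  obtain D2 where D2: "(q2 k has_derivative D2) (at w)"
    using u(2) w unfolding wirtinger_smooth_def differentiable_def by blast
  obtain P1 where P1: "(p1 k has_derivative P1) (at w)" "dz j P1 = 0" using p1(2)[OF w] by blast
  obtain P2 where P2: "(p2 k has_derivative P2) (at w)" "dz j P2 = 0" using p2(2)[OF w] by blast
  have "(q1 k has_derivative (\<lambda>v. D2 v - P2 v + P1 v)) (at w)"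
    by (rule has_derivative_transform_within_open[OF has_derivative_add[OF has_derivative_diff[OF D2 P2(1)] P1(1)] B w])
      (rule q)
  then have "mixed_deriv j k u1 w = dz j (\<lambda>v. D2 v - P2 v + P1 v)"
    by (rule d_dw_d_dwbar_wirtinger[OF B u(1) w])
  also have "\<dots> = dz j D2 - dz j P2 + dz j P1" by (simp add: dz_def field_simps)
  also have "\<dots> = mixed_deriv j k u2 w"
    unfolding d_dw_d_dwbar_wirtinger[OF B u(2) w D2] by (simp add: P1 P2)
  finally show ?thesis .
qed

text \<open>The logarithm of \<open>diag\<close> exhibits the difference of the two logarithms of norms as a difference of logarithms of
moduli of holomorphic functions, up to a constant.\<close>

lemma curvature_eq_of_normalised_kernels:
  fixes F1 F2 :: "'m::finite \<Rightarrow> complex ^ 'n::finite \<Rightarrow> complex"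
  assumes B: "open B" and w0: "w0 \<in> B"
    and F: "\<And>m. holo2_on B (F1 m)" "\<And>m. holo2_on B (F2 m)"
    and nz: "\<And>w. w \<in> B \<Longrightarrow> \<exists>m. F1 m w \<noteq> 0" "\<And>w. w \<in> B \<Longrightarrow> \<exists>m. F2 m w \<noteq> 0"
    and hk: "holo2_on B (\<lambda>w. kern F1 w w0)" "holo2_on B (\<lambda>w. kern F2 w w0)"
    and knz: "\<And>w. w \<in> B \<Longrightarrow> kern F1 w w0 \<noteq> 0" "\<And>w. w \<in> B \<Longrightarrow> kern F2 w w0 \<noteq> 0"
    and diag: "\<And>w. w \<in> B \<Longrightarrow> kernels_agree F1 F2 w0 w w"
    and w: "w \<in> B"
  shows "mixed_deriv j k (log_norm_fam UNIV F1) w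
      = mixed_deriv j k (log_norm_fam UNIV F2) w"
proof -
  let ?K1 = "\<lambda>w. \<Sum>m\<in>UNIV. (cmod (F1 m w))\<^sup>2" and ?K2 = "\<lambda>w. \<Sum>m\<in>UNIV. (cmod (F2 m w))\<^sup>2"
  have pos: "?K1 w > 0" "?K2 w > 0" if "w \<in> B" for w
    using nz(1)[OF that] nz(2)[OF that] sum_cmod_pos[of F1 _ w] sum_cmod_pos[of F2 _ w] by auto
  obtain q1 where q1: "wirtinger_smooth B (log_norm_fam UNIV F1) q1"
    using wirtinger_smooth_log_norm_fam[of UNIV B F1] F(1) pos(1) by blast
  obtain q2 where q2: "wirtinger_smooth B (log_norm_fam UNIV F2) q2"
    using wirtinger_smooth_log_norm_fam[of UNIV B F2] F(2) pos(2) by blast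
  have "log_norm_fam UNIV F1 z - ln (cmod (kern F1 z w0))
      = log_norm_fam UNIV F2 z - ln (cmod (kern F2 z w0)) + (ln (?K2 w0) - ln (?K1 w0)) / 2" if z: "z \<in> B" for z
  proof -
    have c: "cmod (kern F w0 z) = cmod (kern F z w0)" for F :: "'m \<Rightarrow> complex ^ 'n \<Rightarrow> complex"
      unfolding cnj_kern[of F w0 z, symmetric] by simp
    have "cmod (kern F1 z z * kern F2 z w0 * kern F2 w0 z * kern F1 w0 w0)
      = cmod (kern F2 z z * kern F1 z w0 * kern F1 w0 z * kern F2 w0 w0)" using diag[OF z] by (simp add: kernels_agree_def)
    then have "?K1 z * (cmod (kern F2 z w0))\<^sup>2 * ?K1 w0 = ?K2 z * (cmod (kern F1 z w0))\<^sup>2 * ?K2 w0"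
      using pos[OF z] pos[OF w0] unfolding norm_mult c kern_diag norm_of_real
      by (simp add: power2_eq_square mult_ac)
    then have "ln (?K1 z * (cmod (kern F2 z w0))\<^sup>2 * ?K1 w0) = ln (?K2 z * (cmod (kern F1 z w0))\<^sup>2 * ?K2 w0)"
      by simp
    moreover have "ln (a * x\<^sup>2 * b) = ln a + 2 * ln x + ln b" if "a > 0" "x > 0" "b > 0" for a x b :: real
      using that by (simp add: ln_mult ln_realpow)
    ultimately have "ln (?K1 z) + 2 * ln (cmod (kern F2 z w0)) + ln (?K1 w0)
        = ln (?K2 z) + 2 * ln (cmod (kern F1 z w0)) + ln (?K2 w0)"
      using pos[OF z] pos[OF w0] knz[OF z] by simp
    then show ?thesis by (simp add: log_norm_fam_def field_simps)
  qed
  from curvature_eq_of_log_abs[OF B q1 q2 hk knz this w] show ?thesis .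
qed

section \<open>The eigenvectors of the quotient module\<close>

lemma cinner_tens: "cinner x (tens c k) = (\<Sum>m\<in>UNIV. c $ m * pairing k x $ m)"
  by (simp add: cinner_vec_def tens_def pairing_def cinner_scaleC_right)

lemma cinner_tens_tens: "cinner (tens c k) (tens d l) = cnj (\<Sum>m\<in>UNIV. c $ m * cnj (d $ m)) * cinner k l"
  by (simp add: cinner_vec_def tens_def cinner_scaleC_left cinner_scaleC_right sum_distrib_left mult_ac)

lemma cinner_entrywise_tens:
  assumes "hilbert_module M" "k \<in> eigenspace_star M w"
  shows "cinner (entrywise M i x) (tens c k) = w $ i * cinner x (tens c k)"
  by (simp add: cinner_tens pairing_entrywise[OF assms] sum_distrib_left mult_ac)

lemma quotient_by_eq: "quotient_by M \<Omega> \<Theta> = quotient_module (entrywise M) (range (mult_matrix_op M \<Omega> \<Theta>))"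
proof -
  have "(\<lambda>i x. \<chi> k. M i (x $ k)) = entrywise M" by (simp add: fun_eq_iff entrywise_def)
  then show ?thesis unfolding quotient_by_def by (rule arg_cong)
qed

lemma log_norm_det_eq:
  "log_norm_det \<Theta> = (\<lambda>w. complex_of_real (log_norm_fam UNIV (\<lambda>m w. formal_det (\<Theta> w) $ m) w))"
  by (simp add: fun_eq_iff log_norm_det_def log_norm_fam_def norm_vec_def L2_set_def ln_sqrt sum_nonneg)

text \<open>What concerns only one of the two quotients is proved in this context, which is then instantiated twice.\<close>

locale column_multiplier =
  fixes \<Omega> :: "(complex ^ 'n::finite) set" and M :: "'n \<Rightarrow> 'h::chilbert_space \<Rightarrow> 'h"
    and \<Theta> :: "complex ^ 'n \<Rightarrow> complex ^ 'l::finite ^ 'l option"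
    and \<Psi> :: "complex ^ 'n \<Rightarrow> complex ^ 'l option ^ 'l"
  assumes domain: "open \<Omega>" "connected \<Omega>" and M: "M \<in> B1_star \<Omega>"
    and \<Theta>: "\<Theta> \<in> mult_matrices M \<Omega>" and \<Psi>: "\<Psi> \<in> mult_matrices M \<Omega>"
    and inv: "left_inverse_on \<Omega> \<Psi> \<Theta>"
begin

definition S :: "('h ^ 'l option) set" where
  "S = range (mult_matrix_op M \<Omega> \<Theta>)"

definition \<Delta> :: "'l option \<Rightarrow> complex ^ 'n \<Rightarrow> complex" where
  "\<Delta> m w = formal_det (\<Theta> w) $ m"

definition eigen :: "complex ^ 'n \<Rightarrow> 'h \<Rightarrow> 'h ^ 'l option" where
  "eigen w k = tens (formal_det (\<Theta> w)) k"

lemma module: "hilbert_module M"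
  using M by (simp add: B1_star_def)

lemma inv_at: "w \<in> \<Omega> \<Longrightarrow> \<Psi> w ** \<Theta> w = mat 1"
  using inv by (simp add: left_inverse_on_def)

lemma S: "csubspace S" "closed S"
  unfolding S_def by (rule range_mult_matrix_op[OF M \<Theta> \<Psi> inv])+

lemma S_invariant: "x \<in> S \<Longrightarrow> entrywise M i x \<in> S"
  unfolding S_def using entrywise_mult_matrix_op[OF M \<Theta>] by auto

lemma holo2_\<Delta>: "holo2_on \<Omega> (\<Delta> m)"
  using multiplier_holo2[OF domain(1) M multipliers_formal_det[OF \<Theta>]] by (simp add: \<Delta>_def[abs_def])

lemma holo2_kern: "holo2_on \<Omega> (\<lambda>w. kern \<Delta> w v)"
proof (rule multiplier_holo2[OF domain(1) M])
  show "(\<lambda>w. kern \<Delta> w v) \<in> multipliers M \<Omega>"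
    unfolding kern_def \<Delta>_def
    by (intro multipliers_sum multipliers_mult multipliers_const multipliers_formal_det \<Theta>)
qed

lemma \<Delta>_nonzero: "w \<in> \<Omega> \<Longrightarrow> \<exists>m. \<Delta> m w \<noteq> 0"
  using formal_det_nonzero[OF inv_at] by (auto simp: \<Delta>_def vec_eq_iff)

lemma kern_pos: "w \<in> \<Omega> \<Longrightarrow> \<exists>r>0. kern \<Delta> w w = complex_of_real r"
  using \<Delta>_nonzero[of w] sum_cmod_pos[of \<Delta> _ w] unfolding kern_diag by blast

lemma cinner_eigen: "cinner (eigen w k) (eigen v l) = cnj (kern \<Delta> w v) * cinner k l"
  by (simp add: eigen_def cinner_tens_tens kern_def \<Delta>_def)

lemma cinner_entrywise_eigen:
  "k \<in> eigenspace_star M w \<Longrightarrow> cinner (entrywise M i x) (eigen w k) = w $ i * cinner x (eigen w k)"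
  unfolding eigen_def by (rule cinner_entrywise_tens[OF module])

lemma eigen_orthocomp:
  assumes "w \<in> \<Omega>" "k \<in> eigenspace_star M w"
  shows "eigen w k \<in> orthocomp S"
proof -
  have "cinner (mult_matrix_op M \<Omega> \<Theta> x) (eigen w k) = 0" for x
    unfolding eigen_def cinner_tens pairing_mult_matrix_op[OF \<Theta> assms] sum_formal_det_eq_0_iff[OF inv_at[OF assms(1)]]
    by (simp add: matrix_vector_mul_assoc inv_at[OF assms(1)] matrix_mul_assoc)
  then show ?thesis by (intro orthocompI) (metis S_def cinner_commute complex_cnj_zero imageE)
qed

text \<open>The coordinates of a joint eigenvector are multiples of \<open>k\<close>.  Orthogonality to the range says that the conjugated
coefficients annihilate the range of \<open>\<Theta> w\<close>, and the annihilator is spanned by the formal determinant.\<close>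

lemma eigen_unique:
  assumes w: "w \<in> \<Omega>" and E: "eigenspace_star M w = {c *\<^sub>C k |c. True}" and k: "k \<noteq> 0"
    and x: "x \<in> orthocomp S" "\<And>i y. cinner (entrywise M i y) x = w $ i * cinner y x"
  shows "\<exists>c. x = c *\<^sub>C eigen w k"
proof -
  have kE: "k \<in> eigenspace_star M w" by (rule generator_mem[OF E])
  have Mc: "bounded_clinear (M i)" for i using module by (simp add: hilbert_module_def)
  have ax: "cinner (axis m z) y = cinner z (y $ m)" for m z and y :: "'h ^ 'l option"
  proof -
    have "cinner (axis m z) y = (\<Sum>i\<in>UNIV. if i = m then cinner z (y $ m) else 0)"
      unfolding cinner_vec_def by (rule sum.cong) (auto simp: axis_def)
    then show ?thesis by simp
  qed
  have "x $ m \<in> eigenspace_star M w" for m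
    unfolding mem_eigenspace_star(1)[OF module]
  proof (intro allI cadjoint_eqI[OF Mc])
    fix i z
    have "entrywise M i (axis m z) = axis m (M i z)"
      using linear_simps(3)[OF bounded_clinearD[OF Mc[of i]]]
      by (auto simp: entrywise_def axis_def vec_eq_iff)
    then show "cinner (M i z) (x $ m) = cinner z (cnj (w $ i) *\<^sub>C x $ m)"
      using x(2)[of i "axis m z"] by (simp add: ax cinner_scaleC_right)
  qed
  then have "\<forall>m. \<exists>c. x $ m = c *\<^sub>C k" unfolding E by auto
  then obtain b where b: "\<And>m. x $ m = b m *\<^sub>C k" by metis
  define a where "a = (\<chi> m. cnj (b m))"
  have xa: "x = tens a k" by (simp add: vec_eq_iff tens_def a_def b)
  have "(\<Sum>m\<in>UNIV. a $ m * (\<Theta> w *v y) $ m) = 0" for y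
  proof -
    \<comment> \<open>an element of the module whose value at \<open>w\<close> is \<open>y\<close>\<close>
    define z where "z = (\<chi> j. (y $ j / cinner k k) *\<^sub>C k)"
    have "pairing k z = y" using k by (simp add: pairing_def z_def vec_eq_iff cinner_scaleC_left)
    moreover have "mult_matrix_op M \<Omega> \<Theta> z \<in> S" by (simp add: S_def)
    then have "cinner (mult_matrix_op M \<Omega> \<Theta> z) x = 0" by (rule orthocompD'[OF x(1)])
    ultimately show ?thesis
      unfolding xa cinner_tens pairing_mult_matrix_op[OF \<Theta> w kE] by simp
  qed
  then obtain c where "a = c *s formal_det (\<Theta> w)"
    using annihilator_multiple_of_formal_det[OF inv_at[OF w]] by blast
  then have "x = cnj c *\<^sub>C eigen w k"
    by (simp add: xa eigen_def tens_def vec_eq_iff scaleC_vec_def scaleC_scaleC)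
  then show ?thesis by blast
qed

text \<open>Orthogonality to the eigenvectors at \<open>w\<close> says that the value of \<open>h\<close> at \<open>w\<close> lies in the range of \<open>\<Theta> w\<close>.
When this holds at all \<open>w\<close>, the left inverse produces a preimage of \<open>h\<close>, so \<open>h\<close> lies in \<open>S\<close> and is orthogonal to
it.\<close>

lemma eigen_total:
  assumes h: "h \<in> orthocomp S"
    and zero: "\<And>w k. w \<in> \<Omega> \<Longrightarrow> k \<in> eigenspace_star M w \<Longrightarrow> cinner h (eigen w k) = 0"
  shows "h = 0"
proof -
  have "mult_matrix_op M \<Omega> \<Theta> (mult_matrix_op M \<Omega> \<Psi> h) = h"
  proof (rule pairing_total[OF M])
    fix w k assume wk: "w \<in> \<Omega>" "k \<in> eigenspace_star M w"
    show "pairing k (mult_matrix_op M \<Omega> \<Theta> (mult_matrix_op M \<Omega> \<Psi> h)) = pairing k h"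
      unfolding pairing_mult_matrix_op[OF \<Theta> wk] pairing_mult_matrix_op[OF \<Psi> wk]
        sum_formal_det_eq_0_iff[OF inv_at[OF wk(1)], symmetric]
      using zero[OF wk] by (simp only: eigen_def cinner_tens)
  qed
  then have "h \<in> S" unfolding S_def by (metis rangeI)
  then show ?thesis using h by (rule orthocomp_Int_self)
qed

text \<open>The interior \<open>A\<close> of the set of points at which \<open>h\<close> is orthogonal to the eigenvectors is relatively
closed: near a limit point \<open>w0\<close> in \<open>\<Omega>\<close> the identity theorem applies to the function
\<open>w \<mapsto> cinner h (eigen w (k w))\<close>, holomorphic on a ball about \<open>w0\<close>.  So \<open>A\<close> is \<open>\<Omega>\<close> by connectedness.\<close>

lemma eigen_total_on_open:
  assumes W: "open W" "W \<noteq> {}" "W \<subseteq> \<Omega>" and h: "h \<in> orthocomp S"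
    and zero: "\<And>w k. w \<in> W \<Longrightarrow> k \<in> eigenspace_star M w \<Longrightarrow> cinner h (eigen w k) = 0"
  shows "h = 0"
proof -
  define Z where "Z = {w \<in> \<Omega>. \<forall>k\<in>eigenspace_star M w. cinner h (eigen w k) = 0}"
  define A where "A = interior Z"
  have A: "open A" "A \<subseteq> Z" "Z \<subseteq> \<Omega>" by (auto simp: A_def interior_subset Z_def)
  have "W \<subseteq> A" unfolding A_def by (rule interior_maximal) (use W zero in \<open>auto simp: Z_def\<close>)
  have "openin (top_of_set \<Omega>) A" by (rule open_subset) (use A in auto)
  moreover have "closedin (top_of_set \<Omega>) A"
    unfolding closedin_limpt
  proof (intro conjI allI impI)
    show "A \<subseteq> \<Omega>" using A by blast
    fix w0 assume "w0 islimpt A \<and> w0 \<in> \<Omega>"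
    then have lim: "w0 islimpt A" and w0: "w0 \<in> \<Omega>" by simp_all
    obtain r k k1 k2 where r: "r > 0" "ball w0 r \<subseteq> \<Omega>"
      and E: "\<And>w. w \<in> ball w0 r \<Longrightarrow> eigenspace_star M w = {c *\<^sub>C k w |c. True}"
      and kk: "\<And>w. w \<in> ball w0 r \<Longrightarrow> cinner (k w) (k w0) = 1"
      and k1: "\<And>w. w \<in> ball w0 r \<Longrightarrow> (k has_derivative antilin (\<lambda>j. k1 j w)) (at w)"
      and k2: "\<And>w j. w \<in> ball w0 r \<Longrightarrow> (k1 j has_derivative antilin (\<lambda>i. k2 i j w)) (at w)"
      by (rule antiholomorphic_eigenvector[OF domain(1) M w0], rule that)
    define f where "f w = (\<Sum>m\<in>UNIV. \<Delta> m w * cinner (h $ m) (k w))" for w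
    have f: "f w = cinner h (eigen w (k w))" for w
      by (simp add: f_def eigen_def cinner_tens pairing_def \<Delta>_def)
    have lh: "line_holo (ball w0 r) f"
      unfolding f_def
      by (intro line_holo_sum line_holo_mult holo2_imp_line_holo[OF holo2_\<Delta> r(2)]
          holo2_imp_line_holo[OF holo2_cinner_antiholomorphic[OF open_ball k1 k2]]) auto
    have kE: "k w \<in> eigenspace_star M w" if "w \<in> ball w0 r" for w by (rule generator_mem[OF E[OF that]])
    obtain a where "a \<in> A" "dist a w0 < r"
      using lim r(1) unfolding islimpt_approachable by blast
    then have "a \<in> A \<inter> ball w0 r" by (simp add: dist_commute)
    then have ne: "A \<inter> ball w0 r \<noteq> {}" by blast
    have "f w = 0" if "w \<in> ball w0 r" for w
    proof (rule line_holo_identity[OF lh open_ball convex_ball _ ne _ _ that])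
      show "open (A \<inter> ball w0 r)" using A by auto
      show "f v = 0" if "v \<in> A \<inter> ball w0 r" for v
        using that A kE[of v] unfolding f by (auto simp: Z_def)
    qed simp
    then have "cinner h (eigen w (c *\<^sub>C k w)) = 0" if "w \<in> ball w0 r" for w c
    proof -
      have "eigen w (c *\<^sub>C k w) = c *\<^sub>C eigen w (k w)"
        by (simp add: eigen_def tens_def vec_eq_iff scaleC_vec_def scaleC_scaleC mult.commute)
      then show ?thesis using \<open>\<And>w. w \<in> ball w0 r \<Longrightarrow> f w = 0\<close>[OF that] by (simp add: f cinner_scaleC_right)
    qed
    then have "ball w0 r \<subseteq> Z" using r(2) E by (auto simp: Z_def)
    then have "ball w0 r \<subseteq> A" unfolding A_def by (rule interior_maximal) simp
    then show "w0 \<in> A" using r(1) by auto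
  qed
  ultimately have "A = \<Omega>" using domain(2) W(2) \<open>W \<subseteq> A\<close> unfolding connected_clopen by blast
  then have "Z = \<Omega>" using A by blast
  then show ?thesis using eigen_total[OF h] by (auto simp: Z_def)
qed

text \<open>The factors \<open>f\<close> serve to match the eigenvectors of two quotients.\<close>

lemma closure_cspan_eigen:
  assumes W: "open W" "W \<noteq> {}" "W \<subseteq> \<Omega>"
    and E: "\<And>w. w \<in> W \<Longrightarrow> eigenspace_star M w = {c *\<^sub>C k w |c. True}"
    and f: "\<And>w. w \<in> W \<Longrightarrow> f w \<noteq> 0"
  shows "closure (cspan ((\<lambda>w. f w *\<^sub>C eigen w (k w)) ` W)) = orthocomp S"
proof (rule closure_cspan_eqI[OF csubspace_orthocomp closed_orthocomp])
  have kE: "k w \<in> eigenspace_star M w" if "w \<in> W" for w by (rule generator_mem[OF E[OF that]])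
  show "(\<lambda>w. f w *\<^sub>C eigen w (k w)) ` W \<subseteq> orthocomp S"
    using eigen_orthocomp kE W(3) by (auto intro!: csubspace_scale[OF csubspace_orthocomp])
  fix x assume x: "x \<in> orthocomp S" and zero: "\<And>g. g \<in> (\<lambda>w. f w *\<^sub>C eigen w (k w)) ` W \<Longrightarrow> cinner x g = 0"
  show "x = 0"
  proof (rule eigen_total_on_open[OF W x])
    fix w l assume w: "w \<in> W" and "l \<in> eigenspace_star M w"
    then obtain c where l: "l = c *\<^sub>C k w" using E by blast
    have "cinner x (f w *\<^sub>C eigen w (k w)) = 0" by (rule zero) (use w in blast)
    then have "cinner x (eigen w (k w)) = 0" using f[OF w] by (simp add: cinner_scaleC_right)
    moreover have "eigen w l = c *\<^sub>C eigen w (k w)"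
      by (simp add: l eigen_def tens_def vec_eq_iff scaleC_vec_def scaleC_scaleC mult.commute)
    ultimately show "cinner x (eigen w l) = 0" by (simp add: cinner_scaleC_right)
  qed
qed

end

section \<open>Comparing two quotient modules\<close>

locale two_column_multipliers =
  A: column_multiplier \<Omega> M \<Theta>1 \<Psi>1 + B: column_multiplier \<Omega> M \<Theta>2 \<Psi>2
  for \<Omega> :: "(complex ^ 'n::finite) set" and M :: "'n \<Rightarrow> 'h::chilbert_space \<Rightarrow> 'h"
    and \<Theta>1 \<Theta>2 :: "complex ^ 'n \<Rightarrow> complex ^ 'l::finite ^ 'l option" and \<Psi>1 \<Psi>2
begin

lemma isomorphic_iff:
  "isomorphic_modules (quotient_by M \<Omega> \<Theta>1) (quotient_by M \<Omega> \<Theta>2)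
    \<longleftrightarrow> (\<exists>V. intertwining_unitary (entrywise M) A.S B.S V)"
  unfolding quotient_by_eq A.S_def[symmetric] B.S_def[symmetric]
  by (rule isomorphic_quotients_iff[OF A.S B.S bounded_clinear_entrywise[OF A.module] A.S_invariant B.S_invariant])

lemma local_frame:
  assumes w0: "w0 \<in> \<Omega>"
  obtains r k where "r > 0" "ball w0 r \<subseteq> \<Omega>"
    "\<And>w. w \<in> ball w0 r \<Longrightarrow> eigenspace_star M w = {c *\<^sub>C k w |c. True}"
    "\<And>w. w \<in> ball w0 r \<Longrightarrow> cinner (k w) (k w0) = 1"
    "\<And>w. w \<in> ball w0 r \<Longrightarrow> kern A.\<Delta> w w0 \<noteq> 0" "\<And>w. w \<in> ball w0 r \<Longrightarrow> kern B.\<Delta> w w0 \<noteq> 0"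
proof -
  obtain r k k1 k2 where r: "r > 0" "ball w0 r \<subseteq> \<Omega>"
    and E: "\<And>w. w \<in> ball w0 r \<Longrightarrow> eigenspace_star M w = {c *\<^sub>C k w |c. True}"
    and kk: "\<And>w. w \<in> ball w0 r \<Longrightarrow> cinner (k w) (k w0) = 1"
    and "\<And>w. w \<in> ball w0 r \<Longrightarrow> (k has_derivative antilin (\<lambda>j. k1 j w)) (at w)"
    and "\<And>w j. w \<in> ball w0 r \<Longrightarrow> (k1 j has_derivative antilin (\<lambda>i. k2 i j w)) (at w)"
    by (rule antiholomorphic_eigenvector[OF A.domain(1) A.M w0], rule that)
  have away: "\<exists>e>0. \<forall>w. dist w0 w < e \<longrightarrow> f w \<noteq> 0" if "holo2_on \<Omega> f" "f w0 \<noteq> 0" for f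
    using that w0 has_derivative_continuous[of f _ w0 UNIV]
    by (intro continuous_at_avoid) (auto simp: holo2_on_def)
  have "kern A.\<Delta> w0 w0 \<noteq> 0" "kern B.\<Delta> w0 w0 \<noteq> 0"
    using A.kern_pos[OF w0] B.kern_pos[OF w0] by auto
  note away[OF A.holo2_kern this(1)] away[OF B.holo2_kern this(2)]
  then obtain e1 e2 where e: "e1 > 0" "\<forall>w. dist w0 w < e1 \<longrightarrow> kern A.\<Delta> w w0 \<noteq> 0"
    "e2 > 0" "\<forall>w. dist w0 w < e2 \<longrightarrow> kern B.\<Delta> w w0 \<noteq> 0"
    by (elim exE conjE)
  show thesis
    by (rule that[of "min r (min e1 e2)" k]) (use r E kk e in auto)
qed

text \<open>The unitary sends the eigenvector at \<open>w\<close> to an eigenvector at \<open>w\<close>, say to \<open>c w\<close> times the chosen one.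
The Gram matrices then differ by the factor \<open>c w * cnj (c v)\<close>, which normalisation at \<open>w0\<close> cancels.\<close>

lemma normalised_kernels_agree_of_isomorphic:
  assumes V: "intertwining_unitary (entrywise M) A.S B.S V"
    and w0: "w0 \<in> W" and W: "W \<subseteq> \<Omega>"
    and E: "\<And>w. w \<in> W \<Longrightarrow> eigenspace_star M w = {c *\<^sub>C k w |c. True}"
    and kk: "\<And>w. w \<in> W \<Longrightarrow> cinner (k w) (k w0) = 1"
    and w: "w \<in> W"
  shows "kernels_agree A.\<Delta> B.\<Delta> w0 w w"
proof -
  have im: "V ` orthocomp A.S = orthocomp B.S"
    and Vadd: "\<And>x y. x \<in> orthocomp A.S \<Longrightarrow> y \<in> orthocomp A.S \<Longrightarrow> V (x + y) = V x + V y"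
    and Vscale: "\<And>c x. x \<in> orthocomp A.S \<Longrightarrow> V (c *\<^sub>C x) = c *\<^sub>C V x"
    and Vnorm: "\<And>x. x \<in> orthocomp A.S \<Longrightarrow> norm (V x) = norm x"
    and Vact: "\<And>i x. x \<in> orthocomp A.S \<Longrightarrow> V (perp_part A.S (entrywise M i x)) = perp_part B.S (entrywise M i (V x))"
    using V unfolding intertwining_unitary_def by blast+
  have Vcinner: "cinner (V x) (V y) = cinner x y" if "x \<in> orthocomp A.S" "y \<in> orthocomp A.S" for x y
    by (rule isometry_preserves_cinner[OF csubspace_orthocomp _ _ _ that]) (simp_all add: Vadd Vscale Vnorm)
  have kE: "k w \<in> eigenspace_star M w" if "w \<in> W" for w by (rule generator_mem[OF E[OF that]])
  have k0: "k w \<noteq> 0" if "w \<in> W" for w using kk[OF that] by auto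
  let ?g = "\<lambda>w. A.eigen w (k w)" and ?h = "\<lambda>w. B.eigen w (k w)"
  have gA: "?g w \<in> orthocomp A.S" if "w \<in> W" for w using A.eigen_orthocomp kE that W by blast
  have "\<exists>c. V (?g w) = c *\<^sub>C ?h w" if w: "w \<in> W" for w
  proof (rule B.eigen_unique)
    show VB: "V (?g w) \<in> orthocomp B.S" using im gA[OF w] by blast
    fix i y
    have "perp_part B.S y \<in> V ` orthocomp A.S" unfolding im by (rule perp_part_orthocomp[OF B.S])
    then obtain x where x: "x \<in> orthocomp A.S" "perp_part B.S y = V x" by (rule imageE)
    have "cinner (entrywise M i (V x)) (V (?g w)) = cinner (perp_part B.S (entrywise M i (V x))) (V (?g w))"
      by (rule cinner_perp_part[OF B.S VB, symmetric])
    also have "\<dots> = cinner (perp_part A.S (entrywise M i x)) (?g w)"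
      unfolding Vact[OF x(1), symmetric] by (rule Vcinner[OF perp_part_orthocomp[OF A.S] gA[OF w]])
    also have "\<dots> = cinner (entrywise M i x) (?g w)" by (rule cinner_perp_part[OF A.S gA[OF w]])
    also have "\<dots> = w $ i * cinner x (?g w)" by (rule A.cinner_entrywise_eigen[OF kE[OF w]])
    also have "cinner x (?g w) = cinner (V x) (V (?g w))" by (rule Vcinner[OF x(1) gA[OF w], symmetric])
    also have "\<dots> = cinner y (V (?g w))" unfolding x(2)[symmetric] by (rule cinner_perp_part[OF B.S VB])
    finally have "cinner (entrywise M i (perp_part B.S y)) (V (?g w)) = w $ i * cinner y (V (?g w))"
      unfolding x(2) .
    moreover have "cinner (entrywise M i (y - perp_part B.S y)) (V (?g w)) = 0"
      by (rule orthocompD'[OF VB B.S_invariant[OF diff_perp_part[OF B.S]]])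
    ultimately show "cinner (entrywise M i y) (V (?g w)) = w $ i * cinner y (V (?g w))"
      using linear_simps(2)[OF bounded_clinearD[OF bounded_clinear_entrywise[OF A.module]], of i y "perp_part B.S y"]
      by (simp add: cinner.diff_left)
  qed (use w W E k0 in auto)
  then obtain c where c: "\<And>w. w \<in> W \<Longrightarrow> V (?g w) = c w *\<^sub>C ?h w" by metis
  have key: "cnj (kern A.\<Delta> w v) = c w * cnj (c v) * cnj (kern B.\<Delta> w v)"
    if wv: "w \<in> W" "v \<in> W" and nz: "cinner (k w) (k v) \<noteq> 0" for w v
  proof -
    have "cinner (?g w) (?g v) = c w * cnj (c v) * cinner (?h w) (?h v)"
      using Vcinner[OF gA[OF wv(1)] gA[OF wv(2)]]
      by (simp add: c wv cinner_scaleC_left cinner_scaleC_right mult_ac)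
    then show ?thesis using nz by (simp add: A.cinner_eigen B.cinner_eigen)
  qed
  have key': "kern A.\<Delta> v w = c w * cnj (c v) * kern B.\<Delta> v w"
    if "w \<in> W" "v \<in> W" "cinner (k w) (k v) \<noteq> 0" for w v
    using key[OF that] by (simp add: cnj_kern)
  have n: "cinner (k w) (k w) \<noteq> 0" "cinner (k w) (k w0) \<noteq> 0" "cinner (k w0) (k w) \<noteq> 0" "cinner (k w0) (k w0) \<noteq> 0"
    using k0[OF w] k0[OF w0] kk[OF w] cinner_commute[of "k w0" "k w"] by auto
  show ?thesis
    unfolding kernels_agree_def key'[OF w w n(1)] key'[OF w w0 n(2)] key'[OF w0 w n(3)] key'[OF w0 w0 n(4)]
    by (simp only: mult_ac)
qed

text \<open>After rescaling by \<open>f\<close> the eigenvectors have equal Gram matrices, which yields a unitary.  It intertwines the compressed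
operators because their adjoints act on corresponding eigenvectors by the same scalars and the eigenvectors
span.\<close>

lemma isomorphic_of_normalised_kernels_agree:
  assumes w0: "w0 \<in> W" and W: "open W" "W \<subseteq> \<Omega>"
    and E: "\<And>w. w \<in> W \<Longrightarrow> eigenspace_star M w = {c *\<^sub>C k w |c. True}"
    and nz: "\<And>w. w \<in> W \<Longrightarrow> kern A.\<Delta> w w0 \<noteq> 0" "\<And>w. w \<in> W \<Longrightarrow> kern B.\<Delta> w w0 \<noteq> 0"
    and agree: "\<And>w v. w \<in> W \<Longrightarrow> v \<in> W \<Longrightarrow>
      kernels_agree A.\<Delta> B.\<Delta> w0 w v"
  shows "\<exists>V. intertwining_unitary (entrywise M) A.S B.S V"
proof -
  have kE: "k w \<in> eigenspace_star M w" if "w \<in> W" for w by (rule generator_mem[OF E[OF that]])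
  have w0\<Omega>: "w0 \<in> \<Omega>" using w0 W by blast
  obtain s1 where s1: "s1 > 0" "kern A.\<Delta> w0 w0 = complex_of_real s1" using A.kern_pos[OF w0\<Omega>] by blast
  obtain s2 where s2: "s2 > 0" "kern B.\<Delta> w0 w0 = complex_of_real s2" using B.kern_pos[OF w0\<Omega>] by blast
  \<comment> \<open>The factor that the Gram matrices force: \<open>cnj (kern A.\<Delta> w v) = f w * cnj (f v) * cnj (kern B.\<Delta> w v)\<close>,
    solved for \<open>f w\<close> at \<open>v = w0\<close> with \<open>f w0 > 0\<close>.\<close>
  define f where "f w = complex_of_real (sqrt (s2 / s1)) * (kern A.\<Delta> w0 w / kern B.\<Delta> w0 w)" for w
  have ss: "complex_of_real (sqrt (s2 / s1)) * complex_of_real (sqrt (s2 / s1)) = complex_of_real (s2 / s1)"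
    unfolding of_real_mult[symmetric] using s1 s2 by simp
  have nz': "kern A.\<Delta> w0 w \<noteq> 0" "kern B.\<Delta> w0 w \<noteq> 0" if "w \<in> W" for w
    using nz[OF that] cnj_kern[of A.\<Delta> w w0] cnj_kern[of B.\<Delta> w w0] by auto
  have f0: "f w \<noteq> 0" if "w \<in> W" for w
    using nz'[OF that] s1 s2 by (simp add: f_def)
  let ?g = "\<lambda>w. 1 *\<^sub>C A.eigen w (k w)" and ?h = "\<lambda>w. f w *\<^sub>C B.eigen w (k w)"
  have ne: "W \<noteq> {}" using w0 by blast
  have KA: "closure (cspan (?g ` W)) = orthocomp A.S"
    by (rule A.closure_cspan_eigen[OF W(1) ne W(2) E]) simp_all
  have KB: "closure (cspan (?h ` W)) = orthocomp B.S"
    by (rule B.closure_cspan_eigen[OF W(1) ne W(2) E f0])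
  have gram: "cinner (?g w) (?g v) = cinner (?h w) (?h v)" if wv: "w \<in> W" "v \<in> W" for w v
  proof -
    have "kern A.\<Delta> v w * (kern B.\<Delta> v w0 * kern B.\<Delta> w0 w) * complex_of_real s1
        = kern B.\<Delta> v w * kern A.\<Delta> v w0 * kern A.\<Delta> w0 w * complex_of_real s2"
      using agree[OF wv(2,1)] by (simp add: kernels_agree_def s1 s2 mult.assoc)
    then have "kern A.\<Delta> v w = kern B.\<Delta> v w * kern A.\<Delta> v w0 * kern A.\<Delta> w0 w * complex_of_real s2
        / (kern B.\<Delta> v w0 * kern B.\<Delta> w0 w * complex_of_real s1)"
      using nz[OF wv(2)] nz'[OF wv(1)] s1 by (simp add: field_simps)
    also have "\<dots> = complex_of_real (s2 / s1)
        * (kern A.\<Delta> w0 w / kern B.\<Delta> w0 w * (kern A.\<Delta> v w0 / kern B.\<Delta> v w0)) * kern B.\<Delta> v w"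
      by (simp add: mult_ac)
    also have "\<dots> = f w * cnj (f v) * kern B.\<Delta> v w"
      by (simp only: f_def complex_cnj_mult complex_cnj_divide complex_cnj_complex_of_real cnj_kern ss[symmetric] mult_ac)
    finally show ?thesis
      by (simp add: cinner_scaleC_left cinner_scaleC_right A.cinner_eigen B.cinner_eigen cnj_kern mult_ac)
  qed
  obtain V where V: "V ` orthocomp A.S = orthocomp B.S"
    "\<And>x y. x \<in> orthocomp A.S \<Longrightarrow> y \<in> orthocomp A.S \<Longrightarrow> V (x + y) = V x + V y"
    "\<And>c x. x \<in> orthocomp A.S \<Longrightarrow> V (c *\<^sub>C x) = c *\<^sub>C V x" "\<And>x. x \<in> orthocomp A.S \<Longrightarrow> norm (V x) = norm x"
    and Vg: "\<And>w. w \<in> W \<Longrightarrow> V (?g w) = ?h w"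
    using unitary_of_equal_gram[of W ?g ?h, OF gram] unfolding KA KB by blast
  have Vcinner: "cinner (V x) (V y) = cinner x y" if "x \<in> orthocomp A.S" "y \<in> orthocomp A.S" for x y
    by (rule isometry_preserves_cinner[OF csubspace_orthocomp _ _ _ that]) (simp_all add: V(2-4))
  have VB: "V x \<in> orthocomp B.S" if "x \<in> orthocomp A.S" for x using V(1) that by blast
  have gA: "?g w \<in> orthocomp A.S" if "w \<in> W" for w
    using A.eigen_orthocomp kE that W by auto
  have hB: "?h w \<in> orthocomp B.S" if "w \<in> W" for w
    using VB[OF gA[OF that]] unfolding Vg[OF that] .
  have eqv: "V (perp_part A.S (entrywise M i x)) = perp_part B.S (entrywise M i (V x))"
    if x: "x \<in> orthocomp A.S" for i x
  proof -
    let ?d = "V (perp_part A.S (entrywise M i x)) - perp_part B.S (entrywise M i (V x))"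
    have "cinner ?d (?h w) = 0" if w: "w \<in> W" for w
    proof -
      have "cinner (V (perp_part A.S (entrywise M i x))) (?h w) = cinner (perp_part A.S (entrywise M i x)) (?g w)"
        unfolding Vg[OF w, symmetric] by (rule Vcinner[OF perp_part_orthocomp[OF A.S] gA[OF w]])
      also have "\<dots> = cinner (entrywise M i x) (?g w)" by (rule cinner_perp_part[OF A.S gA[OF w]])
      also have "\<dots> = w $ i * cinner x (?g w)" by (simp add: A.cinner_entrywise_eigen[OF kE[OF w]])
      also have "cinner x (?g w) = cinner (V x) (?h w)"
        unfolding Vg[OF w, symmetric] by (rule Vcinner[OF x gA[OF w], symmetric])
      also have "w $ i * cinner (V x) (?h w) = cinner (entrywise M i (V x)) (?h w)"
        by (simp add: cinner_scaleC_right B.cinner_entrywise_eigen[OF kE[OF w]])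
      also have "\<dots> = cinner (perp_part B.S (entrywise M i (V x))) (?h w)"
        by (rule cinner_perp_part[OF B.S hB[OF w], symmetric])
      finally show ?thesis by (simp add: cinner.diff_left)
    qed
    then have "?d \<in> orthocomp (?h ` W)" by (auto intro: orthocompI)
    then have "?d \<in> orthocomp (orthocomp B.S)"
      unfolding KB[symmetric] by (simp only: orthocomp_closure_cspan)
    moreover have "?d \<in> orthocomp B.S"
      by (intro csubspace_diff[OF csubspace_orthocomp] VB perp_part_orthocomp A.S B.S)
    ultimately have "?d = 0" using orthocomp_Int_self by blast
    then show ?thesis by simp
  qed
  show ?thesis
    unfolding intertwining_unitary_def using V eqv by blast
qed

lemma isomorphic_iff_curvature:
  "isomorphic_modules (quotient_by M \<Omega> \<Theta>1) (quotient_by M \<Omega> \<Theta>2)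
    \<longleftrightarrow> (\<forall>w\<in>\<Omega>. \<forall>j k. d_dw j (d_dwbar k (log_norm_det \<Theta>1)) w = d_dw j (d_dwbar k (log_norm_det \<Theta>2)) w)"
proof -
  have ld: "log_norm_det \<Theta>1 = (\<lambda>w. complex_of_real (log_norm_fam UNIV A.\<Delta> w))"
    "log_norm_det \<Theta>2 = (\<lambda>w. complex_of_real (log_norm_fam UNIV B.\<Delta> w))"
    unfolding log_norm_det_eq by (simp_all add: A.\<Delta>_def[abs_def] B.\<Delta>_def[abs_def])
  show ?thesis
    unfolding isomorphic_iff
  proof
    assume "\<exists>V. intertwining_unitary (entrywise M) A.S B.S V"
    then obtain V where V: "intertwining_unitary (entrywise M) A.S B.S V" by blast
    show "\<forall>w\<in>\<Omega>. \<forall>j k. d_dw j (d_dwbar k (log_norm_det \<Theta>1)) w = d_dw j (d_dwbar k (log_norm_det \<Theta>2)) w"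
    proof (intro ballI allI)
      fix w0 j k assume w0: "w0 \<in> \<Omega>"
      obtain r e where r: "r > 0" "ball w0 r \<subseteq> \<Omega>"
        and E: "\<And>w. w \<in> ball w0 r \<Longrightarrow> eigenspace_star M w = {c *\<^sub>C e w |c. True}"
        and ee: "\<And>w. w \<in> ball w0 r \<Longrightarrow> cinner (e w) (e w0) = 1"
        and nz: "\<And>w. w \<in> ball w0 r \<Longrightarrow> kern A.\<Delta> w w0 \<noteq> 0" "\<And>w. w \<in> ball w0 r \<Longrightarrow> kern B.\<Delta> w w0 \<noteq> 0"
        by (rule local_frame[OF w0], rule that)
      have w0b: "w0 \<in> ball w0 r" using r by simp
      show "d_dw j (d_dwbar k (log_norm_det \<Theta>1)) w0 = d_dw j (d_dwbar k (log_norm_det \<Theta>2)) w0"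
        unfolding ld
      proof (rule curvature_eq_of_normalised_kernels[OF open_ball w0b _ _ _ _ _ _ nz _ w0b])
        show "kernels_agree A.\<Delta> B.\<Delta> w0 w w" if "w \<in> ball w0 r" for w
          by (rule normalised_kernels_agree_of_isomorphic[OF V w0b r(2) E ee that])
      qed (use r(2) A.\<Delta>_nonzero B.\<Delta>_nonzero holo2_on_subset A.holo2_\<Delta> B.holo2_\<Delta> A.holo2_kern B.holo2_kern in blast)+
    qed
  next
    assume curv: "\<forall>w\<in>\<Omega>. \<forall>j k. d_dw j (d_dwbar k (log_norm_det \<Theta>1)) w = d_dw j (d_dwbar k (log_norm_det \<Theta>2)) w"
    show "\<exists>V. intertwining_unitary (entrywise M) A.S B.S V"
    proof (cases "\<Omega> = {}")
      case True
      \<comment> \<open>Density of the eigenvectors forces the module to be zero.\<close>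
      have z: "x = y" for x y :: "'h ^ 'l option"
        by (rule pairing_total[OF A.M]) (simp add: True)
      have "orthocomp A.S = UNIV" "orthocomp B.S = UNIV"
        using z csubspace_0[OF csubspace_orthocomp] by (metis UNIV_eq_I)+
      then have "intertwining_unitary (entrywise M) A.S B.S (\<lambda>x. x)"
        unfolding intertwining_unitary_def by (auto intro: z)
      then show ?thesis by blast
    next
      case False
      then obtain w0 where w0: "w0 \<in> \<Omega>" by blast
      obtain r e where r: "r > 0" "ball w0 r \<subseteq> \<Omega>"
        and E: "\<And>w. w \<in> ball w0 r \<Longrightarrow> eigenspace_star M w = {c *\<^sub>C e w |c. True}"
        and ee: "\<And>w. w \<in> ball w0 r \<Longrightarrow> cinner (e w) (e w0) = 1"
        and nz: "\<And>w. w \<in> ball w0 r \<Longrightarrow> kern A.\<Delta> w w0 \<noteq> 0" "\<And>w. w \<in> ball w0 r \<Longrightarrow> kern B.\<Delta> w w0 \<noteq> 0"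
        by (rule local_frame[OF w0], rule that)
      have w0b: "w0 \<in> ball w0 r" using r by simp
      have agree: "kernels_agree A.\<Delta> B.\<Delta> w0 w v"
        if wv: "w \<in> ball w0 r" "v \<in> ball w0 r" for w v
      proof (rule normalised_kernels_agree_of_curvature[OF open_ball convex_ball w0b _ _ _ _ _ wv])
        show "mixed_deriv j k (log_norm_fam UNIV A.\<Delta>) w
          = mixed_deriv j k (log_norm_fam UNIV B.\<Delta>) w" if "w \<in> ball w0 r" for w j k
          using curv that r(2) unfolding ld by blast
      qed (use r(2) A.\<Delta>_nonzero B.\<Delta>_nonzero holo2_on_subset A.holo2_\<Delta> B.holo2_\<Delta> in blast)+
      show ?thesis
        by (rule isomorphic_of_normalised_kernels_agree[OF w0b open_ball r(2) E nz agree])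
    qed
  qed
qed

end

theorem corollary3p2:
  fixes \<Omega> :: "(complex ^ 'n::finite) set"
    and M :: "'n \<Rightarrow> 'h::chilbert_space \<Rightarrow> 'h"
    and \<Theta>\<^sub>1 \<Theta>\<^sub>2 :: "complex ^ 'n \<Rightarrow> complex ^ 'l::finite ^ 'l option"
  assumes "open \<Omega>" and "connected \<Omega>"
    and "M \<in> B1_star \<Omega>"
    and "\<Theta>\<^sub>1 \<in> mult_matrices M \<Omega>"
    and "\<exists>\<Psi> \<in> mult_matrices M \<Omega>. left_inverse_on \<Omega> \<Psi> \<Theta>\<^sub>1"
    and "\<Theta>\<^sub>2 \<in> mult_matrices M \<Omega>"
    and "\<exists>\<Psi> \<in> mult_matrices M \<Omega>. left_inverse_on \<Omega> \<Psi> \<Theta>\<^sub>2"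
  shows "isomorphic_modules (quotient_by M \<Omega> \<Theta>\<^sub>1) (quotient_by M \<Omega> \<Theta>\<^sub>2)
    \<longleftrightarrow> (\<forall>w\<in>\<Omega>. \<forall>j k. d_dw j (d_dwbar k (log_norm_det \<Theta>\<^sub>1)) w
                   = d_dw j (d_dwbar k (log_norm_det \<Theta>\<^sub>2)) w)"
proof -
  obtain \<Psi>1 where 1: "\<Psi>1 \<in> mult_matrices M \<Omega>" "left_inverse_on \<Omega> \<Psi>1 \<Theta>\<^sub>1" using assms(5) by blast
  obtain \<Psi>2 where 2: "\<Psi>2 \<in> mult_matrices M \<Omega>" "left_inverse_on \<Omega> \<Psi>2 \<Theta>\<^sub>2" using assms(7) by blast
  interpret two_column_multipliers \<Omega> M \<Theta>\<^sub>1 \<Theta>\<^sub>2 \<Psi>1 \<Psi>2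
    by unfold_locales (rule assms 1 2)+
  show ?thesis by (rule isomorphic_iff_curvature)
qed

end
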